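(* Let $g:\mathbb{N}\to\mathbb{N}_0$ be a non-decreasing genus function, let $\mathcal A^g$ be any one of $\mathcal E^g$, $\mathcal O\mathcal E^g$, $\mathcal N\mathcal E^g$ or $\mathcal O\mathcal E^g\cap\mathcal N\mathcal E^g$, and let $R_n$ be uniformly random in $\mathrm{Minor}(\mathcal A^g)_n$. (a) If $\mathcal A^g$ contains all graphs, then for any $\varepsilon>0$ we have $\tfrac12n<\Delta(R_n)<(\tfrac12+\varepsilon)n$ with very high probability. (b) If $\mathcal A^g$ does not contain all graphs, then for any $\varepsilon>0$ there exists a constant $c>0$ such that $\limsup_{n\to\infty}\mathbb{P}(c\log n\le\Delta(R_n))>1-\varepsilon$.
   Context: All graphs are finite and simple. $\mathcal E^g$ is the class of graphs $G$ such that, if $G$ has $n$ vertices, $G$ embeds in some surface of Euler genus at most $g(n)$; $\mathcal O\mathcal E^g$ / $\mathcal N\mathcal E^g$ require the surface to be orientable / non-orientable. $\mathrm{Minor}(\mathcal A^g)$ is the class of graphs all of whose minors lie in $\mathcal A^g$, and $\mathrm{Minor}(\mathcal A^g)_n$ its graphs on vertex set $[n]$. $\Delta$ is the maximum degree. With very high probability means with probability $1-e^{-\Omega(n)}$. *)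

theory Defs
  imports "HOL-Homology.Homology" "HOL-Probability.Probability"
begin

section \<open>Finite simple graphs and minors\<close>

type_synonym 'a graph = "'a set \<times> 'a set set"

abbreviation verts :: "'a graph \<Rightarrow> 'a set" where "verts G \<equiv> fst G"
abbreviation edges :: "'a graph \<Rightarrow> 'a set set" where "edges G \<equiv> snd G"

definition simple_graph :: "'a graph \<Rightarrow> bool" where
  "simple_graph G \<longleftrightarrow> finite (verts G) \<and> verts G \<noteq> {} \<and>
     (\<forall>e \<in> edges G. e \<subseteq> verts G \<and> card e = 2)"

definition degree :: "'a graph \<Rightarrow> 'a \<Rightarrow> nat" where
  "degree G v = card {e \<in> edges G. v \<in> e}"

definition max_degree :: "'a graph \<Rightarrow> nat" where
  "max_degree G = Max (degree G ` verts G)"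

definition delete_vertex :: "'a \<Rightarrow> 'a graph \<Rightarrow> 'a graph" where
  "delete_vertex v G = (verts G - {v}, {e \<in> edges G. v \<notin> e})"

definition delete_edge :: "'a set \<Rightarrow> 'a graph \<Rightarrow> 'a graph" where
  "delete_edge e G = (verts G, edges G - {e})"

text \<open>Contraction of \<open>{u, v}\<close>: \<open>v\<close> is merged into \<open>u\<close>. Filtering by cardinality discards
  the loop; parallel edges are identified because edges form a set.\<close>

definition contract_edge :: "'a \<Rightarrow> 'a \<Rightarrow> 'a graph \<Rightarrow> 'a graph" where
  "contract_edge u v G =
     (verts G - {v}, {e \<in> (\<lambda>e. (\<lambda>x. if x = v then u else x) ` e) ` edges G. card e = 2})"

text \<open>Minors are not closed under renaming of vertices here. This makes no difference below,
  where they are only tested for membership in isomorphism-closed classes.\<close>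

inductive minor :: "'a graph \<Rightarrow> 'a graph \<Rightarrow> bool" where
  refl: "minor G G"
| delete_vertex: "minor H G \<Longrightarrow> v \<in> verts H \<Longrightarrow> verts H \<noteq> {v} \<Longrightarrow> minor (delete_vertex v H) G"
| delete_edge: "minor H G \<Longrightarrow> e \<in> edges H \<Longrightarrow> minor (delete_edge e H) G"
| contract_edge: "minor H G \<Longrightarrow> {u, v} \<in> edges H \<Longrightarrow> u \<noteq> v \<Longrightarrow> minor (contract_edge u v H) G"

section \<open>Surfaces\<close>

text \<open>Second countability is implied by compactness together with the local condition.\<close>

definition surface :: "'a topology \<Rightarrow> bool" where
  "surface X \<longleftrightarrow> topspace X \<noteq> {} \<and> compact_space X \<and> connected_space X \<and> Hausdorff_space X \<and>
     (\<forall>x \<in> topspace X. \<exists>U. openin X U \<and> x \<in> U \<and>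
        subtopology X U homeomorphic_space Euclidean_space 2)"

text \<open>Rank of an abelian group: the largest \<open>r\<close> such that it has a free abelian subgroup
  of rank \<open>r\<close>. It is used for the homology groups of surfaces only, whose rank is finite.\<close>

definition group_rank :: "'g monoid \<Rightarrow> nat" where
  "group_rank G = Max {r. mon (free_Abelian_group {..<r}) G \<noteq> {}}"

definition betti :: "nat \<Rightarrow> 'a topology \<Rightarrow> nat" where
  "betti p X = group_rank (homology_group (int p) X)"

text \<open>The homology of a surface vanishes above dimension 2.\<close>

definition euler_characteristic :: "'a topology \<Rightarrow> int" where
  "euler_characteristic X = (\<Sum>p\<le>2. (-1) ^ p * int (betti p X))"

definition euler_genus :: "'a topology \<Rightarrow> int" where
  "euler_genus X = 2 - euler_characteristic X"

text \<open>An orientation of a surface selects a generator of the local homology group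
  \<open>H\<^sub>2(X, X - {x})\<close> at each point \<open>x\<close>, in such a way that the selected generators near any
  point are all induced by a single class in some \<open>H\<^sub>2(X, X - U)\<close>.\<close>

definition orientation :: "'a topology \<Rightarrow> ('a \<Rightarrow> 'a chain set) \<Rightarrow> bool" where
  "orientation X \<mu> \<longleftrightarrow>
     (\<forall>x \<in> topspace X.
        \<mu> x \<in> carrier (relative_homology_group 2 X (topspace X - {x})) \<and>
        generate (relative_homology_group 2 X (topspace X - {x})) {\<mu> x} =
          carrier (relative_homology_group 2 X (topspace X - {x}))) \<and>
     (\<forall>x \<in> topspace X. \<exists>U. openin X U \<and> x \<in> U \<and>
        (\<exists>\<alpha> \<in> carrier (relative_homology_group 2 X (topspace X - U)).
           \<forall>y \<in> U. \<mu> y = hom_induced 2 X (topspace X - U) X (topspace X - {y}) id \<alpha>))"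

definition orientable :: "'a topology \<Rightarrow> bool" where
  "orientable X \<longleftrightarrow> (\<exists>\<mu>. orientation X \<mu>)"

section \<open>Embeddings of graphs in surfaces\<close>

text \<open>Vertices are sent to distinct points by \<open>\<phi>\<close>, and every edge \<open>e\<close> to an arc \<open>\<gamma> e\<close> joining
  its two ends. The interior of an arc contains no vertex and meets no other arc.\<close>

definition graph_embedding ::
    "'v graph \<Rightarrow> 'a topology \<Rightarrow> ('v \<Rightarrow> 'a) \<Rightarrow> ('v set \<Rightarrow> real \<Rightarrow> 'a) \<Rightarrow> bool" where
  "graph_embedding G X \<phi> \<gamma> \<longleftrightarrow>
     \<phi> ` verts G \<subseteq> topspace X \<and> inj_on \<phi> (verts G) \<and>
     (\<forall>e \<in> edges G. pathin X (\<gamma> e) \<and> inj_on (\<gamma> e) {0..1} \<and> {\<gamma> e 0, \<gamma> e 1} = \<phi> ` e \<and>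
        \<gamma> e ` {0<..<1} \<inter> \<phi> ` verts G = {}) \<and>
     (\<forall>e \<in> edges G. \<forall>f \<in> edges G. e \<noteq> f \<longrightarrow> \<gamma> e ` {0<..<1} \<inter> \<gamma> f ` {0<..<1} = {})"

definition embeds_in :: "'v graph \<Rightarrow> 'a topology \<Rightarrow> bool" where
  "embeds_in G X \<longleftrightarrow> (\<exists>\<phi> \<gamma>. graph_embedding G X \<phi> \<gamma>)"

section \<open>Graph classes given by a genus function\<close>

text \<open>Every surface has the cardinality of the continuum, so all surfaces occur, up to
  homeomorphism, as topologies on subsets of \<^typ>\<open>nat \<Rightarrow> real\<close>. Likewise all finite graphs occur,
  up to isomorphism, with vertices in \<^typ>\<open>nat\<close>.\<close>

definition genus_class ::
    "((nat \<Rightarrow> real) topology \<Rightarrow> bool) \<Rightarrow> (nat \<Rightarrow> nat) \<Rightarrow> nat graph set" where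
  "genus_class P g = {G. simple_graph G \<and>
     (\<exists>X. surface X \<and> P X \<and> euler_genus X \<le> int (g (card (verts G))) \<and> embeds_in G X)}"

definition E_class :: "(nat \<Rightarrow> nat) \<Rightarrow> nat graph set" where
  "E_class g = genus_class (\<lambda>X. True) g"

definition OE_class :: "(nat \<Rightarrow> nat) \<Rightarrow> nat graph set" where
  "OE_class g = genus_class orientable g"

text \<open>The sphere, as the sphere with zero crosscaps, is admitted in the non-orientable case.
  This matters only where \<open>g n = 0\<close>, since planar graphs embed in every surface; without it
  no graph of such an order \<open>n\<close> would belong to the class.\<close>

definition NE_class :: "(nat \<Rightarrow> nat) \<Rightarrow> nat graph set" where
  "NE_class g = genus_class (\<lambda>X. \<not> orientable X \<or> X homeomorphic_space nsphere 2) g"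

definition Minor :: "nat graph set \<Rightarrow> nat graph set" where
  "Minor \<A> = {G. simple_graph G \<and> (\<forall>H. minor H G \<longrightarrow> H \<in> \<A>)}"

definition labelled :: "nat graph set \<Rightarrow> nat \<Rightarrow> nat graph set" where
  "labelled \<A> n = {G \<in> \<A>. verts G = {1..n}}"

end

(* If the class A contains all graphs, the random graph is the binomial random graph with edge
   probability 1/2. The bounded differences inequality gives the upper bound on the maximum degree
   vertex by vertex; for the lower bound it is applied to the sum of the positive parts of
   2 deg v - (n - 1), whose mean has order n powr (3/2), while it would be at most n if every
   degree were at most n/2.

   Otherwise D = Minor A is a proper minor-closed class, so that its graphs are sparse and
   |D_(n+1)| <= K (n + 1) |D_n| for a constant K. Moreover D is closed under attaching a fan (a path
   all of whose vertices are joined to one old vertex v): a fan can be drawn close to v without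
   changing the surface, and the minors of an extended graph are contained in extensions of minors
   of the graph. Attaching a fan with k vertices to a graph on n vertices all of whose degrees are
   below k yields a graph on n + k vertices in which v can be recovered, and from v the whole fan.
   Counting the n choices of v and comparing with the growth of D shows that the proportion of
   graphs in D_n with maximum degree below k is at most 2 k K^k / n, which tends to 0 for
   k = c log n with c small. *)

theory Submission
  imports Defs "HOL-Real_Asymp.Real_Asymp"
begin

text \<open>Edges are drawn as arbitrary continuous arcs, so nothing tame is available at a vertex.
  Room for a fan is made beside a single edge: an initial piece of it is closed up to a Jordan curve
  whose inside misses the drawing, and the fan is drawn there by chords. Janiszewski's theorem shows
  that points of the curve can be reached from the inside. The path in the fan serves the count. It
  orders the new vertices, so that, up to a factor 2 k, the (n + k)! / n! lists of new labels give
  different graphs. With k pendant leaves, k! lists would coincide and the same comparison would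
  only reach k of order log n / log log n. The growth bound is a double count. A graph on n + 1
  vertices has linearly many pairs of vertices that are twins or adjacent with bounded degrees.
  Deleting a twin or contracting such an edge can be undone in boundedly many ways, and there are
  only (n + 1)^2 pairs. For the lower bound in (a), a single degree exceeds n / 2 with probability
  about 1/2 only, and the degrees are dependent; a sum over all vertices is concentrated enough for
  an exponentially small error.\<close>

section \<open>Arcs in the plane\<close>

text \<open>Infinitely many paths, the n-th one inside \<open>V n\<close>, are run one after the
  other in finite time. The balls force the concatenation to converge to \<open>v\<close>, so it
  becomes a path ending there.\<close>

lemma path_connected_insert_nested:
  fixes v :: "'a::real_normed_vector" and V :: "nat \<Rightarrow> 'a set"
  assumes pc: "\<And>n. path_connected (V n)" and ne: "\<And>n. V n \<noteq> {}"
    and dec: "\<And>n. V (Suc n) \<subseteq> V n" and small: "\<And>n. V n \<subseteq> ball v (1 / Suc n)"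
  shows "path_connected (insert v (V 0))"
proof -
  have dec': "m \<le> n \<Longrightarrow> V n \<subseteq> V m" for m n
    by (rule lift_Suc_antimono_le[of V]) (use dec in auto)
  have "\<exists>x. \<forall>n. x n \<in> V n" using ne by (meson ex_in_conv)
  then obtain x where x: "\<And>n. x n \<in> V n" by blast
  have "\<exists>p. path p \<and> path_image p \<subseteq> V n \<and> pathstart p = x n \<and> pathfinish p = x (Suc n)" for n
    using pc[of n] x[of n] x[of "Suc n"] dec[of n] unfolding path_connected_def by blast
  then obtain p where p: "\<And>n. path (p n)" "\<And>n. path_image (p n) \<subseteq> V n"
    "\<And>n. p n 0 = x n" "\<And>n. p n 1 = x (Suc n)"
    unfolding pathstart_def pathfinish_def by metis
  \<comment> \<open>\<open>p n\<close> is run during the time from n to n + 1, so \<open>q\<close>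
    lives on the half-line.\<close>
  define q where "q s = p (nat \<lfloor>s\<rfloor>) (s - of_int \<lfloor>s\<rfloor>)" for s :: real
  have q_eq: "q s = p n (s - real n)" if "real n \<le> s" "s \<le> real n + 1" for n s
  proof (cases "s = real n + 1")
    case True
    then have "\<lfloor>s\<rfloor> = int n + 1" by linarith
    then have "nat \<lfloor>s\<rfloor> = Suc n" by simp
    then show ?thesis using True p(3,4) \<open>\<lfloor>s\<rfloor> = int n + 1\<close> by (simp add: q_def)
  next
    case False
    then have "\<lfloor>s\<rfloor> = int n" using that by linarith
    then show ?thesis by (simp add: q_def)
  qed
  have cq1: "continuous_on {real n..real n + 1} q" for n
  proof -
    have "continuous_on {real n..real n + 1} (\<lambda>s. p n (s - real n))"
      by (rule continuous_on_compose2[of "{0..1}" "p n"])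
        (use p(1)[of n] in \<open>auto simp: path_def intro!: continuous_intros\<close>)
    then show ?thesis by (rule continuous_on_eq) (use q_eq[of n] in auto)
  qed
  have cq2: "continuous_on {0..real n} q" for n
  proof (induction n)
    case (Suc n)
    have "{0..real (Suc n)} = {0..real n} \<union> {real n..real n + 1}" by auto
    then show ?case using Suc cq1[of n] by (simp add: continuous_on_closed_Un)
  qed simp

  \<comment> \<open>\<open>t / (1 - t)\<close> maps the unit interval without 1 onto the half-line;
    the missing value at 1 is \<open>v\<close>.\<close>
  define h where "h t = (if t < 1 then q (t / (1 - t)) else v)" for t :: real
  have near: "dist v (q s) < 1 / Suc n" if "real n \<le> s" for n s
  proof -
    define m where "m = nat \<lfloor>s\<rfloor>"
    have s: "real m \<le> s" "s \<le> real m + 1" "n \<le> m" using that unfolding m_def by linarith+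
    have "q s \<in> path_image (p m)" using q_eq[OF s(1,2)] s by (auto simp: path_image_def)
    then have "q s \<in> V n" using p(2)[of m] dec'[OF s(3)] by blast
    then have "q s \<in> ball v (1 / Suc n)" using small[of n] by (rule subsetD[rotated])
    then show ?thesis by (simp only: mem_ball)
  qed
  have qV: "q s \<in> V 0" if "0 \<le> s" for s
  proof -
    define m where "m = nat \<lfloor>s\<rfloor>"
    have s: "real m \<le> s" "s \<le> real m + 1" using that unfolding m_def by linarith+
    have "q s \<in> path_image (p m)" using q_eq[OF s(1,2)] s by (auto simp: path_image_def)
    then show ?thesis using p(2)[of m] dec'[of 0 m] by blast
  qed
  have "continuous_on {0..1} h"
  proof (subst continuous_on_eq_continuous_within, intro ballI)
    fix t :: real assume t: "t \<in> {0..1}"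
    show "continuous (at t within {0..1}) h"
    proof (cases "t = 1")
      case True
      have "\<exists>d>0. \<forall>t'\<in>{0..1}. dist t' t < d \<longrightarrow> dist (h t') (h t) < e" if e: "e > 0" for e
      proof -
        obtain n where n: "1 / real (Suc n) < e" using e nat_approx_posE by metis
        have "dist (h t') (h t) < e" if t': "t' \<in> {0..1}" "dist t' t < 1 / (real n + 1)" for t'
        proof (cases "t' = 1")
          case False
          then have "t' < 1" using t' by auto
          \<comment> \<open>So close to 1, the time of \<open>q\<close> is already at least n, where
            \<open>near\<close> applies.\<close>
          have *: "1 - t' < 1 / (real n + 1)" using t' True by (auto simp: dist_real_def)
          then have "(1 - t') * (real n + 1) < 1" by (simp add: field_simps)
          then have "real n * (1 - t') \<le> t'" by (simp add: algebra_simps)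
          then have "real n \<le> t' / (1 - t')" using \<open>t' < 1\<close> by (simp add: field_simps)
          then show ?thesis using near[of n "t' / (1 - t')"] n True \<open>t' < 1\<close> by (simp add: h_def dist_commute)
        qed (use True e in \<open>simp add: h_def\<close>)
        then show ?thesis by (intro exI[of _ "1 / (real n + 1)"]) auto
      qed
      then show ?thesis by (simp add: continuous_within_eps_delta)
    next
      case False
      \<comment> \<open>Below 1 it suffices to look at the interval up to \<open>b\<close>, halfway
        between \<open>t\<close> and 1, on which \<open>t / (1 - t)\<close> is bounded.\<close>
      define b where "b = (t + 1) / 2"
      have b: "t < b" "b < 1" using False t by (auto simp: b_def)
      obtain n where n: "b / (1 - b) \<le> real n" using real_arch_simple by blast
      have "continuous_on {0..b} (\<lambda>t. q (t / (1 - t)))"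
      proof (rule continuous_on_compose2[OF cq2[of n]])
        show "continuous_on {0..b} (\<lambda>t. t / (1 - t))" using b by (intro continuous_intros) auto
        show "(\<lambda>t. t / (1 - t)) ` {0..b} \<subseteq> {0..real n}"
        proof clarsimp
          fix x assume "0 \<le> x" "x \<le> b"
          then have "x / (1 - x) \<le> b / (1 - b)" using b by (intro frac_le) auto
          then show "0 \<le> x / (1 - x) \<and> x / (1 - x) \<le> real n" using n \<open>0 \<le> x\<close> \<open>x \<le> b\<close> b by auto
        qed
      qed
      then have "continuous_on {0..b} h" by (rule continuous_on_eq) (use b in \<open>auto simp: h_def\<close>)
      then have "continuous (at t within {0..b}) h"
        using t b by (simp add: continuous_on_eq_continuous_within)
      moreover have "at t within {0..b} = at t within {0..1}"
        by (rule at_within_nhd[of t "{..<b}"]) (use b in auto)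
      ultimately show ?thesis by simp
    qed
  qed
  then have ph: "path h" by (simp add: path_def)
  have him: "path_image h \<subseteq> insert v (V 0)"
    unfolding path_image_def using qV by (auto simp: h_def)
  have h0: "h 0 = x 0" using q_eq[of 0 0] p(3)[of 0] by (simp add: h_def)
  have "h 1 = v" by (simp add: h_def)
  have "path_component (insert v (V 0)) (x 0) v"
    unfolding path_component_def using ph him h0 \<open>h 1 = v\<close>
    by (metis pathfinish_def pathstart_def)
  moreover have "path_component (insert v (V 0)) (x 0) y" if "y \<in> V 0" for y
    using pc[of 0] that x[of 0] path_component_of_subset[of "V 0" "insert v (V 0)"]
    by (auto simp: path_connected_component)
  ultimately have "\<forall>y \<in> insert v (V 0). path_component (insert v (V 0)) (x 0) y" by auto
  then show ?thesis unfolding path_connected_component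
    by (meson path_component_sym path_component_trans)
qed

text \<open>Janiszewski's theorem for \<open>S\<close> and the complement of \<open>U\<close>, whose
  intersection \<open>S - U\<close> is connected: two points of \<open>U \<inter> D\<close> are
  separated by neither set, hence not by their union. The assumption \<open>comp\<close>, that
  \<open>D\<close> is a component of the complement of \<open>S\<close>, puts the connecting set
  into \<open>D\<close>.\<close>

lemma connected_Int_component_Janiszewski:
  fixes S U D :: "complex set"
  assumes "compact S" "open U" "connected U" "connected (S - U)" "connected D" "D \<inter> S = {}"
    and comp: "\<And>C. connected C \<Longrightarrow> C \<inter> S = {} \<Longrightarrow> C \<inter> D \<noteq> {} \<Longrightarrow> C \<subseteq> D"
  shows "connected (U \<inter> D)"
  unfolding connected_iff_connected_component
proof (intro ballI)
  fix a b assume ab: "a \<in> U \<inter> D" "b \<in> U \<inter> D"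
  have "connected_component (- S) a b"
    unfolding connected_component_def using ab assms by (intro exI[of _ D]) auto
  moreover have "connected_component (- (- U)) a b"
    unfolding connected_component_def using ab assms by (intro exI[of _ U]) auto
  moreover have "connected (S \<inter> - U)" using assms by (simp add: Diff_eq)
  ultimately have "connected_component (- (S \<union> - U)) a b"
    using Janiszewski[of S "- U" a b] assms by auto
  then obtain C where C: "connected C" "C \<subseteq> - (S \<union> - U)" "a \<in> C" "b \<in> C"
    by (auto simp: connected_component_def)
  then have "C \<subseteq> U \<inter> D" using comp[of C] ab by blast
  then show "connected_component (U \<inter> D) a b"
    unfolding connected_component_def using C by blast
qed

text \<open>\<open>v\<close> is approached by pieces \<open>A n\<close> of \<open>S\<close> whose
  removal leaves \<open>S\<close> connected. Around each piece there is a connected open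
  \<open>U n\<close> meeting \<open>S\<close> in that piece only. By
  \<open>connected_Int_component_Janiszewski\<close> the part of \<open>D\<close> in it is path
  connected, and these parts shrink to \<open>v\<close>. The closed set \<open>C\<close> is a
  further obstacle to be avoided.\<close>

lemma accessible_point:
  fixes S D C :: "complex set"
  assumes S: "compact S" and D: "open D" "connected D" "D \<inter> S = {}"
    and comp: "\<And>C. connected C \<Longrightarrow> C \<inter> S = {} \<Longrightarrow> C \<inter> D \<noteq> {} \<Longrightarrow> C \<subseteq> D"
    and A: "\<And>n. connected (A n)" "\<And>n. A n \<noteq> {}" "\<And>n. A (Suc n) \<subseteq> A n" "\<And>n. A n \<subseteq> S"
      "\<And>n. closed (S - A n)" "\<And>n. connected (S - A n)" "\<And>n. A n \<subseteq> ball v (1 / Suc n)"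
      "\<And>n. A n \<subseteq> closure D"
    and C: "closed C" "C \<inter> A 0 = {}"
  obtains U where "open U" "connected U" "A 0 \<subseteq> U" "U \<inter> C = {}" "U \<inter> S = A 0"
    "path_connected (insert v (U \<inter> D))" "U \<inter> D \<noteq> {}"
proof -
  have dec: "m \<le> n \<Longrightarrow> A n \<subseteq> A m" for m n
    by (rule lift_Suc_antimono_le[of A]) (use A(3) in auto)
  \<comment> \<open>The ball provides the shrinking. Cutting out \<open>S - A n\<close> ensures that
    a component of \<open>N n\<close> meets \<open>S\<close> only in \<open>A n\<close>.\<close>
  define N where "N n = ball v (1 / Suc n) - (S - A n) - C" for n
  have oN: "open (N n)" for n unfolding N_def using A(5) C by (intro open_Diff) auto
  have AN: "A n \<subseteq> N n" for n unfolding N_def using A(7)[of n] C dec[of 0 n] by auto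
  have "\<exists>a. \<forall>n. a n \<in> A n" using A(2) by (meson ex_in_conv)
  then obtain a where a: "\<And>n. a n \<in> A n" by blast
  define U where "U n = connected_component_set (N n) (a n)" for n
  have U: "open (U n)" "connected (U n)" "U n \<subseteq> N n" "A n \<subseteq> U n" for n
    unfolding U_def using oN connected_component_maximal[OF a A(1) AN]
    by (auto simp: open_connected_component connected_component_subset)
  have NN: "N (Suc n) \<subseteq> N n" for n
  proof -
    have "ball v (1 / Suc (Suc n)) \<subseteq> ball v (1 / Suc n)" by (intro subset_ball) (simp add: frac_le)
    then show ?thesis unfolding N_def using A(3)[of n] by blast
  qed
  have UU: "U (Suc n) \<subseteq> U n" for n
  proof -
    have "a (Suc n) \<in> connected_component_set (N n) (a n)"
      using a[of "Suc n"] A(3)[of n] U(4)[of n] unfolding U_def by blast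
    \<comment> \<open>The base points of the components differ, but both lie in the same component
      of \<open>N n\<close>; this makes the sets \<open>U n\<close> nested.\<close>
    then have eq: "U n = connected_component_set (N n) (a (Suc n))"
      unfolding U_def by (metis connected_component_eq)
    show ?thesis unfolding eq
    proof (rule connected_component_maximal)
      show "a (Suc n) \<in> U (Suc n)" using a U(4) by blast
      show "U (Suc n) \<subseteq> N n" using U(3)[of "Suc n"] NN[of n] by (rule order_trans)
    qed (rule U(2))
  qed
  have US: "U n \<inter> S = A n" for n using U(3)[of n] U(4)[of n] A(4)[of n] by (auto simp: N_def)
  then have SU: "S - U n = S - A n" for n by blast
  have pc: "path_connected (U n \<inter> D)" for n
    by (intro connected_open_path_connected connected_Int_component_Janiszewski[OF S] open_Int)
      (use U D SU A(6) comp in auto)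
  have ne: "U n \<inter> D \<noteq> {}" for n
  proof -
    have "a n \<in> U n \<inter> closure D" using a A(8) U(4) by blast
    then show ?thesis using open_Int_closure_eq_empty[OF U(1)[of n]] by blast
  qed
  have "path_connected (insert v (U 0 \<inter> D))"
  proof (rule path_connected_insert_nested[of "\<lambda>n. U n \<inter> D"])
    show "U (Suc n) \<inter> D \<subseteq> U n \<inter> D" for n using UU[of n] by blast
    show "U n \<inter> D \<subseteq> ball v (1 / Suc n)" for n using U(3)[of n] by (auto simp: N_def)
  qed (rule pc ne)+
  moreover have "U 0 \<inter> C = {}" using U(3)[of 0] by (auto simp: N_def)
  ultimately show thesis using that[of "U 0"] U US ne by blast
qed

section \<open>Completing an arc to a Jordan curve\<close>

lemma closure_Compl_arc:
  fixes \<sigma> :: "real \<Rightarrow> complex"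
  assumes "arc \<sigma>"
  shows "closure (- path_image \<sigma>) = UNIV"
proof -
  obtain h where h: "homeomorphism {0..1} (path_image \<sigma>) \<sigma> h"
    using homeomorphism_arc[OF assms] by blast
  have "interior (path_image \<sigma>) = {}"
  proof (rule ccontr)
    assume "interior (path_image \<sigma>) \<noteq> {}"
    moreover have "continuous_on (interior (path_image \<sigma>)) h" "inj_on h (interior (path_image \<sigma>))"
      using h interior_subset[of "path_image \<sigma>"]
      by (auto simp: homeomorphism_def intro: continuous_on_subset intro!: inj_on_inverseI[of _ \<sigma>])
    \<comment> \<open>The inverse parametrisation would embed a nonempty open set of the plane into
      the line.\<close>
    ultimately show False using invariance_of_dimension[of "interior (path_image \<sigma>)" h] by simp
  qed
  then show ?thesis by (simp add: closure_complement)
qed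

lemma arc_shrinking_parameters:
  fixes \<sigma> :: "real \<Rightarrow> complex"
  assumes "arc \<sigma>"
  obtains s :: "nat \<Rightarrow> real" where "\<And>n. 0 < s n" "\<And>n. s n < 1" "\<And>n. s (Suc n) \<le> s n"
    "\<And>n t. 0 \<le> t \<Longrightarrow> t < s n \<Longrightarrow> \<sigma> t \<in> ball (\<sigma> 0) (1 / Suc n)"
proof -
  have c: "continuous_on {0..1} \<sigma>" using assms by (simp add: arc_def path_def)
  have ex: "\<exists>d>0. d < 1 \<and> (\<forall>t. 0 \<le> t \<longrightarrow> t < d \<longrightarrow> \<sigma> t \<in> ball (\<sigma> 0) (1 / Suc n))" for n
  proof -
    obtain d where "d > 0" "\<forall>t\<in>{0..1}. dist t 0 < d \<longrightarrow> dist (\<sigma> t) (\<sigma> 0) < 1 / Suc n"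
      using c[unfolded continuous_on_iff, rule_format, of 0 "1 / Suc n"] by auto
    then show ?thesis by (intro exI[of _ "min d (1/2)"]) (auto simp: dist_commute dist_real_def)
  qed
  have "\<exists>s. \<forall>n. (0 < s n \<and> s n < 1 \<and> (\<forall>t. 0 \<le> t \<longrightarrow> t < s n \<longrightarrow> \<sigma> t \<in> ball (\<sigma> 0) (1 / Suc n))) \<and> s (Suc n) \<le> s n"
  proof (rule dependent_nat_choice)
    fix s :: real and n assume s: "0 < s \<and> s < 1 \<and> (\<forall>t. 0 \<le> t \<longrightarrow> t < s \<longrightarrow> \<sigma> t \<in> ball (\<sigma> 0) (1 / Suc n))"
    obtain d where "d > 0" "d < 1" "\<forall>t. 0 \<le> t \<longrightarrow> t < d \<longrightarrow> \<sigma> t \<in> ball (\<sigma> 0) (1 / Suc (Suc n))"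
      using ex[of "Suc n"] by blast
    then show "\<exists>s'. (0 < s' \<and> s' < 1 \<and> (\<forall>t. 0 \<le> t \<longrightarrow> t < s' \<longrightarrow> \<sigma> t \<in> ball (\<sigma> 0) (1 / Suc (Suc n)))) \<and> s' \<le> s"
      using s by (intro exI[of _ "min d s"]) auto
  qed (use ex[of 0] in auto)
  then show thesis using that by blast
qed

lemma arc_image_Diff:
  assumes "arc \<sigma>" "S \<subseteq> {0..1}" "T \<subseteq> {0..1}"
  shows "\<sigma> ` S - \<sigma> ` T = \<sigma> ` (S - T)"
  using assms by (intro inj_on_image_set_diff[symmetric]) (auto simp: arc_def)

text \<open>\<open>accessible_point\<close> for the half-open initial pieces of the arc: what
  remains after removing one is a closed subarc, hence connected. The complement of the arc is
  connected and serves as the component \<open>D\<close>.\<close>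

lemma arc_endpoint_accessible:
  fixes \<sigma> :: "real \<Rightarrow> complex"
  assumes \<sigma>: "arc \<sigma>"
  shows "path_connected (insert (pathstart \<sigma>) (- path_image \<sigma>))"
proof -
  obtain s :: "nat \<Rightarrow> real" where s: "\<And>n. 0 < s n" "\<And>n. s n < 1" "\<And>n. s (Suc n) \<le> s n"
    "\<And>n t. 0 \<le> t \<Longrightarrow> t < s n \<Longrightarrow> \<sigma> t \<in> ball (\<sigma> 0) (1 / Suc n)"
    using arc_shrinking_parameters[OF \<sigma>] by blast
  have c: "continuous_on {0..1} \<sigma>" using \<sigma> by (simp add: arc_def path_def)
  define A where "A n = \<sigma> ` {0..<s n}" for n
  have diff: "path_image \<sigma> - A n = \<sigma> ` {s n..1}" for n
  proof -
    have eq: "{0..1} - {0..<s n} = {s n..1}" and sub: "{0..<s n} \<subseteq> {0..1}"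
      using s(1,2)[of n] by auto
    show ?thesis unfolding A_def path_image_def
      by (rule arc_image_Diff[OF \<sigma> order_refl sub, unfolded eq])
  qed
  have cA: "connected (A n)" "connected (path_image \<sigma> - A n)" "closed (path_image \<sigma> - A n)" for n
    unfolding diff unfolding A_def using s(1,2)[of n]
    by (auto intro!: connected_continuous_image continuous_on_subset[OF c] compact_imp_closed compact_continuous_image)
  have "2 \<le> DIM(complex)" by simp
  then have pcC: "path_connected (- path_image \<sigma>)" using path_connected_arc_complement[OF \<sigma>] by blast
  obtain U where U: "path_connected (insert (\<sigma> 0) (U \<inter> - path_image \<sigma>))" "U \<inter> - path_image \<sigma> \<noteq> {}"
  proof (rule accessible_point[of "path_image \<sigma>" "- path_image \<sigma>" A "\<sigma> 0" "{}"])
    show "compact (path_image \<sigma>)" "open (- path_image \<sigma>)"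
      using \<sigma> by (auto simp: compact_arc_image closed_arc_image)
    show "connected (- path_image \<sigma>)" using pcC by (rule path_connected_imp_connected)
    show "A n \<noteq> {}" for n using s(1)[of n] by (auto simp: A_def)
    show "A (Suc n) \<subseteq> A n" for n using s(3)[of n] by (auto simp: A_def)
    show "A n \<subseteq> path_image \<sigma>" for n using s(2)[of n] by (auto simp: A_def path_image_def)
    show "A n \<subseteq> ball (\<sigma> 0) (1 / Suc n)" for n using s(4)[of _ n] unfolding A_def by auto
    show "A n \<subseteq> closure (- path_image \<sigma>)" for n using closure_Compl_arc[OF \<sigma>] by simp
  qed (use cA in auto)
  have "path_connected (insert (\<sigma> 0) (U \<inter> - path_image \<sigma>) \<union> - path_image \<sigma>)"
    by (rule path_connected_Un[OF U(1) pcC]) (use U(2) in auto)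
  moreover have "insert (\<sigma> 0) (U \<inter> - path_image \<sigma>) \<union> - path_image \<sigma> = insert (pathstart \<sigma>) (- path_image \<sigma>)"
    by (auto simp: pathstart_def)
  ultimately show ?thesis by simp
qed

text \<open>Both ends are accessible from the connected complement, so an arc through the complement
  joins them.\<close>

lemma arc_closes_up:
  fixes \<sigma> :: "real \<Rightarrow> complex"
  assumes \<sigma>: "arc \<sigma>"
  obtains \<tau> where "arc \<tau>" "pathstart \<tau> = pathstart \<sigma>" "pathfinish \<tau> = pathfinish \<sigma>"
    "path_image \<sigma> \<inter> path_image \<tau> = {pathstart \<sigma>, pathfinish \<sigma>}"
proof -
  let ?a = "pathstart \<sigma>" and ?b = "pathfinish \<sigma>" and ?N = "- path_image \<sigma>"
  have ne: "?N \<noteq> {}" using closure_Compl_arc[OF \<sigma>] by auto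
  have "path_connected (insert ?a ?N)" "path_connected (insert ?b ?N)"
    using arc_endpoint_accessible[OF \<sigma>] arc_endpoint_accessible[of "reversepath \<sigma>"] \<sigma>
    by (auto simp: arc_reversepath)
  then have "path_connected (insert ?a ?N \<union> insert ?b ?N)" by (rule path_connected_Un) (use ne in auto)
  moreover have "?a \<noteq> ?b" using arc_distinct_ends[OF \<sigma>] by simp
  ultimately obtain \<tau> where \<tau>: "arc \<tau>" "path_image \<tau> \<subseteq> insert ?a ?N \<union> insert ?b ?N" "pathstart \<tau> = ?a" "pathfinish \<tau> = ?b"
    unfolding path_connected_arcwise by (metis UnI1 UnI2 insertI1)
  then have "path_image \<sigma> \<inter> path_image \<tau> = {?a, ?b}"
    using pathstart_in_path_image[of \<tau>] pathfinish_in_path_image[of \<tau>]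
      pathstart_in_path_image[of \<sigma>] pathfinish_in_path_image[of \<sigma>] by auto
  then show thesis using that \<tau> by blast
qed

text \<open>A Jordan curve kept as two arcs with common ends. The common start will carry the centre
  of the fan, and the first arc is the side along which the path of the fan is drawn.\<close>

definition theta_pair :: "(real \<Rightarrow> complex) \<Rightarrow> (real \<Rightarrow> complex) \<Rightarrow> bool" where
  "theta_pair \<sigma> \<tau> \<longleftrightarrow> arc \<sigma> \<and> arc \<tau> \<and> pathstart \<tau> = pathstart \<sigma> \<and> pathfinish \<tau> = pathfinish \<sigma> \<and>
     path_image \<sigma> \<inter> path_image \<tau> = {pathstart \<sigma>, pathfinish \<sigma>}"

lemma theta_pair_loop:
  assumes "theta_pair \<sigma> \<tau>"
  shows "simple_path (\<sigma> +++ reversepath \<tau>)" "pathfinish (\<sigma> +++ reversepath \<tau>) = pathstart (\<sigma> +++ reversepath \<tau>)"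
    "path_image (\<sigma> +++ reversepath \<tau>) = path_image \<sigma> \<union> path_image \<tau>"
  using assms unfolding theta_pair_def
  by (auto simp: arc_reversepath path_image_join intro!: simple_path_join_loop)

text \<open>The Jordan curve theorem in the form that \<open>accessible_point\<close> consumes; the
  last clause says that the inside is a component of the complement.\<close>

lemma theta_pair_inside:
  assumes "theta_pair \<sigma> \<tau>"
  defines "J \<equiv> path_image \<sigma> \<union> path_image \<tau>"
  shows "compact J" "inside J \<noteq> {}" "open (inside J)" "connected (inside J)" "bounded (inside J)"
    "inside J \<subseteq> - J" "frontier (inside J) = J"
    "\<And>C. connected C \<Longrightarrow> C \<inter> J = {} \<Longrightarrow> C \<inter> inside J \<noteq> {} \<Longrightarrow> C \<subseteq> inside J"
proof -
  note L = theta_pair_loop[OF assms(1)]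
  note I = Jordan_inside_outside[OF L(1,2), unfolded L(3), folded J_def]
  show "inside J \<noteq> {}" "open (inside J)" "connected (inside J)" "bounded (inside J)"
    "frontier (inside J) = J" using I by auto
  show "inside J \<subseteq> - J" using inside_no_overlap[of J] by blast
  show "compact J" unfolding J_def using assms(1) by (auto simp: theta_pair_def compact_arc_image)
  fix C assume C: "connected C" "C \<inter> J = {}" "C \<inter> inside J \<noteq> {}"
  have "inside J \<inter> C = {} \<or> outside J \<inter> C = {}"
    using connectedD[OF C(1), of "inside J" "outside J"] I C(2) by blast
  then show "C \<subseteq> inside J" using I C by blast
qed

text \<open>The pieces of \<open>\<sigma>\<close> omit the start point, because \<open>C\<close> may
  contain it. What remains of the curve is the other arc together with the rest of
  \<open>\<sigma>\<close>, joined at the far end.\<close>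

lemma theta_pair_accessible:
  assumes \<sigma>\<tau>: "theta_pair \<sigma> \<tau>" and C: "closed C" "C \<inter> \<sigma> ` {0<..<1} = {}"
  defines "J \<equiv> path_image \<sigma> \<union> path_image \<tau>"
  obtains U s where "0 < s" "s < 1" "open U" "connected U" "\<sigma> ` {0<..<s} \<subseteq> U" "U \<inter> C = {}"
    "U \<inter> J = \<sigma> ` {0<..<s}" "path_connected (insert (pathstart \<sigma>) (U \<inter> inside J))" "U \<inter> inside J \<noteq> {}"
proof -
  have \<sigma>: "arc \<sigma>" and \<tau>: "arc \<tau>" using \<sigma>\<tau> by (auto simp: theta_pair_def)
  have ends: "path_image \<sigma> \<inter> path_image \<tau> = {\<sigma> 0, \<sigma> 1}" "\<tau> 0 = \<sigma> 0" "\<tau> 1 = \<sigma> 1"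
    using \<sigma>\<tau> by (auto simp: theta_pair_def pathstart_def pathfinish_def)
  obtain s :: "nat \<Rightarrow> real" where s: "\<And>n. 0 < s n" "\<And>n. s n < 1" "\<And>n. s (Suc n) \<le> s n"
    "\<And>n t. 0 \<le> t \<Longrightarrow> t < s n \<Longrightarrow> \<sigma> t \<in> ball (\<sigma> 0) (1 / Suc n)"
    using arc_shrinking_parameters[OF \<sigma>] by blast
  have c: "continuous_on {0..1} \<sigma>" using \<sigma> by (simp add: arc_def path_def)
  have inj: "inj_on \<sigma> {0..1}" using \<sigma> by (simp add: arc_def)
  define A where "A n = \<sigma> ` {0<..<s n}" for n
  have diff: "J - A n = path_image \<tau> \<union> \<sigma> ` {s n..1}" for n
  proof -
    have "path_image \<sigma> - A n = \<sigma> ` ({0} \<union> {s n..1})"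
    proof -
      have eq: "{0..1} - {0<..<s n} = {0} \<union> {s n..1}" and sub: "{0<..<s n} \<subseteq> {0..1}"
        using s(1,2)[of n] by auto
      show ?thesis unfolding A_def path_image_def
        by (rule arc_image_Diff[OF \<sigma> order_refl sub, unfolded eq])
    qed
    moreover have "path_image \<tau> \<inter> A n = {}"
    proof -
      have "\<sigma> 0 \<notin> A n" "\<sigma> 1 \<notin> A n" unfolding A_def
        using inj_onD[OF inj, of 0] inj_onD[OF inj, of 1] s(2)[of n] by fastforce+
      moreover have "A n \<subseteq> path_image \<sigma>" unfolding A_def path_image_def using s(2)[of n] by auto
      then have "path_image \<tau> \<inter> A n \<subseteq> {\<sigma> 0, \<sigma> 1}" unfolding ends(1)[symmetric] by auto
      ultimately show ?thesis by auto
    qed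
    moreover have "\<sigma> 0 \<in> path_image \<tau>" using ends(1) by blast
    ultimately show ?thesis unfolding J_def by auto
  qed
  have c1: "connected (path_image \<tau> \<union> \<sigma> ` {s n..1})" for n
  proof (rule connected_Un)
    show "connected (path_image \<tau>)" using \<tau> by (simp add: connected_arc_image)
    show "connected (\<sigma> ` {s n..1})" using s(1)[of n]
      by (auto intro!: connected_continuous_image continuous_on_subset[OF c])
    have "\<sigma> 1 \<in> \<sigma> ` {s n..1}" using s(2)[of n] by auto
    then show "path_image \<tau> \<inter> \<sigma> ` {s n..1} \<noteq> {}" using ends(1) by blast
  qed
  have c2: "closed (path_image \<tau> \<union> \<sigma> ` {s n..1})" for n
    using \<tau> s(1)[of n]
    by (auto simp: compact_arc_image intro!: compact_Un compact_imp_closed compact_continuous_image continuous_on_subset[OF c])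
  have AJ: "A n \<subseteq> J" for n using s(2)[of n] by (auto simp: A_def J_def path_image_def)
  note I = theta_pair_inside[OF \<sigma>\<tau>, folded J_def]
  obtain U where U: "open U" "connected U" "A 0 \<subseteq> U" "U \<inter> C = {}" "U \<inter> J = A 0"
    "path_connected (insert (\<sigma> 0) (U \<inter> inside J))" "U \<inter> inside J \<noteq> {}"
  proof (rule accessible_point[of J "inside J" A "\<sigma> 0" C])
    show "connected (A n)" for n unfolding A_def using s(2)[of n]
      by (auto intro!: connected_continuous_image continuous_on_subset[OF c])
    show "A n \<noteq> {}" for n using s(1)[of n] by (auto simp: A_def)
    show "A (Suc n) \<subseteq> A n" for n using s(3)[of n] by (auto simp: A_def)
    show "A n \<subseteq> ball (\<sigma> 0) (1 / Suc n)" for n using s(4)[of _ n] unfolding A_def by auto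
    show "A n \<subseteq> closure (inside J)" for n using I(7) AJ[of n] by (auto simp: frontier_def)
    show "C \<inter> A 0 = {}" using C(2) s(2)[of 0] by (auto simp: A_def)
  qed (use I C(1) AJ c1 c2 diff in auto)
  then show thesis using that[of "s 0" U] s unfolding A_def pathstart_def by auto
qed

text \<open>Any point can be made the common start of the two arcs: the curve is cut anew at
  \<open>v\<close> and at some other point.\<close>

lemma inside_simple_closed_curve_accessible:
  assumes "theta_pair \<sigma> \<tau>" "v \<in> path_image \<sigma> \<union> path_image \<tau>"
  shows "path_connected (insert v (inside (path_image \<sigma> \<union> path_image \<tau>)))"
proof -
  let ?J = "path_image \<sigma> \<union> path_image \<tau>"
  note L = theta_pair_loop[OF assms(1)]
  have "pathfinish \<sigma> \<noteq> pathstart \<sigma>" using assms(1) arc_distinct_ends by (auto simp: theta_pair_def)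
  then obtain w where w: "w \<in> ?J" "w \<noteq> v"
    using pathfinish_in_path_image[of \<sigma>] pathstart_in_path_image[of \<sigma>] by (metis UnI1)
  obtain u d where ud: "arc u" "arc d" "pathstart u = v" "pathfinish u = w"
                    "pathstart d = w" "pathfinish d = v"
                    "(path_image u) \<inter> (path_image d) = {v,w}"
                    "(path_image u) \<union> (path_image d) = ?J"
    by (rule exists_double_arc[OF L(1,2), unfolded L(3), OF assms(2) w(1) w(2)[symmetric]])
  have "theta_pair u (reversepath d)" using ud by (auto simp: theta_pair_def arc_reversepath)
  from theta_pair_accessible[OF this, of "{}"]
  obtain U where U: "path_connected (insert v (U \<inter> inside ?J))" "U \<inter> inside ?J \<noteq> {}"
    unfolding path_image_reversepath ud(8) ud(3) by (metis closed_empty inf_bot_left)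
  have "path_connected (inside ?J)" using theta_pair_inside[OF assms(1)] connected_open_path_connected by blast
  then have "path_connected (insert v (U \<inter> inside ?J) \<union> inside ?J)"
    using path_connected_Un[OF U(1)] U(2) by blast
  moreover have "insert v (U \<inter> inside ?J) \<union> inside ?J = insert v (inside ?J)" by blast
  ultimately show ?thesis by simp
qed

lemma chord_exists:
  assumes "theta_pair \<sigma> \<tau>" "a \<in> path_image \<sigma> \<union> path_image \<tau>" "b \<in> path_image \<sigma> \<union> path_image \<tau>" "a \<noteq> b"
  obtains c where "arc c" "pathstart c = a" "pathfinish c = b"
    "path_image c - {a, b} \<subseteq> inside (path_image \<sigma> \<union> path_image \<tau>)"
proof -
  let ?I = "inside (path_image \<sigma> \<union> path_image \<tau>)"
  have "path_connected (insert a ?I \<union> insert b ?I)"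
    using inside_simple_closed_curve_accessible[OF assms(1,2)] inside_simple_closed_curve_accessible[OF assms(1,3)]
      theta_pair_inside(2)[OF assms(1)] by (intro path_connected_Un) auto
  then obtain c where "arc c" "path_image c \<subseteq> insert a ?I \<union> insert b ?I" "pathstart c = a" "pathfinish c = b"
    unfolding path_connected_arcwise using \<open>a \<noteq> b\<close> by (metis UnI1 UnI2 insertI1)
  then show thesis using that by blast
qed

text \<open>The arc \<open>\<beta>\<close> runs beside an initial piece of \<open>\<sigma>\<close>,
  so close that it meets \<open>C\<close> at most in its ends. It is found inside a Jordan curve
  completing \<open>\<sigma>\<close>, within the neighbourhood \<open>U\<close> of the initial
  piece.\<close>

lemma arc_closes_up_avoiding:
  fixes \<sigma> :: "real \<Rightarrow> complex"
  assumes \<sigma>: "arc \<sigma>" and C: "closed C" "C \<inter> \<sigma> ` {0<..<1} = {}"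
  obtains s \<beta> where "0 < s" "s < 1" "arc \<beta>" "pathstart \<beta> = \<sigma> 0" "pathfinish \<beta> = \<sigma> s"
    "path_image \<beta> \<inter> path_image \<sigma> = {\<sigma> 0, \<sigma> s}" "(path_image \<beta> - {\<sigma> 0, \<sigma> s}) \<inter> C = {}"
proof -
  obtain \<tau> where "arc \<tau>" "pathstart \<tau> = pathstart \<sigma>" "pathfinish \<tau> = pathfinish \<sigma>"
    "path_image \<sigma> \<inter> path_image \<tau> = {pathstart \<sigma>, pathfinish \<sigma>}"
    using arc_closes_up[OF \<sigma>] by blast
  then have th: "theta_pair \<sigma> \<tau>" using \<sigma> by (simp add: theta_pair_def)
  define J where "J = path_image \<sigma> \<union> path_image \<tau>"
  obtain U s where U: "0 < s" "s < 1" "open U" "connected U" "\<sigma> ` {0<..<s} \<subseteq> U" "U \<inter> C = {}"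
    "U \<inter> J = \<sigma> ` {0<..<s}" "path_connected (insert (\<sigma> 0) (U \<inter> inside J))" "U \<inter> inside J \<noteq> {}"
    using theta_pair_accessible[OF th C] unfolding J_def pathstart_def by metis
  note I = theta_pair_inside[OF th, folded J_def]
  define D where "D = U \<inter> inside J"
  have oD: "open D" unfolding D_def using U(3) I(3) by blast
  obtain x where x: "x \<in> D" using U(9) by (auto simp: D_def)
  have "\<sigma> (s/2) \<in> U" using U(1,5) by auto
  have s2: "\<sigma> (s/2) \<in> J" using U(1,2) by (auto simp: J_def path_image_def)
  have "path_connected U" using U(3,4) connected_open_path_connected by blast
  \<comment> \<open>\<open>q\<close> leads from \<open>D\<close> to a point of
    \<open>\<sigma>\<close> without leaving \<open>U\<close>. Its first exit from \<open>D\<close>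
    lies in \<open>U\<close> and on the boundary of the inside, hence on the initial piece of
    \<open>\<sigma>\<close>.\<close>
  then obtain q where q: "path q" "path_image q \<subseteq> U" "pathstart q = x" "pathfinish q = \<sigma> (s/2)"
    using x \<open>\<sigma> (s/2) \<in> U\<close> unfolding path_connected_def D_def by blast
  have "pathfinish q \<notin> D" using s2 q(4) I(6) unfolding D_def by auto
  moreover have "pathstart q \<in> closure D" using x q(3) closure_subset by auto
  ultimately obtain h where h: "path h" "pathstart h = pathstart q" "path_image h \<subseteq> path_image q"
    "path_image h - {pathfinish h} \<subseteq> interior D" "pathfinish h \<in> frontier D"
    using exists_path_subpath_to_frontier[OF q(1)] by blast
  have hU: "pathfinish h \<in> U" using h(3) q(2) by blast
  have "pathfinish h \<notin> D" using h(5) oD by (auto simp: frontier_def interior_open)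
  moreover have "pathfinish h \<in> closure (inside J)"
    using h(5) closure_mono[of D "inside J"] by (auto simp: frontier_def D_def)
  ultimately have "pathfinish h \<in> J" using hU I(3,7) by (auto simp: frontier_def D_def interior_open)
  then have "pathfinish h \<in> \<sigma> ` {0<..<s}" using hU U(7) by (metis IntI)
  then obtain r where r: "0 < r" "r < s" "pathfinish h = \<sigma> r" by auto
  \<comment> \<open>Up to its last point \<open>h\<close> runs in \<open>D\<close>, and the start of
    \<open>\<sigma>\<close> is accessible from \<open>D\<close>. So these sets together contain an
    arc from \<open>\<sigma> 0\<close> to \<open>\<sigma> r\<close>.\<close>
  have "path_connected (insert (\<sigma> 0) D \<union> path_image h)"
    using U(8) h(1,2) q(3) x pathstart_in_path_image[of h]
    by (intro path_connected_Un) (auto simp: D_def path_connected_path_image)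
  moreover have "\<sigma> r \<in> path_image h" using r pathfinish_in_path_image[of h] by simp
  moreover have ne: "\<sigma> 0 \<noteq> \<sigma> r" using \<sigma> r U(2) inj_onD[of \<sigma> "{0..1}" 0 r] by (auto simp: arc_def)
  ultimately obtain \<beta> where \<beta>: "arc \<beta>" "path_image \<beta> \<subseteq> insert (\<sigma> 0) D \<union> path_image h"
    "pathstart \<beta> = \<sigma> 0" "pathfinish \<beta> = \<sigma> r"
    unfolding path_connected_arcwise by (metis UnCI insertI1)
  have "path_image \<beta> \<subseteq> insert (\<sigma> 0) (insert (\<sigma> r) D)"
    using \<beta>(2) h(4) r(3) oD by (auto simp: interior_open)
  moreover have "D \<inter> path_image \<sigma> = {}" "D \<inter> C = {}" using I(6) U(6) by (auto simp: D_def J_def)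
  moreover have "\<sigma> 0 \<in> path_image \<sigma>" "\<sigma> r \<in> path_image \<sigma>" using r U(2) by (auto simp: path_image_def)
  moreover have "\<sigma> 0 \<in> path_image \<beta>" "\<sigma> r \<in> path_image \<beta>"
    using \<beta>(3,4) pathstart_in_path_image[of \<beta>] pathfinish_in_path_image[of \<beta>] by auto
  ultimately have "path_image \<beta> \<inter> path_image \<sigma> = {\<sigma> 0, \<sigma> r}" "(path_image \<beta> - {\<sigma> 0, \<sigma> r}) \<inter> C = {}"
    by blast+
  then show thesis using that[of r \<beta>] r U(2) \<beta> by auto
qed

text \<open>Induction from the outside inwards. The chord from the start to the midpoint of
  \<open>\<beta>\<close> is the last spoke. With the first half of \<open>\<beta>\<close> it forms a
  smaller Jordan curve, in which the other spokes are found.\<close>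

lemma fan_in_theta_pair:
  assumes "theta_pair \<beta> \<delta>"
  shows "\<exists>(t :: nat \<Rightarrow> real) c. (\<forall>i<k. 0 < t i \<and> t i < 1 \<and> arc (c i) \<and> pathstart (c i) = pathstart \<beta> \<and>
      pathfinish (c i) = \<beta> (t i) \<and>
      path_image (c i) - {pathstart \<beta>, \<beta> (t i)} \<subseteq> inside (path_image \<beta> \<union> path_image \<delta>)) \<and>
    (\<forall>i<k. \<forall>j<k. i < j \<longrightarrow> t i < t j \<and> path_image (c i) \<inter> path_image (c j) = {pathstart \<beta>})"
  using assms
proof (induction k arbitrary: \<beta> \<delta>)
  case (Suc k)
  note th = Suc.prems
  let ?v = "pathstart \<beta>" and ?h = "1/2 :: real"
  let ?J = "path_image \<beta> \<union> path_image \<delta>"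
  have \<beta>: "arc \<beta>" and \<delta>: "arc \<delta>" and \<delta>e: "pathstart \<delta> = ?v" "pathfinish \<delta> = pathfinish \<beta>"
    and int: "path_image \<beta> \<inter> path_image \<delta> = {?v, pathfinish \<beta>}" using th by (auto simp: theta_pair_def)
  have inj: "inj_on \<beta> {0..1}" using \<beta> by (simp add: arc_def)
  have vh: "?v \<noteq> \<beta> ?h" using inj_onD[OF inj, of 0 ?h] by (auto simp: pathstart_def)
  have hJ: "\<beta> ?h \<in> ?J" "?v \<in> ?J" by (auto simp: path_image_def pathstart_def)
  obtain c where c: "arc c" "pathstart c = ?v" "pathfinish c = \<beta> ?h" "path_image c - {?v, \<beta> ?h} \<subseteq> inside ?J"
    using chord_exists[OF th hJ(2,1) vh] by blast
  note I = theta_pair_inside[OF th]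
  define b1 where "b1 = subpath 0 ?h \<beta>"
  define b2 where "b2 = subpath ?h 1 \<beta>"
  have b1: "arc b1" "pathstart b1 = ?v" "pathfinish b1 = \<beta> ?h" "path_image b1 = \<beta> ` {0..?h}"
    using \<beta> arc_subpath_arc[of \<beta> 0 ?h] by (auto simp: b1_def path_image_subpath pathstart_def[of \<beta>])
  have b2: "arc b2" "pathstart b2 = \<beta> ?h" "pathfinish b2 = pathfinish \<beta>" "path_image b2 = \<beta> ` {?h..1}"
    using \<beta> arc_subpath_arc[of \<beta> ?h 1] by (auto simp: b2_def path_image_subpath pathfinish_def[of \<beta>])
  have b12: "path_image b1 \<inter> path_image b2 = {\<beta> ?h}"
  proof -
    have "\<beta> ` {0..?h} \<inter> \<beta> ` {?h..1} = \<beta> ` ({0..?h} \<inter> {?h..1})"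
      by (rule inj_on_image_Int[OF inj, symmetric]) auto
    moreover have "{0..?h} \<inter> {?h..1} = {?h}" by auto
    ultimately show ?thesis by (simp add: b1 b2)
  qed
  have b12u: "path_image b1 \<union> path_image b2 = path_image \<beta>"
  proof -
    have "{0..1} = {0..?h} \<union> {?h..1}" by auto
    then show ?thesis unfolding b1 b2 path_image_def[of \<beta>] by (metis image_Un)
  qed
  have vb2: "?v \<notin> path_image b2"
  proof
    assume "?v \<in> path_image b2"
    then obtain t where "?h \<le> t" "t \<le> 1" "\<beta> t = \<beta> 0" by (auto simp: b2 pathstart_def)
    then show False using inj_onD[OF inj, of t 0] by auto
  qed
  have eb1: "pathfinish \<beta> \<notin> path_image b1"
  proof
    assume "pathfinish \<beta> \<in> path_image b1"
    then obtain t where "0 \<le> t" "t \<le> ?h" "\<beta> t = \<beta> 1" by (auto simp: b1 pathfinish_def)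
    then show False using inj_onD[OF inj, of t 1] by auto
  qed
  have eb2: "pathfinish \<beta> \<in> path_image b2" using b2(3) pathfinish_in_path_image by metis
  have vb1: "?v \<in> path_image b1" using b1(2) pathstart_in_path_image by metis
  have hb: "\<beta> ?h \<in> path_image b1" "\<beta> ?h \<in> path_image b2"
    using b1(3) b2(2) pathfinish_in_path_image pathstart_in_path_image by metis+
  define e where "e = \<delta> +++ reversepath b2"
  have b1s: "path_image b1 \<subseteq> path_image \<beta>" and b2s: "path_image b2 \<subseteq> path_image \<beta>" using b12u by auto
  have d2: "\<And>x. x \<in> path_image \<delta> \<Longrightarrow> x \<in> path_image \<beta> \<Longrightarrow> x = ?v \<or> x = pathfinish \<beta>" using int by auto
  have ed: "pathfinish \<beta> \<in> path_image \<delta>" "?v \<in> path_image \<delta>" using int by auto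
  have db2: "path_image \<delta> \<inter> path_image b2 = {pathfinish \<beta>}" using d2 b2s vb2 eb2 ed by fast
  have e: "arc e" "pathstart e = ?v" "pathfinish e = \<beta> ?h" "path_image e = path_image \<delta> \<union> path_image b2"
    unfolding e_def using \<delta> \<delta>e b2 db2 by (auto simp: arc_reversepath path_image_join intro!: arc_join)
  have cJ: "path_image c \<inter> ?J = {?v, \<beta> ?h}"
    using c I(6) hJ pathstart_in_path_image[of c] pathfinish_in_path_image[of c] by auto
  have cJ': "\<And>x. x \<in> path_image c \<Longrightarrow> x \<in> ?J \<Longrightarrow> x = ?v \<or> x = \<beta> ?h" using cJ by auto
  have cc: "?v \<in> path_image c" "\<beta> ?h \<in> path_image c" using cJ by auto
  have c1: "path_image b1 \<inter> path_image c = {?v, \<beta> ?h}" using cJ' cc b1s vb1 hb by fast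
  have c2: "path_image e \<inter> path_image c = {?v, \<beta> ?h}"
    unfolding e(4) using cJ' cc b2s hb ed by fast
  have c3: "path_image b1 \<inter> path_image e = {?v, \<beta> ?h}"
    unfolding e(4) Int_Un_distrib b12 using d2 b1s eb1 vb1 hb ed by fast
  have Ju: "path_image b1 \<union> path_image e = ?J" using e(4) b12u by blast
  obtain x where "x \<in> path_image c" "x \<noteq> ?v" "x \<noteq> \<beta> ?h"
  proof -
    have "c (1/2) \<in> path_image c" by (auto simp: path_image_def)
    moreover have "inj_on c {0..1}" using c(1) by (simp add: arc_def)
    then have "c (1/2) \<noteq> c 0" "c (1/2) \<noteq> c 1"
      using inj_onD[of c "{0..1}" "1/2" 0] inj_onD[of c "{0..1}" "1/2" 1] by auto
    ultimately show thesis using that c(2,3) by (auto simp: pathstart_def pathfinish_def)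
  qed
  then have ne: "path_image c \<inter> inside (path_image b1 \<union> path_image e) \<noteq> {}" using c(4) Ju by auto
  have "inside (path_image b1 \<union> path_image c) \<union> inside (path_image e \<union> path_image c) \<union>
      (path_image c - {?v, \<beta> ?h}) = inside (path_image b1 \<union> path_image e)"
    by (rule split_inside_simple_closed_curve[OF arc_imp_simple_path[OF b1(1)] b1(2,3)
          arc_imp_simple_path[OF e(1)] e(2,3) arc_imp_simple_path[OF c(1)] c(2,3) vh c3 c1 c2 ne])
  then have sub: "inside (path_image b1 \<union> path_image c) \<subseteq> inside ?J" unfolding Ju by blast
  have "theta_pair b1 c" using b1 c c1 by (simp add: theta_pair_def)
  note I' = theta_pair_inside[OF this]
  obtain t d where T: "\<forall>i<k. 0 < t i \<and> t i < 1 \<and> arc (d i) \<and> pathstart (d i) = ?v \<and>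
      pathfinish (d i) = b1 (t i) \<and>
      path_image (d i) - {?v, b1 (t i)} \<subseteq> inside (path_image b1 \<union> path_image c)"
    "\<forall>i<k. \<forall>j<k. i < j \<longrightarrow> t i < t j \<and> path_image (d i) \<inter> path_image (d j) = {?v}"
    using Suc.IH[OF \<open>theta_pair b1 c\<close>] unfolding b1(2) by (elim exE conjE) (rule that)
  note td = T(1)[rule_format] and td2 = T(2)[rule_format]
  have b1t: "b1 x = \<beta> (x / 2)" for x by (simp add: b1_def subpath_def)
  \<comment> \<open>\<open>b1\<close> runs through the first half of \<open>\<beta>\<close> at half
    speed, hence the halved parameters.\<close>
  define t' where "t' i = (if i < k then t i / 2 else ?h)" for i
  define d' where "d' i = (if i < k then d i else c)" for i
  \<comment> \<open>An inner spoke lies inside the smaller curve except for its two ends. Its far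
    end is strictly between the ends of \<open>b1\<close>, so it is not on \<open>c\<close>.\<close>
  have dc: "path_image (d i) \<inter> path_image c = {?v}" if i: "i < k" for i
  proof -
    have ti: "0 < t i" "t i < 1" using td[OF i] by auto
    have "b1 (t i) \<notin> path_image c"
    proof
      assume a: "b1 (t i) \<in> path_image c"
      have "b1 (t i) \<in> path_image b1" using ti by (auto simp: path_image_def)
      then have "b1 (t i) \<in> {?v, \<beta> ?h}" using a c1 by (metis IntI)
      then consider "\<beta> (t i / 2) = \<beta> 0" | "\<beta> (t i / 2) = \<beta> ?h"
        by (auto simp only: b1t pathstart_def insert_iff empty_iff)
      then show False
      proof cases
        case 1
        have "t i / 2 = 0" by (rule inj_onD[OF inj 1]) (use ti in auto)
        then show False using ti by simp
      next
        case 2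
        have "t i / 2 = ?h" by (rule inj_onD[OF inj 2]) (use ti in auto)
        then show False using ti by simp
      qed
    qed
    moreover have "?v \<in> path_image (d i)" using td[OF i] pathstart_in_path_image by metis
    moreover have "?v \<in> path_image c" using c(2) pathstart_in_path_image by metis
    ultimately show ?thesis using td[OF i] I'(6) by blast
  qed
  show ?case
  proof (intro exI[of _ t'] exI[of _ d'] conjI allI impI)
    fix i assume i: "i < Suc k"
    show "0 < t' i" "t' i < 1" using td[of i] by (auto simp: t'_def)
    show "arc (d' i)" "pathstart (d' i) = ?v" "pathfinish (d' i) = \<beta> (t' i)"
      using td[of i] c by (auto simp: d'_def t'_def b1t)
    show "path_image (d' i) - {?v, \<beta> (t' i)} \<subseteq> inside ?J"
      using td[of i] c(4) sub by (auto simp: d'_def t'_def b1t)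
    fix j assume j: "j < Suc k" and ij: "i < j"
    then have "i < k" by simp
    then show "t' i < t' j" using td2[of i j] td[of i] ij j by (auto simp: t'_def)
    show "path_image (d' i) \<inter> path_image (d' j) = {?v}"
      using td2[of i j] dc[OF \<open>i < k\<close>] ij \<open>i < k\<close> by (auto simp: d'_def)
  qed
qed simp

section \<open>Minor-closed classes of graphs\<close>

definition nbrs :: "'a graph \<Rightarrow> 'a \<Rightarrow> 'a set" where
  "nbrs G u = {x. {u, x} \<in> edges G}"

lemma edgeE:
  assumes "simple_graph G" "e \<in> edges G"
  obtains x y where "e = {x, y}" "x \<noteq> y" "x \<in> verts G" "y \<in> verts G"
proof -
  have "card e = 2" "e \<subseteq> verts G" using assms by (auto simp: simple_graph_def)
  then show thesis using that by (auto simp: card_2_iff)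
qed

lemma edge_atE:
  assumes "simple_graph G" "e \<in> edges G" "x \<in> e"
  obtains y where "e = {x, y}" "x \<noteq> y" "y \<in> verts G"
proof -
  obtain a b where "e = {a, b}" "a \<noteq> b" "a \<in> verts G" "b \<in> verts G" using edgeE[OF assms(1,2)] .
  then show thesis using that[of a] that[of b] assms(3) by (auto simp: insert_commute)
qed

lemma contract_edgeI:
  assumes "e \<in> edges G" "card ((\<lambda>y. if y = x then u else y) ` e) = 2"
  shows "(\<lambda>y. if y = x then u else y) ` e \<in> edges (contract_edge u x G)"
  unfolding contract_edge_def snd_conv
  by (rule CollectI, rule conjI, rule imageI, rule assms(1), rule assms(2))

lemma contract_edgeE:
  assumes "e \<in> edges (contract_edge u x G)"
  obtains e' where "e' \<in> edges G" "e = (\<lambda>y. if y = x then u else y) ` e'" "card e = 2"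
  using assms unfolding contract_edge_def snd_conv by blast

lemma edge_ends:
  assumes "simple_graph G" "{x, y} \<in> edges G"
  shows "x \<noteq> y" "x \<in> verts G" "y \<in> verts G"
proof -
  have "card {x, y} = 2" "{x, y} \<subseteq> verts G" using assms by (auto simp: simple_graph_def)
  then show "x \<noteq> y" "x \<in> verts G" "y \<in> verts G" by (auto simp: card_2_iff)
qed

lemma nbrs_subset: "simple_graph G \<Longrightarrow> nbrs G u \<subseteq> verts G - {u}"
  unfolding nbrs_def using edge_ends by fast

lemma finite_nbrs: "simple_graph G \<Longrightarrow> finite (nbrs G u)"
  using nbrs_subset[of G u] by (auto simp: simple_graph_def intro: finite_subset)

lemma degree_eq_card_nbrs:
  assumes "simple_graph G"
  shows "degree G u = card (nbrs G u)"
proof -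
  have "{e \<in> edges G. u \<in> e} = (\<lambda>x. {u, x}) ` nbrs G u"
  proof (intro equalityI subsetI)
    fix e assume e: "e \<in> {e \<in> edges G. u \<in> e}"
    then obtain x y where "e = {x, y}" "x \<noteq> y" using edgeE[OF assms] by blast
    then show "e \<in> (\<lambda>x. {u, x}) ` nbrs G u" using e by (auto simp: nbrs_def insert_commute)
  qed (auto simp: nbrs_def)
  moreover have "inj_on (\<lambda>x. {u, x}) (nbrs G u)" by (auto simp: inj_on_def doubleton_eq_iff)
  ultimately show ?thesis by (simp add: degree_def card_image)
qed

lemma finite_edges: "simple_graph G \<Longrightarrow> finite (edges G)"
  by (rule finite_subset[of _ "Pow (verts G)"]) (auto simp: simple_graph_def)

lemma sum_degree:
  assumes G: "simple_graph G"
  shows "(\<Sum>v\<in>verts G. degree G v) = 2 * card (edges G)"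
proof -
  have fin: "finite (verts G)" using G by (simp add: simple_graph_def)
  have "(\<Sum>v\<in>verts G. degree G v) = (\<Sum>v\<in>verts G. \<Sum>e\<in>edges G. if v \<in> e then 1 else 0)"
    unfolding degree_def using finite_edges[OF G] by (simp add: sum.If_cases Int_def)
  also have "\<dots> = (\<Sum>e\<in>edges G. \<Sum>v\<in>verts G. if v \<in> e then 1 else 0)" by (rule sum.swap)
  also have "\<dots> = (\<Sum>e\<in>edges G. 2)"
  proof (rule sum.cong[OF HOL.refl])
    fix e assume "e \<in> edges G"
    then have "card e = 2" "e \<subseteq> verts G" using G by (auto simp: simple_graph_def)
    then show "(\<Sum>v\<in>verts G. if v \<in> e then 1 else 0) = (2::nat)"
      using fin by (simp add: sum.If_cases Int_absorb1)
  qed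
  finally show ?thesis by simp
qed

lemma simple_delete_vertex: "simple_graph G \<Longrightarrow> verts G \<noteq> {v} \<Longrightarrow> simple_graph (delete_vertex v G)"
  by (auto simp: simple_graph_def delete_vertex_def)

lemma simple_delete_edge: "simple_graph G \<Longrightarrow> simple_graph (delete_edge e G)"
  by (auto simp: simple_graph_def delete_edge_def)

lemma simple_contract_edge:
  assumes "simple_graph G" "{u, v} \<in> edges G" "u \<noteq> v"
  shows "simple_graph (contract_edge u v G)"
proof -
  note ends = edge_ends[OF assms(1,2)]
  have "e \<subseteq> verts G" if "e \<in> edges G" for e using assms(1) that by (auto simp: simple_graph_def)
  then show ?thesis using assms ends unfolding simple_graph_def contract_edge_def by force
qed

lemma minor_simple: "minor H G \<Longrightarrow> simple_graph G \<Longrightarrow> simple_graph H"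
  by (induction rule: minor.induct) (auto simp: simple_delete_vertex simple_delete_edge simple_contract_edge)

lemma minor_trans: "minor K H \<Longrightarrow> minor H G \<Longrightarrow> minor K G"
  by (induction rule: minor.induct) (auto intro: minor.intros)

text \<open>Closure under single steps is what can be verified for the auxiliary classes, the graphs
  that may be joined to a vertex and the graphs \<open>fan_extension D\<close>.\<close>

definition minor_closed :: "'a graph set \<Rightarrow> bool" where
  "minor_closed D \<longleftrightarrow> (\<forall>G\<in>D. simple_graph G) \<and>
     (\<forall>G\<in>D. \<forall>v\<in>verts G. verts G \<noteq> {v} \<longrightarrow> delete_vertex v G \<in> D) \<and>
     (\<forall>G\<in>D. \<forall>e\<in>edges G. delete_edge e G \<in> D) \<and>
     (\<forall>G\<in>D. \<forall>u v. {u, v} \<in> edges G \<longrightarrow> u \<noteq> v \<longrightarrow> contract_edge u v G \<in> D)"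

lemma minor_closedD:
  assumes "minor_closed D" "G \<in> D"
  shows "simple_graph G" "v \<in> verts G \<Longrightarrow> verts G \<noteq> {v} \<Longrightarrow> delete_vertex v G \<in> D"
    "e \<in> edges G \<Longrightarrow> delete_edge e G \<in> D" "{u, v} \<in> edges G \<Longrightarrow> u \<noteq> v \<Longrightarrow> contract_edge u v G \<in> D"
  using assms by (auto simp: minor_closed_def)

lemma minor_closed_Minor: "minor_closed (Minor \<A>)"
proof -
  have "H \<in> Minor \<A>" if "G \<in> Minor \<A>" "minor H G" for G H
    using that minor_trans[of _ H G] minor_simple[of H G] by (auto simp: Minor_def)
  note * = this
  show ?thesis unfolding minor_closed_def
  proof (intro conjI ballI allI impI)
    fix G assume G: "G \<in> Minor \<A>"
    then show "simple_graph G" by (simp add: Minor_def)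
    show "delete_vertex v G \<in> Minor \<A>" if "v \<in> verts G" "verts G \<noteq> {v}" for v
      using *[OF G minor.delete_vertex[OF minor.refl that]] .
    show "delete_edge e G \<in> Minor \<A>" if "e \<in> edges G" for e
      using *[OF G minor.delete_edge[OF minor.refl that]] .
    show "contract_edge u v G \<in> Minor \<A>" if "{u, v} \<in> edges G" "u \<noteq> v" for u v
      using *[OF G minor.contract_edge[OF minor.refl that]] .
  qed
qed

lemma minor_in_minor_closed: "minor H G \<Longrightarrow> minor_closed D \<Longrightarrow> G \<in> D \<Longrightarrow> H \<in> D"
  by (induction rule: minor.induct) (auto simp: minor_closed_def)

lemma minor_closed_edges:
  assumes "minor_closed D" "G \<in> D" "F \<subseteq> edges G"
  shows "(verts G, F) \<in> D"
proof -
  have "(verts G, edges G - C) \<in> D" if "finite C" "C \<subseteq> edges G" for C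
    using that
  proof (induction C rule: finite_induct)
    case (insert e C)
    have "delete_edge e (verts G, edges G - C) \<in> D"
      by (rule minor_closedD(3)[OF assms(1)]) (use insert in auto)
    moreover have "delete_edge e (verts G, edges G - C) = (verts G, edges G - insert e C)"
      by (auto simp: delete_edge_def)
    ultimately show ?case by simp
  qed (use assms in simp)
  from this[of "edges G - F"] show ?thesis
    using finite_edges[OF minor_closedD(1)[OF assms(1,2)]] assms(3) by (simp add: double_diff)
qed

lemma minor_closed_subgraph:
  assumes D: "minor_closed D" and G: "G \<in> D" and W: "W \<subseteq> verts G" "W \<noteq> {}"
    and F: "F \<subseteq> edges G" "\<And>e. e \<in> F \<Longrightarrow> e \<subseteq> W"
  shows "(W, F) \<in> D"
proof -
  have fin: "finite (verts G)" using minor_closedD(1)[OF D G] by (simp add: simple_graph_def)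
  have "(verts G - C, {e \<in> edges G. e \<inter> C = {}}) \<in> D" if "finite C" "C \<subseteq> verts G - W" for C
    using that
  proof (induction C rule: finite_induct)
    case (insert v C)
    let ?H = "(verts G - C, {e \<in> edges G. e \<inter> C = {}})"
    have "delete_vertex v ?H \<in> D"
      by (rule minor_closedD(2)[OF D]) (use insert W in auto)
    moreover have "delete_vertex v ?H = (verts G - insert v C, {e \<in> edges G. e \<inter> insert v C = {}})"
      by (auto simp: delete_vertex_def)
    ultimately show ?case by simp
  qed (use G in simp)
  from this[of "verts G - W"] have "(W, {e \<in> edges G. e \<inter> (verts G - W) = {}}) \<in> D"
    using fin W by (simp add: double_diff)
  from minor_closed_edges[OF D this, of F] show ?thesis using F by fastforce
qed

section \<open>Dense graphs have large complete minors\<close>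

definition complete_graph :: "'a graph \<Rightarrow> bool" where
  "complete_graph G \<longleftrightarrow> (\<forall>x\<in>verts G. \<forall>y\<in>verts G. x \<noteq> y \<longrightarrow> {x, y} \<in> edges G)"

definition join_vertex :: "'a \<Rightarrow> 'a graph \<Rightarrow> 'a graph" where
  "join_vertex u G = (insert u (verts G), edges G \<union> (\<lambda>x. {u, x}) ` verts G)"

text \<open>Every operation on \<open>F\<close> commutes with joining \<open>u\<close> to all
  vertices; in a contraction the edges from \<open>u\<close> to the two ends are identified. This
  lets an induction over classes descend into the neighbourhood of \<open>u\<close>.\<close>

lemma minor_closed_join_vertex:
  assumes D: "minor_closed D"
  shows "minor_closed {F. simple_graph F \<and> u \<notin> verts F \<and> join_vertex u F \<in> D}"
  unfolding minor_closed_def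
proof (intro conjI ballI allI impI; clarify)
  fix V E assume F: "simple_graph (V, E)" "u \<notin> verts (V, E)" "join_vertex u (V, E) \<in> D"
  have E: "e \<subseteq> V" if "e \<in> E" for e using F(1) that by (auto simp: simple_graph_def)
  {
    fix v assume v: "v \<in> verts (V, E)" "verts (V, E) \<noteq> {v}"
    have "delete_vertex v (join_vertex u (V, E)) = join_vertex u (delete_vertex v (V, E))"
      using v F(2) by (auto simp: delete_vertex_def join_vertex_def)
    moreover have "delete_vertex v (join_vertex u (V, E)) \<in> D"
      by (rule minor_closedD(2)[OF D F(3)]) (use v F(2) in \<open>auto simp: join_vertex_def\<close>)
    ultimately show "simple_graph (delete_vertex v (V, E)) \<and> u \<notin> verts (delete_vertex v (V, E)) \<and>
        join_vertex u (delete_vertex v (V, E)) \<in> D"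
      using simple_delete_vertex[OF F(1) v(2)] F(2) by (simp add: delete_vertex_def)
  next
    fix e assume e: "e \<in> edges (V, E)"
    have "delete_edge e (join_vertex u (V, E)) = join_vertex u (delete_edge e (V, E))"
      using E[of e] e F(2) by (auto simp: delete_edge_def join_vertex_def)
    moreover have "delete_edge e (join_vertex u (V, E)) \<in> D"
      by (rule minor_closedD(3)[OF D F(3)]) (use e in \<open>auto simp: join_vertex_def\<close>)
    ultimately show "simple_graph (delete_edge e (V, E)) \<and> u \<notin> verts (delete_edge e (V, E)) \<and>
        join_vertex u (delete_edge e (V, E)) \<in> D"
      using simple_delete_edge[OF F(1)] F(2) by (simp add: delete_edge_def)
  next
    fix a b assume ab: "{a, b} \<in> edges (V, E)" "a \<noteq> b"
    let ?f = "\<lambda>x. if x = b then a else x"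
    have ends: "a \<in> V" "b \<in> V" using E[of "{a, b}"] ab by auto
    then have u: "u \<noteq> a" "u \<noteq> b" using F(2) by auto
    have "{e \<in> (`) ?f ` (\<lambda>x. {u, x}) ` V. card e = 2} = (\<lambda>x. {u, x}) ` (V - {b})"
    proof (intro equalityI subsetI)
      fix e assume "e \<in> {e \<in> (`) ?f ` (\<lambda>x. {u, x}) ` V. card e = 2}"
      then obtain x where "x \<in> V" "e = {u, ?f x}" using u by auto
      then show "e \<in> (\<lambda>x. {u, x}) ` (V - {b})" using ends ab by auto
    next
      fix e assume "e \<in> (\<lambda>x. {u, x}) ` (V - {b})"
      then obtain x where x: "x \<in> V" "x \<noteq> b" "e = {u, x}" by auto
      moreover have "x \<noteq> u" using x(1) F(2) by auto
      ultimately have "e = ?f ` {u, x}" "card e = 2" using u by auto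
      then show "e \<in> {e \<in> (`) ?f ` (\<lambda>x. {u, x}) ` V. card e = 2}" using x by blast
    qed
    then have "contract_edge a b (join_vertex u (V, E)) = join_vertex u (contract_edge a b (V, E))"
      using u by (auto simp: contract_edge_def join_vertex_def image_Un)
    moreover have "contract_edge a b (join_vertex u (V, E)) \<in> D"
      by (rule minor_closedD(4)[OF D F(3)]) (use ab in \<open>auto simp: join_vertex_def\<close>)
    ultimately show "simple_graph (contract_edge a b (V, E)) \<and> u \<notin> verts (contract_edge a b (V, E)) \<and>
        join_vertex u (contract_edge a b (V, E)) \<in> D"
      using simple_contract_edge[OF F(1) ab] F(2) by (simp add: contract_edge_def)
  }
qed

text \<open>Contraction loses \<open>{u, x}\<close> and one edge for each common neighbour. On the
  remaining set \<open>R\<close> it is injective.\<close>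

lemma card_edges_contract:
  assumes G: "simple_graph G" and ux: "{u, x} \<in> edges G"
  shows "card (edges G) \<le> card (edges (contract_edge u x G)) + 1 + card (nbrs G u \<inter> nbrs G x)"
proof -
  let ?f = "\<lambda>y. if y = x then u else y"
  let ?C = "nbrs G u \<inter> nbrs G x"
  note ends = edge_ends[OF G ux]
  have finC: "finite ?C" using finite_nbrs[OF G] by blast
  define R where "R = edges G - insert {u, x} ((\<lambda>y. {x, y}) ` ?C)"
  have img: "?f ` e \<in> edges (contract_edge u x G)" and form: "?f ` e = (if x \<in> e then insert u (e - {x}) else e)"
    if e: "e \<in> R" for e
  proof -
    have eG: "e \<in> edges G" "e \<noteq> {u, x}" using e by (auto simp: R_def)
    obtain a b where ab: "e = {a, b}" "a \<noteq> b" using edgeE[OF G eG(1)] by metis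
    have fe: "?f ` e = {?f a, ?f b}" using ab(1) by simp
    show "?f ` e = (if x \<in> e then insert u (e - {x}) else e)"
    proof (cases "x \<in> e")
      case True
      then have "x = a \<or> x = b" using ab(1) by blast
      then show ?thesis unfolding fe using ab by (elim disjE) auto
    next
      case False
      then show ?thesis unfolding fe using ab(1) by auto
    qed
    have "?f a \<noteq> ?f b"
    proof
      assume "?f a = ?f b"
      then have "a = x \<and> b = u \<or> a = u \<and> b = x" using ab(2) by (metis (full_types))
      then show False using ab(1) eG(2) by auto
    qed
    then have "card (?f ` e) = 2" unfolding fe by simp
    then show "?f ` e \<in> edges (contract_edge u x G)" by (rule contract_edgeI[OF eG(1)])
  qed
  have inj: "inj_on ((`) ?f) R"
  proof (rule inj_onI)
    fix e e' assume e: "e \<in> R" "e' \<in> R" "?f ` e = ?f ` e'"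
    \<comment> \<open>If an edge at \<open>x\<close> and one away from \<open>x\<close> have the
      same image, then their other end is a common neighbour, and the edge at \<open>x\<close> was
      excluded from \<open>R\<close>.\<close>
    have key: False if a: "a \<in> R" "b \<in> R" "x \<in> a" "x \<notin> b" "insert u (a - {x}) = b" for a b
    proof -
      have aG: "a \<in> edges G" "b \<in> edges G" using a by (auto simp: R_def)
      obtain y where y: "a = {x, y}" "x \<noteq> y" using edge_atE[OF G aG(1) a(3)] .
      then have "b = {u, y}" using a(5) by auto
      then have "y \<in> ?C" using aG y by (auto simp: nbrs_def)
      then show False using a(1) y by (auto simp: R_def)
    qed
    consider "x \<in> e" "x \<in> e'" | "x \<notin> e" "x \<notin> e'" | "x \<in> e" "x \<notin> e'" | "x \<notin> e" "x \<in> e'" by blast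
    then show "e = e'"
    proof cases
      case 1
      have nu: "u \<notin> e" if "e \<in> R" "x \<in> e" for e
      proof
        assume u: "u \<in> e"
        have eG: "e \<in> edges G" using that by (auto simp: R_def)
        obtain y where "e = {u, y}" using edge_atE[OF G eG u] .
        then have "e = {u, x}" using that(2) ends(1) by auto
        then show False using that by (auto simp: R_def)
      qed
      have "insert u (e - {x}) = insert u (e' - {x})" using e(3) form[OF e(1)] form[OF e(2)] 1 by simp
      then have "e - {x} = e' - {x}" using nu[OF e(1) 1(1)] nu[OF e(2) 1(2)] by (metis Diff_iff insert_ident)
      then show ?thesis using 1 by blast
    next
      case 2
      then show ?thesis using e(3) form[OF e(1)] form[OF e(2)] by simp
    next
      case 3
      then show ?thesis using key[OF e(1,2)] e(3) form[OF e(1)] form[OF e(2)] by simp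
    next
      case 4
      then show ?thesis using key[OF e(2,1)] e(3) form[OF e(1)] form[OF e(2)] by simp
    qed
  qed
  have fin': "finite (edges (contract_edge u x G))"
    using finite_edges[OF simple_contract_edge[OF G ux ends(1)]] .
  have "card R \<le> card (edges (contract_edge u x G))"
    using card_inj_on_le[OF inj _ fin'] img by blast
  moreover have "card (edges G) \<le> card R + card (insert {u, x} ((\<lambda>y. {x, y}) ` ?C))"
    unfolding R_def using diff_card_le_card_Diff[of "insert {u, x} ((\<lambda>y. {x, y}) ` ?C)" "edges G"] finC by simp
  moreover have "card (insert {u, x} ((\<lambda>y. {x, y}) ` ?C)) \<le> 1 + card ?C"
    using card_insert_le_m1 card_image_le[OF finC, of "\<lambda>y. {x, y}"] finC by (simp add: card_insert_if)
  ultimately show ?thesis by linarith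
qed

text \<open>Mader's argument. In a graph of \<open>D\<close> with this density and fewest vertices,
  each contraction loses more than \<open>2 ^ Suc t\<close> edges, so adjacent vertices have at
  least \<open>2 ^ Suc t\<close> common neighbours. The neighbourhood of a vertex \<open>u\<close>
  thus has minimum degree \<open>2 ^ Suc t\<close>, that is density \<open>2 ^ t\<close>. The
  induction hypothesis for the class of graphs that may be joined to \<open>u\<close> yields a
  complete graph, and \<open>u\<close> enlarges it.\<close>

lemma dense_complete_minor:
  assumes "minor_closed D" "G \<in> D" "2 ^ t * card (verts G) \<le> card (edges G)"
  shows "\<exists>H\<in>D. t \<le> card (verts H) \<and> complete_graph H"
  using assms
proof (induction t arbitrary: D G)
  case 0
  have "verts G \<noteq> {}" using minor_closedD(1)[OF 0(1,2)] by (simp add: simple_graph_def)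
  then obtain x where "x \<in> verts G" by blast
  then have "({x}, {}) \<in> D" by (intro minor_closed_subgraph[OF 0(1,2)]) auto
  then show ?case by (intro bexI[of _ "({x}, {})"]) (auto simp: complete_graph_def)
next
  case (Suc t)
  note D = Suc.prems(1)
  obtain H where H: "H \<in> D" "2 ^ Suc t * card (verts H) \<le> card (edges H)"
    and min: "\<And>K. K \<in> D \<Longrightarrow> 2 ^ Suc t * card (verts K) \<le> card (edges K) \<Longrightarrow> card (verts H) \<le> card (verts K)"
    using ex_has_least_nat[of "\<lambda>K. K \<in> D \<and> 2 ^ Suc t * card (verts K) \<le> card (edges K)" G "\<lambda>K. card (verts K)"]
      Suc.prems(2,3) by blast
  have sH: "simple_graph H" using minor_closedD(1)[OF D H(1)] .
  have finV: "finite (verts H)" "verts H \<noteq> {}" using sH by (auto simp: simple_graph_def)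
  have common: "2 ^ Suc t \<le> card (nbrs H u \<inter> nbrs H x)" if ux: "{u, x} \<in> edges H" for u x
  proof -
    note ends = edge_ends[OF sH ux]
    let ?K = "contract_edge u x H"
    have K: "?K \<in> D" using minor_closedD(4)[OF D H(1) ux ends(1)] .
    have cK: "card (verts ?K) = card (verts H) - 1" using ends(3) finV by (simp add: contract_edge_def)
    have c0: "card (verts H) > 0" using finV by (simp add: card_gt_0_iff)
    then have "card (edges ?K) < 2 ^ Suc t * (card (verts H) - 1)"
      using min[OF K] cK by (metis diff_less less_numeral_extra(1) not_le)
    moreover have "2 ^ Suc t * card (verts H) = 2 ^ Suc t * (card (verts H) - 1) + 2 ^ Suc t"
      using c0 by (metis Suc_pred' mult_Suc_right add.commute)
    ultimately show ?thesis using card_edges_contract[OF sH ux] H(2) by linarith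
  qed
  have "card (edges H) > 0" using H(2) finV by (metis card_gt_0_iff gr0I le_zero_eq mult_is_0 power_not_zero zero_neq_numeral)
  then obtain e where e: "e \<in> edges H" by (auto simp: card_gt_0_iff)
  then obtain u w where uw: "{u, w} \<in> edges H" using edgeE[OF sH] by metis
  let ?N = "nbrs H u"
  let ?K = "(?N, {e \<in> edges H. e \<subseteq> ?N})"
  have Nne: "?N \<noteq> {}" using uw by (auto simp: nbrs_def)
  have finN: "finite ?N" using finite_nbrs[OF sH] .
  have uN: "u \<notin> ?N" "?N \<subseteq> verts H" using nbrs_subset[OF sH, of u] by auto
  have uV: "u \<in> verts H" using edge_ends[OF sH uw] by blast
  have sK: "simple_graph ?K" using sH finN Nne by (auto simp: simple_graph_def)
  have "join_vertex u ?K \<in> D"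
  proof -
    have "join_vertex u ?K = (insert u ?N, {e \<in> edges H. e \<subseteq> ?N} \<union> (\<lambda>x. {u, x}) ` ?N)"
      by (simp add: join_vertex_def)
    also have "\<dots> \<in> D" by (rule minor_closed_subgraph[OF D H(1)]) (use uN uV in \<open>auto simp: nbrs_def\<close>)
    finally show ?thesis .
  qed
  then have KD: "?K \<in> {F. simple_graph F \<and> u \<notin> verts F \<and> join_vertex u F \<in> D}" using sK uN by simp
  have "2 ^ Suc t \<le> degree ?K x" if x: "x \<in> ?N" for x
  proof -
    have "nbrs ?K x = ?N \<inter> nbrs H x" using x by (auto simp: nbrs_def)
    then show ?thesis using common[of u x] x degree_eq_card_nbrs[OF sK, of x] by (simp add: nbrs_def)
  qed
  then have "card ?N * 2 ^ Suc t \<le> (\<Sum>x\<in>?N. degree ?K x)"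
    using sum_bounded_below[of ?N "2 ^ Suc t" "degree ?K"] by simp
  also have "\<dots> = 2 * card (edges ?K)" using sum_degree[OF sK] by simp
  finally have "2 ^ t * card (verts ?K) \<le> card (edges ?K)" by (simp add: mult.commute)
  from Suc.IH[OF minor_closed_join_vertex[OF D] KD this]
  obtain F where F: "simple_graph F" "u \<notin> verts F" "join_vertex u F \<in> D" "t \<le> card (verts F)" "complete_graph F" by blast
  have "complete_graph (join_vertex u F)" using F(5) by (auto simp: complete_graph_def join_vertex_def insert_commute)
  moreover have "Suc t \<le> card (verts (join_vertex u F))" using F(1,2,4) by (simp add: join_vertex_def simple_graph_def)
  ultimately show ?case using F(3) by blast
qed

section \<open>Renaming vertices, and the sparsity of proper minor-closed classes\<close>

definition relabel :: "('a \<Rightarrow> 'b) \<Rightarrow> 'a graph \<Rightarrow> 'b graph" where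
  "relabel f G = (f ` verts G, (`) f ` edges G)"

definition iso_closed :: "nat graph set \<Rightarrow> bool" where
  "iso_closed D \<longleftrightarrow> (\<forall>G\<in>D. \<forall>f. inj_on f (verts G) \<longrightarrow> relabel f G \<in> D)"

lemma relabel_inverse:
  assumes "simple_graph G" "inj_on f (verts G)"
  shows "relabel (the_inv_into (verts G) f) (relabel f G) = G"
proof -
  have "the_inv_into (verts G) f ` f ` e = e" if "e \<subseteq> verts G" for e
    using that the_inv_into_f_f[OF assms(2)] by (force simp: image_image)
  then have "(`) (the_inv_into (verts G) f) ` (`) f ` edges G = edges G"
    using assms(1) by (force simp: image_image simple_graph_def)
  moreover have "the_inv_into (verts G) f ` f ` verts G = verts G"
    using assms(2) by (simp add: the_inv_into_onto)
  ultimately show ?thesis by (simp add: relabel_def)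
qed

lemma simple_relabel:
  assumes "simple_graph G" "inj_on f (verts G)"
  shows "simple_graph (relabel f G)"
proof -
  have "f ` e \<subseteq> f ` verts G \<and> card (f ` e) = 2" if "e \<in> edges G" for e
  proof -
    have e: "e \<subseteq> verts G" "card e = 2" using assms that by (auto simp: simple_graph_def)
    then show ?thesis using card_image[OF inj_on_subset[OF assms(2) e(1)]] by auto
  qed
  then show ?thesis using assms(1) by (auto simp: simple_graph_def relabel_def)
qed

text \<open>A denser graph would put into \<open>D\<close> a complete graph with at least as many
  vertices as \<open>G\<close>. This contains a copy of \<open>G\<close>, which is renamed back to
  \<open>G\<close> itself.\<close>

lemma sparse_minor_closed:
  assumes D: "minor_closed D" "iso_closed D" and G: "simple_graph G" "G \<notin> D"
  obtains d :: nat where "d \<ge> 1" "\<And>H. H \<in> D \<Longrightarrow> card (edges H) \<le> d * card (verts H)"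
proof -
  have "card (edges H) \<le> 2 ^ card (verts G) * card (verts H)" if H: "H \<in> D" for H
  proof (rule ccontr)
    assume "\<not> ?thesis"
    then obtain K where K: "K \<in> D" "card (verts G) \<le> card (verts K)" "complete_graph K"
      using dense_complete_minor[OF D(1) H, of "card (verts G)"] by auto
    have sK: "simple_graph K" using minor_closedD(1)[OF D(1) K(1)] .
    obtain f where f: "inj_on f (verts G)" "f ` verts G \<subseteq> verts K"
      using card_le_inj[OF _ _ K(2)] G sK by (auto simp: simple_graph_def)
    have "relabel f G \<in> D" unfolding relabel_def
    proof (rule minor_closed_subgraph[OF D(1) K(1) f(2)])
      show "f ` verts G \<noteq> {}" using G by (simp add: simple_graph_def)
      show "(`) f ` edges G \<subseteq> edges K"
      proof clarify
        fix e assume "e \<in> edges G"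
        then obtain x y where xy: "e = {x, y}" "x \<noteq> y" "x \<in> verts G" "y \<in> verts G" using edgeE[OF G(1)] by metis
        then have "f x \<noteq> f y" using f(1) by (auto simp: inj_on_def)
        then show "f ` e \<in> edges K" using K(3) f(2) xy by (auto simp: complete_graph_def)
      qed
      show "e \<in> (`) f ` edges G \<Longrightarrow> e \<subseteq> f ` verts G" for e using G by (auto simp: simple_graph_def)
    qed
    moreover have "inj_on (the_inv_into (verts G) f) (verts (relabel f G))"
      using inj_on_the_inv_into[OF f(1)] by (simp add: relabel_def)
    ultimately have "relabel (the_inv_into (verts G) f) (relabel f G) \<in> D" using D(2) by (auto simp: iso_closed_def)
    then show False using relabel_inverse[OF G(1) f(1)] G(2) by simp
  qed
  then show thesis using that[of "2 ^ card (verts G)"] by simp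
qed

section \<open>Attaching a fan to a drawing\<close>

text \<open>The whole complex plane serves as the domain of the chart, so the results on plane arcs
  apply without restriction to a disc.\<close>

lemma surface_chart:
  assumes X: "surface X" and x: "x \<in> topspace X"
  obtains h :: "complex \<Rightarrow> 'a" and z where "inj h" "continuous_map euclidean X h" "\<And>W. open W \<Longrightarrow> openin X (h ` W)"
    "h z = x"
proof -
  obtain U where U: "openin X U" "x \<in> U" "subtopology X U homeomorphic_space Euclidean_space 2"
    using X x by (auto simp: surface_def)
  obtain f' :: "(nat \<Rightarrow> real) \<Rightarrow> complex" and g' where "homeomorphic_maps (Euclidean_space (DIM(complex))) euclidean f' g'"
    using homeomorphic_maps_Euclidean_space_euclidean by blast
  then have "Euclidean_space 2 homeomorphic_space (euclidean :: complex topology)"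
    unfolding homeomorphic_space_def by auto
  then have "subtopology X U homeomorphic_space (euclidean :: complex topology)"
    using U(3) homeomorphic_space_trans by blast
  then obtain h where h: "homeomorphic_map (euclidean :: complex topology) (subtopology X U) h"
    using homeomorphic_space homeomorphic_space_sym by blast
  have UX: "U \<subseteq> topspace X" using U(1) openin_subset by blast
  have "inj h" using homeomorphic_imp_injective_map[OF h] by simp
  moreover have "continuous_map euclidean X h"
    using homeomorphic_imp_continuous_map[OF h] continuous_map_in_subtopology by blast
  moreover have "openin X (h ` W)" if "open W" for W
    using homeomorphic_imp_open_map[OF h] that U(1) openin_trans_full by (fastforce simp: open_map_def)
  moreover have "h ` UNIV = U" using homeomorphic_imp_surjective_map[OF h] UX by auto
  then have "\<exists>z. h z = x" using U(2) by blast
  ultimately show thesis using that by blast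
qed

lemma pathin_image_closedin:
  assumes "Hausdorff_space X" "pathin X g" "a \<ge> 0" "b \<le> 1"
  shows "closedin X (g ` {a..b})"
proof (rule compactin_imp_closedin[OF assms(1)], rule image_compactin)
  show "compactin (top_of_set {0..1}) {a..b}" using assms by (simp add: compactin_subtopology)
qed (use assms in \<open>simp add: pathin_def\<close>)

lemma pathin_image_connectedin:
  assumes "pathin X g" "a \<ge> 0" "b \<le> 1"
  shows "connectedin X (g ` {a..b})"
proof (rule connectedin_continuous_map_image)
  show "connectedin (top_of_set {0..1}) {a..b}" using assms by (simp add: connectedin_subtopology)
qed (use assms in \<open>simp add: pathin_def\<close>)

lemma pathin_reverse: "pathin X g \<Longrightarrow> pathin X (\<lambda>t. g (1 - t))"
  unfolding pathin_def
  by (rule continuous_map_compose[where g = g, unfolded o_def])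
    (auto simp: continuous_map_in_subtopology intro!: continuous_intros)

text \<open>The arc of an edge comes with an arbitrary direction; reversing it if necessary makes it
  start at the chosen end.\<close>

lemma oriented_edge:
  assumes E: "graph_embedding G X \<phi> \<gamma>" and G: "simple_graph G" and e: "e \<in> edges G" "a \<in> e"
  obtains g w where "pathin X g" "inj_on g {0..1}" "g 0 = \<phi> a" "g 1 = \<phi> w" "e = {a, w}" "a \<noteq> w"
    "w \<in> verts G" "g ` {0<..<1} = \<gamma> e ` {0<..<1}" "g ` {0..1} = \<gamma> e ` {0..1}"
proof -
  have c: "card e = 2" "e \<subseteq> verts G" using G e by (auto simp: simple_graph_def)
  then obtain w where w: "e = {a, w}" "a \<noteq> w" using e(2) by (auto simp: card_2_iff doubleton_eq_iff)
  have \<gamma>: "pathin X (\<gamma> e)" "inj_on (\<gamma> e) {0..1}" "{\<gamma> e 0, \<gamma> e 1} = {\<phi> a, \<phi> w}"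
    using E e w by (auto simp: graph_embedding_def)
  have inj: "\<phi> a \<noteq> \<phi> w" using E c w by (auto simp: graph_embedding_def inj_on_def)
  consider "\<gamma> e 0 = \<phi> a" "\<gamma> e 1 = \<phi> w" | "\<gamma> e 1 = \<phi> a" "\<gamma> e 0 = \<phi> w"
    using \<gamma>(3) by (auto simp: doubleton_eq_iff)
  then show thesis
  proof cases
    case 1
    then show thesis using that[of "\<gamma> e" w] \<gamma> w c by auto
  next
    case 2
    have r: "(\<lambda>t::real. 1 - t) ` {0<..<1} = {0<..<1}" "(\<lambda>t::real. 1 - t) ` {0..1} = {0..1}"
      by (auto simp: image_iff intro!: bexI[of _ "1 - x" for x])
    have i: "(\<lambda>t. \<gamma> e (1 - t)) ` {0<..<1} = \<gamma> e ` {0<..<1}" "(\<lambda>t. \<gamma> e (1 - t)) ` {0..1} = \<gamma> e ` {0..1}"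
      unfolding image_image[of "\<gamma> e" "\<lambda>t. 1 - t", symmetric] r by simp_all
    have inj': "inj_on (\<lambda>t. \<gamma> e (1 - t)) {0..1}"
    proof (rule inj_onI)
      fix a b :: real assume "a \<in> {0..1}" "b \<in> {0..1}" "\<gamma> e (1 - a) = \<gamma> e (1 - b)"
      then show "a = b" using inj_onD[OF \<gamma>(2), of "1 - a" "1 - b"] by simp
    qed
    have "w \<in> verts G" using w(1) c(2) by blast
    then show thesis by (intro that[of "\<lambda>t. \<gamma> e (1 - t)" w] pathin_reverse[OF \<gamma>(1)] inj' i w) (simp_all add: 2)
  qed
qed

section \<open>A region next to a vertex that avoids the drawing\<close>

definition drawing :: "'v graph \<Rightarrow> ('v \<Rightarrow> 'a) \<Rightarrow> ('v set \<Rightarrow> real \<Rightarrow> 'a) \<Rightarrow> 'a set" where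
  "drawing G \<phi> \<gamma> = \<phi> ` verts G \<union> (\<Union>e\<in>edges G. \<gamma> e ` {0..1})"

lemma inside_subset_ball:
  fixes S :: "complex set"
  assumes "S \<subseteq> ball z r"
  shows "inside S \<subseteq> ball z r"
proof -
  have "inside S \<subseteq> ball z r - S"
  proof (rule inside_subset)
    show "connected (- ball z r)" by (rule connected_complement_bounded_convex) auto
    show "\<not> bounded (- ball z r)" using bounded_ball not_bounded_UNIV by (metis Compl_partition bounded_Un)
    show "ball z r - S \<union> - ball z r = - S" using assms by auto
  qed
  then show ?thesis by blast
qed

text \<open>An initial piece of \<open>\<sigma>\<close> is closed up by an arc beside it. Only that
  arc is known to avoid \<open>C\<close> here, not yet the inside of the curve.\<close>

lemma theta_pair_from_arc:
  fixes \<sigma> :: "real \<Rightarrow> complex"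
  assumes \<sigma>: "arc \<sigma>" and C: "closed C" "C \<inter> \<sigma> ` {0<..<1} = {}"
  obtains s \<beta> where "0 < s" "s < 1" "theta_pair \<beta> (subpath 0 s \<sigma>)" "pathstart \<beta> = \<sigma> 0"
    "\<beta> ` {0<..<1} \<inter> (C \<union> path_image \<sigma>) = {}" "path_image (subpath 0 s \<sigma>) = \<sigma> ` {0..s}"
    "path_image \<beta> = insert (\<sigma> 0) (insert (\<sigma> s) (\<beta> ` {0<..<1}))"
proof -
  obtain s \<beta> where \<beta>: "0 < s" "s < 1" "arc \<beta>" "pathstart \<beta> = \<sigma> 0" "pathfinish \<beta> = \<sigma> s"
    "path_image \<beta> \<inter> path_image \<sigma> = {\<sigma> 0, \<sigma> s}" "(path_image \<beta> - {\<sigma> 0, \<sigma> s}) \<inter> C = {}"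
    using arc_closes_up_avoiding[OF assms] by blast
  have im: "path_image (subpath 0 s \<sigma>) = \<sigma> ` {0..s}" using \<beta>(1) by (simp add: path_image_subpath)
  have ends: "\<beta> 0 = \<sigma> 0" "\<beta> 1 = \<sigma> s" using \<beta>(4,5) by (auto simp: pathstart_def pathfinish_def)
  have inj: "inj_on \<beta> {0..1}" using \<beta>(3) by (simp add: arc_def)
  have I: "{0..1} = insert 0 (insert 1 {0<..<1::real})" by auto
  have pim: "path_image \<beta> = insert (\<sigma> 0) (insert (\<sigma> s) (\<beta> ` {0<..<1}))"
    unfolding path_image_def I by (simp add: ends)
  have int: "\<beta> ` {0<..<1} \<subseteq> path_image \<beta> - {\<sigma> 0, \<sigma> s}"
  proof (intro subsetI)
    fix x assume "x \<in> \<beta> ` {0<..<1}"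
    then obtain t where t: "0 < t" "t < 1" "x = \<beta> t" by auto
    then have "x \<noteq> \<beta> 0" "x \<noteq> \<beta> 1" using inj_onD[OF inj, of t 0] inj_onD[OF inj, of t 1] by auto
    then show "x \<in> path_image \<beta> - {\<sigma> 0, \<sigma> s}" using t ends by (auto simp: path_image_def)
  qed
  have "\<sigma> ` {0..s} \<subseteq> path_image \<sigma>" using \<beta>(2) by (auto simp: path_image_def)
  moreover have "\<sigma> 0 \<in> \<sigma> ` {0..s}" "\<sigma> s \<in> \<sigma> ` {0..s}" using \<beta>(1) by auto
  ultimately have "path_image \<beta> \<inter> \<sigma> ` {0..s} = {\<sigma> 0, \<sigma> s}" using \<beta>(6) by blast
  moreover have "arc (subpath 0 s \<sigma>)" using arc_subpath_arc[OF \<sigma>, of 0 s] \<beta>(1,2) by simp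
  ultimately have "theta_pair \<beta> (subpath 0 s \<sigma>)" using \<beta>(3,4,5) im by (simp add: theta_pair_def)
  moreover have "\<beta> ` {0<..<1} \<inter> (C \<union> path_image \<sigma>) = {}" using int \<beta>(6,7) by blast
  ultimately show thesis using that[of s \<beta>] \<beta> im pim by blast
qed

text \<open>The curve is drawn beside the initial piece of an edge at \<open>v\<close>, in a disc of
  a chart that contains no other vertex. If a point of the drawing lay inside the curve, its edge
  could be followed to an end other than \<open>v\<close> without meeting the curve, although that
  end lies outside the disc.\<close>

lemma drawing_avoiding_region:
  fixes G :: "'v graph" and X :: "'a topology"
  assumes X: "surface X" and G: "simple_graph G" and E: "graph_embedding G X \<phi> \<gamma>" and v: "v \<in> verts G"
  obtains h :: "complex \<Rightarrow> 'a" and \<beta> \<delta> where "inj h" "continuous_map euclidean X h"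
    "h (pathstart \<beta>) = \<phi> v" "theta_pair \<beta> \<delta>"
    "h ` \<beta> ` {0<..<1} \<inter> drawing G \<phi> \<gamma> = {}"
    "h ` inside (path_image \<beta> \<union> path_image \<delta>) \<inter> drawing G \<phi> \<gamma> = {}"
proof -
  let ?V = "verts G" and ?K = "drawing G \<phi> \<gamma>"
  have haus: "Hausdorff_space X" using X by (simp add: surface_def)
  have \<phi>: "\<phi> ` ?V \<subseteq> topspace X" "inj_on \<phi> ?V" using E by (auto simp: graph_embedding_def)
  have fin: "finite ?V" using G by (simp add: simple_graph_def)
  have \<gamma>: "pathin X (\<gamma> e)" if "e \<in> edges G" for e using E that by (auto simp: graph_embedding_def)
  have \<gamma>V: "\<gamma> e ` {0<..<1} \<inter> \<phi> ` ?V = {}" if "e \<in> edges G" for e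
    using E that by (auto simp: graph_embedding_def)
  have \<gamma>dis: "\<gamma> e ` {0<..<1} \<inter> \<gamma> e' ` {0<..<1} = {}" if "e \<in> edges G" "e' \<in> edges G" "e \<noteq> e'" for e e'
    using E that by (auto simp: graph_embedding_def)
  have \<gamma>ends: "\<gamma> e ` {0..1} \<subseteq> \<gamma> e ` {0<..<1} \<union> \<phi> ` e" if "e \<in> edges G" for e
  proof -
    have I: "{0..1} = insert 0 (insert 1 {0<..<1::real})" by auto
    have "{\<gamma> e 0, \<gamma> e 1} = \<phi> ` e" using E that by (simp add: graph_embedding_def)
    then show ?thesis unfolding I by auto
  qed
  have eV: "e \<subseteq> ?V" if "e \<in> edges G" for e using G that by (auto simp: simple_graph_def)
  obtain h :: "complex \<Rightarrow> 'a" and z where h: "inj h" "continuous_map euclidean X h"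
    "\<And>W. open W \<Longrightarrow> openin X (h ` W)" "h z = \<phi> v"
    using surface_chart[OF X] v \<phi> by blast
  have pre: "closed {x. h x \<in> S}" if "closedin X S" for S
    using closedin_continuous_map_preimage[OF h(2) that] by simp
  have pre_open: "open {x. h x \<in> S}" if "openin X S" for S
    using openin_continuous_map_preimage[OF h(2) that] by simp
  have clV: "closedin X (\<phi> ` (?V - {v}))"
    by (rule closedin_Hausdorff_finite[OF haus]) (use \<phi> fin in auto)
  have clE: "closedin X (\<gamma> e ` {0..1})" if "e \<in> edges G" for e
    using pathin_image_closedin[OF haus \<gamma>[OF that]] by simp
  \<comment> \<open>The escape argument. \<open>Y\<close> is a piece of an edge leading from a point
    inside the curve to a vertex other than \<open>v\<close>. The image of the inside and the
    complement of the image of the closed inside are both open and would disconnect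
    \<open>Y\<close>.\<close>
  have tail: False
    if y: "y \<in> inside J" and J: "J \<subseteq> ball z \<epsilon>" "compact J" "frontier (inside J) = J" "bounded (inside J)" "open (inside J)"
      and av: "\<And>w. w \<in> ?V \<Longrightarrow> w \<noteq> v \<Longrightarrow> \<phi> w \<notin> h ` ball z \<epsilon>" and Y: "connectedin X Y" "h y \<in> Y" "Y \<inter> h ` J = {}"
      and w: "\<phi> w \<in> Y" "w \<in> ?V" "w \<noteq> v"
    for y J \<epsilon> Y w
  proof -
    have cl: "closure (inside J) = inside J \<union> J"
      using J(3) closure_Un_frontier[of "inside J"] by simp
    then have "compact (inside J \<union> J)" using J(4) by (metis compact_closure)
    then have "compactin X (h ` (inside J \<union> J))" by (intro image_compactin[OF _ h(2)]) simp
    then have o2: "openin X (topspace X - h ` (inside J \<union> J))"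
      using compactin_imp_closedin[OF haus] by blast
    have "inside J \<union> J \<subseteq> ball z \<epsilon>" using J(1) inside_subset_ball by blast
    then have "\<phi> w \<in> topspace X - h ` (inside J \<union> J)" using av[OF w(2,3)] w(2) \<phi>(1) by blast
    moreover have "h y \<in> h ` inside J" using y by (rule imageI)
    moreover have "Y \<subseteq> topspace X" using Y(1) connectedin_subset_topspace by blast
    ultimately have "Y \<subseteq> h ` inside J \<union> (topspace X - h ` (inside J \<union> J))"
      "h ` inside J \<inter> (topspace X - h ` (inside J \<union> J)) \<inter> Y = {}"
      "h ` inside J \<inter> Y \<noteq> {}" "(topspace X - h ` (inside J \<union> J)) \<inter> Y \<noteq> {}"
      using Y(2,3) w(1) by (auto simp: image_Un)
    moreover have "\<nexists>E1 E2. openin X E1 \<and> openin X E2 \<and> Y \<subseteq> E1 \<union> E2 \<and> E1 \<inter> E2 \<inter> Y = {} \<and>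
        E1 \<inter> Y \<noteq> {} \<and> E2 \<inter> Y \<noteq> {}" using Y(1) unfolding connectedin by blast
    ultimately show False using h(3)[OF J(5)] o2 by meson
  qed
  show thesis
  proof (cases "\<exists>e\<in>edges G. v \<in> e")
    case False
    have "closedin X (\<phi> ` (?V - {v}) \<union> (\<Union>e\<in>edges G. \<gamma> e ` {0..1}))"
      by (intro closedin_Un clV closedin_Union) (use finite_edges[OF G] clE in auto)
    then have "openin X (topspace X - (\<phi> ` (?V - {v}) \<union> (\<Union>e\<in>edges G. \<gamma> e ` {0..1})))" (is "openin X ?W")
      by blast
    then have "open {x. h x \<in> ?W}" by (rule pre_open)
    moreover have "\<phi> v \<notin> \<gamma> e ` {0..1}" if e: "e \<in> edges G" for e
    proof -
      have "v \<notin> e" using False e by blast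
      then have "\<phi> v \<notin> \<phi> ` e" using \<phi>(2) v eV[OF e] by (auto simp: inj_on_def)
      then show ?thesis using \<gamma>ends[OF e] \<gamma>V[OF e] v by blast
    qed
    then have "h z \<in> ?W" using h(4) v \<phi> by (auto simp: inj_on_def)
    ultimately obtain \<epsilon> where \<epsilon>: "\<epsilon> > 0" "ball z \<epsilon> \<subseteq> {x. h x \<in> ?W}" by (auto simp: open_contains_ball)
    \<comment> \<open>An isolated vertex has no edge to follow, so a short segment takes its place.
      The disc meets the drawing in \<open>v\<close> only.\<close>
    define \<sigma> where "\<sigma> = linepath z (z + of_real (\<epsilon> / 2))"
    have \<sigma>: "arc \<sigma>" "path_image \<sigma> \<subseteq> ball z \<epsilon>" "\<sigma> 0 = z"
      using \<epsilon>(1) closed_segment_subset[of z "ball z \<epsilon>" "z + of_real (\<epsilon> / 2)"]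
      by (auto simp: \<sigma>_def dist_norm linepath_0' )
    have "\<sigma> ` {0<..<1} \<subseteq> path_image \<sigma>" by (auto simp: path_image_def)
    then have "(- ball z \<epsilon>) \<inter> \<sigma> ` {0<..<1} = {}" using \<sigma>(2) by blast
    then obtain s \<beta> where \<beta>: "0 < s" "s < 1" "theta_pair \<beta> (subpath 0 s \<sigma>)" "pathstart \<beta> = \<sigma> 0"
      "\<beta> ` {0<..<1} \<inter> (- ball z \<epsilon> \<union> path_image \<sigma>) = {}" "path_image (subpath 0 s \<sigma>) = \<sigma> ` {0..s}"
      "path_image \<beta> = insert (\<sigma> 0) (insert (\<sigma> s) (\<beta> ` {0<..<1}))"
      using theta_pair_from_arc[OF \<sigma>(1) closed_Compl[OF open_ball[of z \<epsilon>]]] by blast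
    let ?J = "path_image \<beta> \<union> path_image (subpath 0 s \<sigma>)"
    have s\<sigma>: "\<sigma> ` {0..s} \<subseteq> path_image \<sigma>" "\<sigma> 0 \<in> \<sigma> ` {0..s}" "\<sigma> s \<in> \<sigma> ` {0..s}"
      using \<beta>(1,2) by (auto simp: path_image_def)
    have bb: "\<beta> ` {0<..<1} \<subseteq> ball z \<epsilon>" using \<beta>(5) by blast
    have ss: "\<sigma> ` {0..s} \<subseteq> ball z \<epsilon>" using s\<sigma>(1) \<sigma>(2) by (rule order_trans)
    have J: "?J \<subseteq> ball z \<epsilon>" unfolding \<beta>(6,7) using bb ss s\<sigma>(2,3) by blast
    have zJ: "z \<in> ?J" using \<beta>(7) \<sigma>(3) by simp
    have K: "y = z" if "h y \<in> ?K" "y \<in> ball z \<epsilon>" for y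
    proof -
      have "h y \<in> ?W" using that \<epsilon>(2) by blast
      then have "h y = \<phi> v" using that(1) by (auto simp: drawing_def)
      then show ?thesis using h(1,4) by (metis injD)
    qed
    have "h ` inside ?J \<inter> ?K = {}"
    proof -
      have "z \<notin> inside ?J" "inside ?J \<subseteq> ball z \<epsilon>"
        using zJ theta_pair_inside(6)[OF \<beta>(3)] inside_subset_ball[OF J] by blast+
      then show ?thesis using K by blast
    qed
    moreover have "h ` \<beta> ` {0<..<1} \<inter> ?K = {}"
    proof -
      have "z \<in> path_image \<sigma>" using s\<sigma>(1,2) \<sigma>(3) by (metis subsetD)
      then have "z \<notin> \<beta> ` {0<..<1}" using \<beta>(5) by blast
      then show ?thesis using K bb by blast
    qed
    ultimately show thesis using that[OF h(1,2) _ \<beta>(3)] \<beta>(4) \<sigma>(3) h(4) by simp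
  next
    case True
    then obtain e where e: "e \<in> edges G" "v \<in> e" by blast
    obtain g w where g: "pathin X g" "inj_on g {0..1}" "g 0 = \<phi> v" "g 1 = \<phi> w" "e = {v, w}" "v \<noteq> w"
      "w \<in> ?V" "g ` {0<..<1} = \<gamma> e ` {0<..<1}" "g ` {0..1} = \<gamma> e ` {0..1}"
      using oriented_edge[OF E G e] by blast
    have "open {x. h x \<in> topspace X - \<phi> ` (?V - {v})}" using clV by (intro pre_open) blast
    moreover have "h z \<in> topspace X - \<phi> ` (?V - {v})" using h(4) v \<phi> by (auto simp: inj_on_def)
    ultimately obtain \<epsilon> where \<epsilon>: "\<epsilon> > 0" "ball z \<epsilon> \<subseteq> {x. h x \<in> topspace X - \<phi> ` (?V - {v})}"
      by (auto simp: open_contains_ball)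
    have "h y \<notin> \<phi> ` (?V - {v})" if "y \<in> ball z \<epsilon>" for y using subsetD[OF \<epsilon>(2) that] by blast
    then have av: "\<phi> u \<notin> h ` ball z \<epsilon>" if "u \<in> ?V" "u \<noteq> v" for u
      using that by (metis DiffI empty_iff image_iff insert_iff)
    have cg: "continuous_map (top_of_set {0..1}) X g" using g(1) by (simp add: pathin_def)
    have "openin (top_of_set {0..1}) {t \<in> {0..1}. g t \<in> h ` ball z \<epsilon>}"
      using openin_continuous_map_preimage[OF cg h(3)[OF open_ball[of z \<epsilon>]]] by simp
    moreover have "0 \<in> {t \<in> {0..1}. g t \<in> h ` ball z \<epsilon>}" using g(3) h(4) \<epsilon>(1) by (auto intro!: image_eqI[of _ _ z])
    ultimately obtain d where d: "d > 0" "\<And>t. t \<in> {0..1} \<Longrightarrow> dist t 0 < d \<Longrightarrow> g t \<in> h ` ball z \<epsilon>"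
      unfolding openin_euclidean_subtopology_iff by blast
    \<comment> \<open>A time up to which, inclusively, the edge stays in the disc.\<close>
    define t0 where "t0 = min (d / 2) (1 / 2)"
    have t0: "0 < t0" "t0 < 1" "\<And>t. 0 \<le> t \<Longrightarrow> t \<le> t0 \<Longrightarrow> g t \<in> h ` ball z \<epsilon>"
      using d by (auto simp: t0_def)
    define \<sigma> where "\<sigma> t = inv_into UNIV h (g (t0 * t))" for t
    have tt: "0 \<le> t0 * t \<and> t0 * t \<le> t0" if "t \<in> {0..1}" for t
      using that t0(1) by (auto simp: mult_left_le)
    have h\<sigma>: "h (\<sigma> t) = g (t0 * t)" "\<sigma> t \<in> ball z \<epsilon>" if t: "t \<in> {0..1}" for t
    proof -
      obtain y where y: "y \<in> ball z \<epsilon>" "g (t0 * t) = h y" using t0(3)[of "t0 * t"] tt[OF t] by blast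
      then have "\<sigma> t = y" unfolding \<sigma>_def using h(1) by simp
      then show "h (\<sigma> t) = g (t0 * t)" "\<sigma> t \<in> ball z \<epsilon>" using y by auto
    qed
    \<comment> \<open>\<open>h\<close> is open and injective, so the preimage of an open set under
      \<open>\<sigma>\<close> is the preimage of its open image under the edge.\<close>
    have "continuous_map (top_of_set {0..1}) euclidean \<sigma>"
      unfolding continuous_map_def
    proof (intro conjI allI impI)
      fix W :: "complex set" assume "openin euclidean W"
      then have W: "openin X (h ` W)" using h(3) by simp
      have "continuous_map (top_of_set {0..1}) (top_of_set {0..1}) (\<lambda>t. t0 * t)"
      proof -
        have "0 \<le> t0 * t \<and> t0 * t \<le> 1" if "t \<in> {0..1}" for t using tt[OF that] t0(2) by linarith
        then show ?thesis by (auto simp: image_subset_iff Pi_iff intro!: continuous_intros)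
      qed
      from continuous_map_compose[OF this cg]
      have "openin (top_of_set {0..1}) {t \<in> {0..1}. g (t0 * t) \<in> h ` W}"
        using openin_continuous_map_preimage[OF _ W] by (fastforce simp: o_def)
      moreover have "g (t0 * t) \<in> h ` W \<longleftrightarrow> \<sigma> t \<in> W" if "t \<in> {0..1}" for t
        unfolding h\<sigma>(1)[OF that, symmetric] by (rule inj_image_mem_iff[OF h(1)])
      then have "{t \<in> {0..1}. g (t0 * t) \<in> h ` W} = {t \<in> topspace (top_of_set {0..1}). \<sigma> t \<in> W}"
        by (simp cong: conj_cong)
      ultimately show "openin (top_of_set {0..1}) {t \<in> topspace (top_of_set {0..1}). \<sigma> t \<in> W}" by simp
    qed auto
    then have "path \<sigma>" by (simp add: path_def)
    moreover have "inj_on \<sigma> {0..1}"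
    proof (rule inj_onI)
      fix a b :: real assume ab: "a \<in> {0..1}" "b \<in> {0..1}" "\<sigma> a = \<sigma> b"
      then have "g (t0 * a) = g (t0 * b)" using h\<sigma>(1) by metis
      moreover have "t0 * a \<in> {0..1}" "t0 * b \<in> {0..1}" using tt[OF ab(1)] tt[OF ab(2)] t0(2) by auto
      ultimately have "t0 * a = t0 * b" by (rule inj_onD[OF g(2)])
      then show "a = b" using t0(1) by simp
    qed
    ultimately have \<sigma>: "arc \<sigma>" by (simp add: arc_def)
    have "h (\<sigma> 0) = h z" using h\<sigma>(1)[of 0] g(3) h(4) by simp
    then have \<sigma>0: "\<sigma> 0 = z" by (rule injD[OF h(1)])
    have \<sigma>ball: "path_image \<sigma> \<subseteq> ball z \<epsilon>" unfolding path_image_def using h\<sigma>(2) by blast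
    \<comment> \<open>Everything drawn except the piece of \<open>e\<close> strictly between times 0
      and \<open>t0\<close>. Together with the outside of the disc it forms the closed set that the
      new arc must avoid.\<close>
    define K0 where "K0 = \<phi> ` ?V \<union> (\<Union>e'\<in>edges G - {e}. \<gamma> e' ` {0..1}) \<union> g ` {t0..1}"
    have "closedin X (\<Union>e'\<in>edges G - {e}. \<gamma> e' ` {0..1})"
    proof (rule closedin_Union)
      show "finite ((\<lambda>e'. \<gamma> e' ` {0..1}) ` (edges G - {e}))" using finite_edges[OF G] by simp
      fix T assume "T \<in> (\<lambda>e'. \<gamma> e' ` {0..1}) ` (edges G - {e})"
      then obtain e' where "e' \<in> edges G" "T = \<gamma> e' ` {0..1}" by blast
      then show "closedin X T" using clE by simp
    qed
    moreover have "closedin X (\<phi> ` ?V)" by (rule closedin_Hausdorff_finite[OF haus \<phi>(1)]) (use fin in simp)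
    moreover have "closedin X (g ` {t0..1})" using pathin_image_closedin[OF haus g(1)] t0(1) by simp
    ultimately have "closedin X K0" unfolding K0_def by (metis closedin_Un)
    then have clC: "closed ({x. h x \<in> K0} \<union> - ball z \<epsilon>)" using pre by (intro closed_Un) auto
    have gint: "g r \<notin> \<phi> ` ?V" "e' \<in> edges G \<Longrightarrow> e' \<noteq> e \<Longrightarrow> g r \<notin> \<gamma> e' ` {0..1}" if "0 < r" "r < 1" for r e'
    proof -
      have "g r \<in> \<gamma> e ` {0<..<1}" unfolding g(8)[symmetric] using that by simp
      then show "g r \<notin> \<phi> ` ?V" "e' \<in> edges G \<Longrightarrow> e' \<noteq> e \<Longrightarrow> g r \<notin> \<gamma> e' ` {0..1}"
      proof -
        show "g r \<notin> \<phi> ` ?V" using \<gamma>V[OF e(1)] \<open>g r \<in> \<gamma> e ` {0<..<1}\<close> by (metis IntI empty_iff)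
        assume e': "e' \<in> edges G" "e' \<noteq> e"
        have "\<gamma> e' ` {0..1} \<subseteq> \<gamma> e' ` {0<..<1} \<union> \<phi> ` ?V" using \<gamma>ends[OF e'(1)] eV[OF e'(1)] by (meson Un_mono image_mono order_refl order_trans)
        moreover have "g r \<notin> \<gamma> e' ` {0<..<1}"
          using \<gamma>dis[OF e'(1) e(1) e'(2)] \<open>g r \<in> \<gamma> e ` {0<..<1}\<close> by (metis IntI empty_iff)
        ultimately show "g r \<notin> \<gamma> e' ` {0..1}" using \<open>g r \<notin> \<phi> ` ?V\<close> by (metis UnE subsetD)
      qed
    qed
    have "\<sigma> t \<notin> {x. h x \<in> K0} \<union> - ball z \<epsilon>" if t: "0 < t" "t < 1" for t
    proof -
      have r: "0 < t0 * t" "t0 * t < t0" using t t0(1) by auto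
      have "g (t0 * t) \<notin> g ` {t0..1}"
      proof
        assume "g (t0 * t) \<in> g ` {t0..1}"
        then obtain r' where "t0 \<le> r'" "r' \<le> 1" "g (t0 * t) = g r'" by auto
        then show False using inj_onD[OF g(2), of "t0 * t" r'] r t0 by auto
      qed
      then have "g (t0 * t) \<notin> K0" using gint[of "t0 * t"] r t0(2) unfolding K0_def by auto
      then show ?thesis using h\<sigma>[of t] t by auto
    qed
    then have "({x. h x \<in> K0} \<union> - ball z \<epsilon>) \<inter> \<sigma> ` {0<..<1} = {}" by auto
    from theta_pair_from_arc[OF \<sigma> clC this]
    obtain s \<beta> where \<beta>: "0 < s" "s < 1" "theta_pair \<beta> (subpath 0 s \<sigma>)" "pathstart \<beta> = \<sigma> 0"
      "\<beta> ` {0<..<1} \<inter> ({x. h x \<in> K0} \<union> - ball z \<epsilon> \<union> path_image \<sigma>) = {}"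
      "path_image (subpath 0 s \<sigma>) = \<sigma> ` {0..s}"
      "path_image \<beta> = insert (\<sigma> 0) (insert (\<sigma> s) (\<beta> ` {0<..<1}))" .
    let ?J = "path_image \<beta> \<union> path_image (subpath 0 s \<sigma>)"
    have s\<sigma>: "\<sigma> ` {0..s} \<subseteq> path_image \<sigma>" "\<sigma> 0 \<in> \<sigma> ` {0..s}" "\<sigma> s \<in> \<sigma> ` {0..s}"
      using \<beta>(1,2) by (auto simp: path_image_def)
    have bb: "\<beta> ` {0<..<1} \<subseteq> ball z \<epsilon>" using \<beta>(5) by blast
    have ss: "\<sigma> ` {0..s} \<subseteq> ball z \<epsilon>" using s\<sigma>(1) \<sigma>ball by (rule order_trans)
    have J: "?J \<subseteq> ball z \<epsilon>" unfolding \<beta>(6,7) using bb ss s\<sigma>(2,3) by blast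
    have KK: "?K \<subseteq> K0 \<union> h ` path_image \<sigma>"
    proof -
      have "g ` {0..1} \<subseteq> g ` {t0..1} \<union> h ` path_image \<sigma>"
      proof
        fix y assume "y \<in> g ` {0..1}"
        then obtain r where r: "0 \<le> r" "r \<le> 1" "y = g r" by auto
        show "y \<in> g ` {t0..1} \<union> h ` path_image \<sigma>"
        proof (cases "r \<ge> t0")
          case False
          then have "r / t0 \<in> {0..1}" using r t0(1) by auto
          moreover have "y = h (\<sigma> (r / t0))" using h\<sigma>(1)[OF calculation] r t0(1) by simp
          ultimately show ?thesis by (auto simp: path_image_def)
        qed (use r in auto)
      qed
      then have "\<gamma> e ` {0..1} \<subseteq> K0 \<union> h ` path_image \<sigma>" unfolding g(9) K0_def by (rule order_trans) blast
      moreover have "\<gamma> e' ` {0..1} \<subseteq> K0" if "e' \<in> edges G" "e' \<noteq> e" for e'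
        unfolding K0_def using that by auto
      moreover have "\<phi> ` ?V \<subseteq> K0" unfolding K0_def by auto
      ultimately have "\<gamma> e' ` {0..1} \<subseteq> K0 \<union> h ` path_image \<sigma>" if "e' \<in> edges G" for e'
        using that by (cases "e' = e") (blast intro: le_supI1)+
      then show ?thesis unfolding drawing_def using \<open>\<phi> ` ?V \<subseteq> K0\<close> by (intro Un_least UN_least) blast+
    qed
    have b1: "h ` \<beta> ` {0<..<1} \<inter> ?K = {}"
    proof (rule ccontr)
      assume "h ` \<beta> ` {0<..<1} \<inter> ?K \<noteq> {}"
      then obtain y where y: "y \<in> \<beta> ` {0<..<1}" "h y \<in> ?K" by blast
      then consider "h y \<in> K0" | "h y \<in> h ` path_image \<sigma>" using KK by blast
      then show False
      proof cases
        case 2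
        then have "y \<in> path_image \<sigma>" using inj_image_mem_iff[OF h(1)] by blast
        then show False using y \<beta>(5) by blast
      qed (use y \<beta>(5) in blast)
    qed
    \<comment> \<open>The curve meets the drawing only in that piece of \<open>e\<close> from which
      it was built, which ends at time \<open>t0 * s\<close>.\<close>
    have hJ: "h ` ?J \<inter> ?K \<subseteq> g ` {0..t0 * s}"
    proof -
      have "h (\<sigma> t) \<in> g ` {0..t0 * s}" if "0 \<le> t" "t \<le> s" for t
        using that h\<sigma>(1)[of t] \<beta>(2) t0(1) by auto
      then have "h ` \<sigma> ` {0..s} \<subseteq> g ` {0..t0 * s}" by auto
      moreover have "h ` ?J \<subseteq> h ` \<beta> ` {0<..<1} \<union> h ` \<sigma> ` {0..s}" unfolding \<beta>(6,7) using s\<sigma>(2,3) by blast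
      ultimately show ?thesis using b1 by (simp add: disjoint_iff subset_iff) metis
    qed
    note I = theta_pair_inside[OF \<beta>(3)]
    have "h ` inside ?J \<inter> ?K = {}"
    proof (rule ccontr)
      assume "h ` inside ?J \<inter> ?K \<noteq> {}"
      then obtain y where y: "y \<in> inside ?J" "h y \<in> ?K" by blast
      have yb: "y \<in> ball z \<epsilon>" using y(1) inside_subset_ball[OF J] by blast
      have yJ: "y \<notin> ?J" using I(6) y(1) by blast
      have "z \<in> ?J" using \<beta>(7) \<sigma>0 by simp
      then have "y \<noteq> z" using yJ by blast
      then have "h y \<noteq> \<phi> v" using h(1,4) by (metis injD)
      then have nV: "h y \<notin> \<phi> ` ?V" using av imageI[OF yb, of h] by (metis imageE)
      then obtain e' where e': "e' \<in> edges G" "h y \<in> \<gamma> e' ` {0..1}" using y(2) by (auto simp: drawing_def)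
      then have e'i: "h y \<in> \<gamma> e' ` {0<..<1}" using \<gamma>ends[OF e'(1)] eV[OF e'(1)] nV by blast
      note T = tail[OF y(1) J I(1,7,5,3) av]
      show False
      proof (cases "e' = e")
        case True
        then obtain r where r: "0 < r" "r < 1" "h y = g r" using e'i g(8) by force
        \<comment> \<open>A point of \<open>e\<close> at an earlier time would lie on the curve
          itself. Hence the rest of \<open>e\<close>, from this point to \<open>w\<close>, avoids
          the curve.\<close>
        have "r > t0 * s"
        proof (rule ccontr)
          assume "\<not> r > t0 * s"
          then have "r / t0 \<le> s" using t0(1) by (simp add: field_simps)
          then have rs: "r / t0 \<in> {0..s}" using r t0(1) by auto
          then have "r / t0 \<in> {0..1}" using \<beta>(2) by auto
          then have "h (\<sigma> (r / t0)) = h y" using h\<sigma>(1)[of "r / t0"] r(3) t0(1) by simp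
          then have "y = \<sigma> (r / t0)" using h(1) by (metis injD)
          then have "y \<in> ?J" unfolding \<beta>(6) using rs by blast
          then show False using yJ by blast
        qed
        have "g ` {r..1} \<inter> g ` {0..t0 * s} = g ` ({r..1} \<inter> {0..t0 * s})"
          by (rule inj_on_image_Int[OF g(2), symmetric]) (use r t0 \<beta>(1,2) in \<open>auto intro: order_trans[OF mult_le_one]\<close>)
        also have "{r..1} \<inter> {0..t0 * s} = {}" using \<open>r > t0 * s\<close> by auto
        finally have "g ` {r..1} \<inter> g ` {0..t0 * s} = {}" by simp
        moreover have "g ` {r..1} \<subseteq> ?K" using r g(9) e(1) by (auto simp: drawing_def) (metis atLeastAtMost_iff image_eqI less_eq_real_def order_trans)
        ultimately have "g ` {r..1} \<inter> h ` ?J = {}" using hJ by blast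
        moreover have "connectedin X (g ` {r..1})" using pathin_image_connectedin[OF g(1), of r 1] r by simp
        moreover have "h y \<in> g ` {r..1}" "\<phi> w \<in> g ` {r..1}"
          unfolding r(3) g(4)[symmetric] using r(1,2) by (intro imageI; simp)+
        ultimately show False using T[of "g ` {r..1}" w] g(6,7) by simp
      next
        case False
        \<comment> \<open>Another edge has an end different from \<open>v\<close>, and is followed
          from that end to the point in question, stopping before the second end. Since the
          interiors of edges are disjoint and contain no vertex, this piece avoids the
          curve.\<close>
        have "card e' = 2" using G e'(1) by (auto simp: simple_graph_def)
        then obtain w' where w': "w' \<in> e'" "w' \<noteq> v" by (auto simp: card_2_iff)
        obtain g' u where g': "pathin X g'" "inj_on g' {0..1}" "g' 0 = \<phi> w'"
          "g' ` {0<..<1} = \<gamma> e' ` {0<..<1}" "g' ` {0..1} = \<gamma> e' ` {0..1}"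
          using oriented_edge[OF E G e'(1) w'(1)] by metis
        have w'V: "w' \<in> ?V" using eV[OF e'(1)] w'(1) by blast
        obtain r where r: "0 < r" "r < 1" "h y = g' r" using e'i g'(4) by force
        have gsub: "g ` {0..t0 * s} \<subseteq> insert (\<phi> v) (g ` {0<..<1})"
        proof
          fix x assume "x \<in> g ` {0..t0 * s}"
          then obtain q where q: "0 \<le> q" "q \<le> t0 * s" "x = g q" by auto
          have "t0 * s < 1" using mult_strict_mono[of t0 1 s 1] t0(2) \<beta>(1,2) by simp
          then have "q = 0 \<or> q \<in> {0<..<1}" using q by auto
          then show "x \<in> insert (\<phi> v) (g ` {0<..<1})" using q(3) g(3) by blast
        qed
        have "{0..r} \<subseteq> insert 0 {0<..<1}" using r by auto
        then have "g' ` {0..r} \<subseteq> g' ` insert 0 {0<..<1}" by (rule image_mono)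
        then have g'sub: "g' ` {0..r} \<subseteq> insert (\<phi> w') (\<gamma> e' ` {0<..<1})" unfolding image_insert g'(3,4) .
        have "\<phi> w' \<noteq> \<phi> v" using \<phi>(2) w'(2) w'V v by (auto simp: inj_on_def)
        moreover have "\<phi> w' \<notin> \<gamma> e ` {0<..<1}" "\<phi> v \<notin> \<gamma> e' ` {0<..<1}"
          using \<gamma>V[OF e(1)] \<gamma>V[OF e'(1)] v w'V by blast+
        moreover have "\<gamma> e' ` {0<..<1} \<inter> \<gamma> e ` {0<..<1} = {}" using \<gamma>dis[OF e'(1) e(1) False] .
        ultimately have "insert (\<phi> w') (\<gamma> e' ` {0<..<1}) \<inter> insert (\<phi> v) (\<gamma> e ` {0<..<1}) = {}" by auto
        then have "g' ` {0..r} \<inter> g ` {0..t0 * s} = {}"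
          using gsub g'sub unfolding g(8) by (meson disjoint_iff subset_eq)
        moreover have "g' ` {0..r} \<subseteq> g' ` {0..1}" using r by auto
        then have "g' ` {0..r} \<subseteq> ?K" unfolding g'(5) drawing_def using e'(1) by blast
        ultimately have "g' ` {0..r} \<inter> h ` ?J = {}" using hJ by blast
        moreover have "connectedin X (g' ` {0..r})" using pathin_image_connectedin[OF g'(1), of 0 r] r by simp
        moreover have "h y \<in> g' ` {0..r}" "\<phi> w' \<in> g' ` {0..r}"
          unfolding r(3) g'(3)[symmetric] using r(1,2) by (intro imageI; simp)+
        ultimately show False using T[of "g' ` {0..r}" w'] w'V w'(2) by simp
      qed
    qed
    moreover have "h (pathstart \<beta>) = \<phi> v" unfolding \<beta>(4) \<sigma>0 by (rule h(4))
    ultimately show thesis using that[OF h(1,2) _ \<beta>(3) b1] by blast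
  qed
qed

text \<open>The order of the path is given by a rank function instead of a list: a subset of
  \<open>Q\<close> inherits the order through the same \<open>r\<close>, which suits deletion and
  contraction.\<close>

definition consecutive :: "nat set \<Rightarrow> (nat \<Rightarrow> nat) \<Rightarrow> nat \<Rightarrow> nat \<Rightarrow> bool" where
  "consecutive Q r p q \<longleftrightarrow> p \<in> Q \<and> q \<in> Q \<and> r p < r q \<and> (\<forall>z\<in>Q. \<not> (r p < r z \<and> r z < r q))"

definition fan_edges :: "nat set \<Rightarrow> (nat \<Rightarrow> nat) \<Rightarrow> nat \<Rightarrow> nat set set" where
  "fan_edges Q r v = {{v, p} |p. p \<in> Q} \<union> {{p, q} |p q. consecutive Q r p q}"

text \<open>Ranks may have gaps, positions counted from 0 do not; they index the spokes provided by
  \<open>fan_in_theta_pair\<close>.\<close>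

definition fan_rank :: "nat set \<Rightarrow> (nat \<Rightarrow> nat) \<Rightarrow> nat \<Rightarrow> nat" where
  "fan_rank Q r p = card {z \<in> Q. r z < r p}"

lemma fan_rank_mono:
  assumes "finite Q" "p \<in> Q" "r p < r q"
  shows "fan_rank Q r p < fan_rank Q r q"
  unfolding fan_rank_def by (rule psubset_card_mono) (use assms in auto)

lemma fan_rank_less: "finite Q \<Longrightarrow> p \<in> Q \<Longrightarrow> fan_rank Q r p < card Q"
  unfolding fan_rank_def by (rule psubset_card_mono) auto

lemma fan_rank_consecutive:
  assumes "finite Q" "inj_on r Q" "consecutive Q r p q"
  shows "fan_rank Q r q = Suc (fan_rank Q r p)"
proof -
  have "{z \<in> Q. r z < r q} = insert p {z \<in> Q. r z < r p}"
  proof (intro equalityI subsetI)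
    fix z assume z: "z \<in> {z \<in> Q. r z < r q}"
    then have "r z \<le> r p" using assms(3) by (auto simp: consecutive_def not_less)
    then show "z \<in> insert p {z \<in> Q. r z < r p}"
      using z assms(2,3) by (cases "r z = r p") (auto simp: consecutive_def inj_on_def)
  qed (use assms(3) in \<open>auto simp: consecutive_def\<close>)
  then show ?thesis using assms(1) by (simp add: fan_rank_def)
qed

lemma fan_rank_inj:
  assumes "finite Q" "inj_on r Q"
  shows "inj_on (fan_rank Q r) Q"
proof (rule inj_onI)
  fix p q assume "p \<in> Q" "q \<in> Q" "fan_rank Q r p = fan_rank Q r q"
  then show "p = q" using fan_rank_mono[OF assms(1), of p r q] fan_rank_mono[OF assms(1), of q r p] assms(2)
    by (metis inj_onD nat_neq_iff)
qed

text \<open>A path vertex lies where the spoke with its position ends on \<open>\<beta>\<close>, and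
  the path runs along \<open>\<beta>\<close> itself. The interiors of spokes are inside the curve
  and those of path edges on it, so the two kinds cannot meet.\<close>

lemma fan_embedding_plane:
  assumes th: "theta_pair \<beta> \<delta>" and Q: "finite Q" "inj_on r Q" "v \<notin> Q"
  obtains \<psi> :: "nat \<Rightarrow> complex" and \<alpha> where "\<psi> v = pathstart \<beta>" "inj_on \<psi> (insert v Q)" "\<psi> ` Q \<subseteq> \<beta> ` {0<..<1}"
    "\<And>e. e \<in> fan_edges Q r v \<Longrightarrow> arc (\<alpha> e) \<and> {\<alpha> e 0, \<alpha> e 1} = \<psi> ` e \<and>
      \<alpha> e ` {0<..<1} \<subseteq> (inside (path_image \<beta> \<union> path_image \<delta>) \<union> \<beta> ` {0<..<1}) - \<psi> ` Q"
    "\<And>e f. e \<in> fan_edges Q r v \<Longrightarrow> f \<in> fan_edges Q r v \<Longrightarrow> e \<noteq> f \<Longrightarrow> \<alpha> e ` {0<..<1} \<inter> \<alpha> f ` {0<..<1} = {}"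
proof -
  let ?I = "inside (path_image \<beta> \<union> path_image \<delta>)" and ?k = "card Q"
  define \<rho> where "\<rho> = fan_rank Q r"
  obtain t :: "nat \<Rightarrow> real" and c where tc: "\<forall>i<?k. 0 < t i \<and> t i < 1 \<and> arc (c i) \<and> pathstart (c i) = pathstart \<beta> \<and>
      pathfinish (c i) = \<beta> (t i) \<and> path_image (c i) - {pathstart \<beta>, \<beta> (t i)} \<subseteq> ?I"
    "\<forall>i<?k. \<forall>j<?k. i < j \<longrightarrow> t i < t j \<and> path_image (c i) \<inter> path_image (c j) = {pathstart \<beta>}"
    using fan_in_theta_pair[OF th, of ?k] by (elim exE conjE) (rule that)
  note tc1 = tc(1)[rule_format] and tc2 = tc(2)[rule_format]
  have \<rho>k: "\<rho> p < ?k" if "p \<in> Q" for p using fan_rank_less[OF Q(1) that] by (simp add: \<rho>_def)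
  have \<rho>inj: "p = q" if "p \<in> Q" "q \<in> Q" "\<rho> p = \<rho> q" for p q
    using fan_rank_inj[OF Q(1,2)] that by (auto simp: inj_on_def \<rho>_def)
  have tinj: "t i = t j \<Longrightarrow> i = j" if "i < ?k" "j < ?k" for i j using tc2[of i j] tc2[of j i] that by (metis nat_neq_iff less_irrefl)
  have tless: "i < j" if "t i < t j" "i < ?k" "j < ?k" for i j
  proof (rule ccontr)
    assume "\<not> i < j"
    then consider "i = j" | "j < i" by linarith
    then show False
    proof cases
      case 2
      then have "t j < t i" using tc2[OF that(3,2)] by blast
      then show False using that(1) by simp
    qed (use that(1) in simp)
  qed
  have inj: "inj_on \<beta> {0..1}" using th by (simp add: theta_pair_def arc_def)
  have \<beta>arc: "arc \<beta>" using th by (simp add: theta_pair_def)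
  have \<beta>eq: "a = b" if "\<beta> a = \<beta> b" "0 \<le> a" "a \<le> 1" "0 \<le> b" "b \<le> 1" for a b
    using inj_onD[OF inj that(1)] that by simp
  have \<beta>0: "pathstart \<beta> = \<beta> 0" by (simp add: pathstart_def)
  have \<beta>notI: "\<beta> a \<notin> ?I" if "0 \<le> a" "a \<le> 1" for a
    using theta_pair_inside(6)[OF th] that by (auto simp: path_image_def)
  have cint: "c i ` {0<..<1} \<subseteq> ?I" if i: "i < ?k" for i
  proof
    fix x assume "x \<in> c i ` {0<..<1}"
    then obtain s where s: "0 < s" "s < 1" "x = c i s" by auto
    have ic: "inj_on (c i) {0..1}" using tc1[OF i] by (simp add: arc_def)
    have "c i 0 = \<beta> 0" "c i 1 = \<beta> (t i)" using tc1[OF i] by (auto simp: pathstart_def pathfinish_def)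
    then have "x \<noteq> \<beta> 0" "x \<noteq> \<beta> (t i)" using s inj_onD[OF ic, of s 0] inj_onD[OF ic, of s 1] by auto
    moreover have "x \<in> path_image (c i)" using s by (auto simp: path_image_def)
    ultimately show "x \<in> ?I" using tc1[OF i] \<beta>0 by auto
  qed
  define \<psi> where "\<psi> p = (if p = v then \<beta> 0 else \<beta> (t (\<rho> p)))" for p
  \<comment> \<open>\<open>THE\<close> extracts the path vertex of a spoke. For a path edge,
    \<open>Min\<close> is the position of its earlier end, and the later end has the next
    position.\<close>
  define \<alpha> where "\<alpha> e = (if v \<in> e then c (\<rho> (THE p. p \<in> e - {v})) else subpath (t (Min (\<rho> ` e))) (t (Suc (Min (\<rho> ` e)))) \<beta>)" for e
  have \<psi>v: "\<psi> v = \<beta> 0" by (simp add: \<psi>_def)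
  have \<psi>Q: "\<psi> p = \<beta> (t (\<rho> p))" if "p \<in> Q" for p using that Q(3) by (auto simp: \<psi>_def)
  have \<alpha>1: "\<alpha> {v, p} = c (\<rho> p)" if "p \<in> Q" for p
  proof -
    have "(THE q. q \<in> {v, p} - {v}) = p" using that Q(3) by auto
    then show ?thesis by (simp add: \<alpha>_def)
  qed
  have \<alpha>2: "\<alpha> {p, q} = subpath (t (\<rho> p)) (t (\<rho> q)) \<beta>" "\<rho> q = Suc (\<rho> p)" "p \<in> Q" "q \<in> Q" if "consecutive Q r p q" for p q
  proof -
    show pq: "p \<in> Q" "q \<in> Q" using that by (auto simp: consecutive_def)
    show *: "\<rho> q = Suc (\<rho> p)" using fan_rank_consecutive[OF Q(1,2) that] by (simp add: \<rho>_def)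
    have "v \<notin> {p, q}" using pq Q(3) by auto
    then show "\<alpha> {p, q} = subpath (t (\<rho> p)) (t (\<rho> q)) \<beta>" using * by (simp add: \<alpha>_def min_def)
  qed
  have sub_int: "subpath a b \<beta> ` {0<..<1} \<subseteq> \<beta> ` {a<..<b}" if "a < b" for a b
  proof
    fix x assume "x \<in> subpath a b \<beta> ` {0<..<1}"
    then obtain s where s: "0 < s" "s < 1" "x = \<beta> (a + (b - a) * s)" by (auto simp: subpath_def add.commute mult.commute)
    define u where "u = (b - a) * s"
    have "u < (b - a) * 1" unfolding u_def using s that by (intro mult_strict_left_mono) auto
    then have "u < b - a" by simp
    moreover have "0 < u" using s that by (simp add: u_def)
    ultimately have "a < a + u" "a + u < b" by linarith+
    then have "a < a + (b - a) * s" "a + (b - a) * s < b" unfolding u_def .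
    then have "a + (b - a) * s \<in> {a<..<b}" by (simp only: greaterThanLessThan_iff)
    then show "x \<in> \<beta> ` {a<..<b}" using s(3) by blast
  qed
  have seg: "t (\<rho> p) < t (\<rho> q)" "0 < t (\<rho> p)" "t (\<rho> q) < 1" if "consecutive Q r p q" for p q
  proof -
    have k: "\<rho> p < ?k" "\<rho> q < ?k" using \<rho>k[OF \<alpha>2(3)[OF that]] \<rho>k[OF \<alpha>2(4)[OF that]] .
    show "t (\<rho> p) < t (\<rho> q)" "0 < t (\<rho> p)" "t (\<rho> q) < 1"
      using tc2[OF k] tc1[OF k(1)] tc1[OF k(2)] \<alpha>2(2)[OF that] by simp_all
  qed
  have \<alpha>int2: "\<alpha> {p, q} ` {0<..<1} \<subseteq> \<beta> ` {t (\<rho> p)<..<t (\<rho> q)}" if "consecutive Q r p q" for p q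
    using sub_int[OF seg(1)[OF that]] \<alpha>2(1)[OF that] by simp
  have gap: "\<not> (t (\<rho> p) < t (\<rho> z) \<and> t (\<rho> z) < t (\<rho> q))" if "consecutive Q r p q" "z \<in> Q" for p q z
  proof
    assume a: "t (\<rho> p) < t (\<rho> z) \<and> t (\<rho> z) < t (\<rho> q)"
    have k: "\<rho> p < ?k" "\<rho> z < ?k" "\<rho> q < ?k" 
      using \<rho>k[OF \<alpha>2(3)[OF that(1)]] \<rho>k[OF that(2)] \<rho>k[OF \<alpha>2(4)[OF that(1)]] .
    have "\<rho> p < \<rho> z" "\<rho> z < \<rho> q" using a tless k by blast+
    then show False using \<alpha>2(2)[OF that(1)] by simp
  qed
  have c_disj: "c i ` {0<..<1} \<inter> c j ` {0<..<1} = {}" if ij: "i < ?k" "j < ?k" "i \<noteq> j" for i j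
  proof -
    have "path_image (c i) \<inter> path_image (c j) = {\<beta> 0}" using tc2[of i j] tc2[of j i] ij \<beta>0 by (metis Int_commute nat_neq_iff)
    moreover have "c i ` {0<..<1} \<subseteq> path_image (c i)" "c j ` {0<..<1} \<subseteq> path_image (c j)" by (auto simp: path_image_def)
    moreover have "\<beta> 0 \<notin> c i ` {0<..<1}" using cint[OF ij(1)] \<beta>notI[of 0] by auto
    ultimately show ?thesis by (smt (verit) disjoint_iff IntI singletonD subsetD)
  qed
  show thesis
  proof (rule that[of \<psi> \<alpha>])
    show "\<psi> v = pathstart \<beta>" by (simp add: \<psi>_def \<beta>0)
    show "inj_on \<psi> (insert v Q)"
    proof (rule inj_onI)
      fix p q assume pq: "p \<in> insert v Q" "q \<in> insert v Q" "\<psi> p = \<psi> q"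
      have *: "\<beta> (t (\<rho> p)) \<noteq> \<beta> 0" if "p \<in> Q" for p using \<beta>eq[of "t (\<rho> p)" 0] tc1[OF \<rho>k[OF that]] by auto
      show "p = q"
      proof (cases "p = v \<or> q = v")
        case True
        then show ?thesis using pq * by (auto simp: \<psi>_def split: if_splits)
      next
        case False
        then have "p \<in> Q" "q \<in> Q" "\<beta> (t (\<rho> p)) = \<beta> (t (\<rho> q))" using pq by (auto simp: \<psi>_def)
        then have "t (\<rho> p) = t (\<rho> q)" using \<beta>eq tc1[OF \<rho>k] by (metis less_eq_real_def)
        then show ?thesis using tinj \<rho>k \<rho>inj \<open>p \<in> Q\<close> \<open>q \<in> Q\<close> by metis
      qed
    qed
    show "\<psi> ` Q \<subseteq> \<beta> ` {0<..<1}" using \<psi>Q tc1[OF \<rho>k] by auto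
    have \<psi>I: "\<psi> ` Q \<inter> ?I = {}" using \<psi>Q tc1[OF \<rho>k] \<beta>notI by fastforce
    fix e assume e: "e \<in> fan_edges Q r v"
    show "arc (\<alpha> e) \<and> {\<alpha> e 0, \<alpha> e 1} = \<psi> ` e \<and> \<alpha> e ` {0<..<1} \<subseteq> (?I \<union> \<beta> ` {0<..<1}) - \<psi> ` Q"
    proof -
      consider p where "p \<in> Q" "e = {v, p}" | p q where "consecutive Q r p q" "e = {p, q}"
        using e by (auto simp: fan_edges_def)
      then show ?thesis
      proof cases
        case 1
        have "c (\<rho> p) 0 = \<beta> 0" "c (\<rho> p) 1 = \<beta> (t (\<rho> p))" using tc1[OF \<rho>k[OF 1(1)]] by (auto simp: pathstart_def pathfinish_def)
        moreover have "\<psi> ` e = {\<beta> 0, \<beta> (t (\<rho> p))}" using \<psi>Q[OF 1(1)] 1(2) \<psi>v by simp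
        moreover have "c (\<rho> p) ` {0<..<1} \<subseteq> (?I \<union> \<beta> ` {0<..<1}) - \<psi> ` Q"
          using cint[OF \<rho>k[OF 1(1)]] \<psi>I by blast
        ultimately show ?thesis using tc1[OF \<rho>k[OF 1(1)]] unfolding 1(2) \<alpha>1[OF 1(1)] by simp
      next
        case 2
        note a2 = \<alpha>2[OF 2(1)] and sg = seg[OF 2(1)]
        have "arc (\<alpha> e)" unfolding 2(2) a2(1) using arc_subpath_arc[OF \<beta>arc, of "t (\<rho> p)" "t (\<rho> q)"] sg by simp
        moreover have "{\<alpha> e 0, \<alpha> e 1} = \<psi> ` e" unfolding 2(2) a2(1) by (simp add: subpath_def \<psi>Q a2)
        moreover have "\<alpha> e ` {0<..<1} \<subseteq> \<beta> ` {0<..<1}"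
        proof -
          have "{t (\<rho> p)<..<t (\<rho> q)} \<subseteq> {0<..<1}" using sg by auto
          then show ?thesis unfolding 2(2) using \<alpha>int2[OF 2(1)] by blast
        qed
        moreover have "\<alpha> e ` {0<..<1} \<inter> \<psi> ` Q = {}"
        proof (rule ccontr)
          assume "\<alpha> e ` {0<..<1} \<inter> \<psi> ` Q \<noteq> {}"
          then obtain x where "x \<in> \<alpha> e ` {0<..<1}" "x \<in> \<psi> ` Q" by blast
          then have "x \<in> \<beta> ` {t (\<rho> p)<..<t (\<rho> q)}" using \<alpha>int2[OF 2(1)] unfolding 2(2) by blast
          then obtain z a where za: "z \<in> Q" "t (\<rho> p) < a" "a < t (\<rho> q)" "\<beta> a = \<beta> (t (\<rho> z))"
            using \<open>x \<in> \<psi> ` Q\<close> \<psi>Q by auto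
          then have "a = t (\<rho> z)" using \<beta>eq[OF za(4)] sg tc1[OF \<rho>k[OF za(1)]] by linarith
          then show False using gap[OF 2(1) za(1)] za by blast
        qed
        ultimately show ?thesis by blast
      qed
    qed
    fix f assume f: "f \<in> fan_edges Q r v" and ef: "e \<noteq> f"
    have mixed: "c (\<rho> p) ` {0<..<1} \<inter> \<alpha> {p', q'} ` {0<..<1} = {}" if "p \<in> Q" "consecutive Q r p' q'" for p p' q'
    proof -
      have "\<beta> ` {t (\<rho> p')<..<t (\<rho> q')} \<inter> ?I = {}" using \<beta>notI seg[OF that(2)] by fastforce
      then show ?thesis using \<alpha>int2[OF that(2)] cint[OF \<rho>k[OF that(1)]] by blast
    qed
    have both: "\<alpha> {p, q} ` {0<..<1} \<inter> \<alpha> {p', q'} ` {0<..<1} = {}"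
      if 1: "consecutive Q r p q" and 2: "consecutive Q r p' q'" and ne: "{p, q} \<noteq> {p', q'}" for p q p' q'
    proof (rule ccontr)
      assume "\<not> ?thesis"
      then obtain x where "x \<in> \<beta> ` {t (\<rho> p)<..<t (\<rho> q)}" "x \<in> \<beta> ` {t (\<rho> p')<..<t (\<rho> q')}"
        using \<alpha>int2[OF 1] \<alpha>int2[OF 2] by blast
      then obtain a b where ab: "t (\<rho> p) < a" "a < t (\<rho> q)" "t (\<rho> p') < b" "b < t (\<rho> q')" "\<beta> a = \<beta> b" by auto
      then have "a = b" using \<beta>eq[OF ab(5)] seg[OF 1] seg[OF 2] by linarith
      \<comment> \<open>No path vertex lies strictly within a segment, so overlapping segments start
        at the same vertex.\<close>
      moreover have "t (\<rho> p) = t (\<rho> p')"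
        using gap[OF 1 \<alpha>2(3)[OF 2]] gap[OF 2 \<alpha>2(3)[OF 1]] ab \<open>a = b\<close> by linarith
      then have "\<rho> p = \<rho> p'" using tinj \<rho>k \<alpha>2(3)[OF 1] \<alpha>2(3)[OF 2] by blast
      then have "p = p'" "q = q'" using \<rho>inj \<alpha>2[OF 1] \<alpha>2[OF 2] by metis+
      then show False using ne by simp
    qed
    show "\<alpha> e ` {0<..<1} \<inter> \<alpha> f ` {0<..<1} = {}"
    proof -
      consider (pp) p p' where "p \<in> Q" "e = {v, p}" "p' \<in> Q" "f = {v, p'}"
        | (pc) p p' q' where "p \<in> Q" "e = {v, p}" "consecutive Q r p' q'" "f = {p', q'}"
        | (cp) p p' q' where "p \<in> Q" "f = {v, p}" "consecutive Q r p' q'" "e = {p', q'}"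
        | (cc) p q p' q' where "consecutive Q r p q" "e = {p, q}" "consecutive Q r p' q'" "f = {p', q'}"
        using e f unfolding fan_edges_def by blast
      then show ?thesis
      proof cases
        case pp
        then have "\<rho> p \<noteq> \<rho> p'" using ef \<rho>inj by blast
        then show ?thesis using c_disj \<rho>k pp \<alpha>1 by simp
      next
        case pc
        then show ?thesis using mixed \<alpha>1 by simp
      next
        case cp
        then show ?thesis using mixed \<alpha>1 by (simp add: Int_commute)
      next
        case cc
        then show ?thesis using both ef by simp
      qed
    qed
  qed
qed

text \<open>Each fan edge contains a vertex of \<open>Q\<close>, so it is never an old edge and the
  two drawings can be combined edge by edge. They have only the point of \<open>v\<close> in
  common.\<close>

lemma embeds_in_fan:
  fixes X :: "'a topology"
  assumes X: "surface X" and G: "simple_graph G" and E: "embeds_in G X" and v: "v \<in> verts G"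
    and Q: "finite Q" "inj_on r Q" "Q \<inter> verts G = {}"
  shows "embeds_in (verts G \<union> Q, edges G \<union> fan_edges Q r v) X"
proof -
  obtain \<phi> \<gamma> where E: "graph_embedding G X \<phi> \<gamma>" using E by (auto simp: embeds_in_def)
  let ?K = "drawing G \<phi> \<gamma>"
  obtain h :: "complex \<Rightarrow> 'a" and \<beta> \<delta> where h: "inj h" "continuous_map euclidean X h"
    "h (pathstart \<beta>) = \<phi> v" and th: "theta_pair \<beta> \<delta>"
    and av: "h ` \<beta> ` {0<..<1} \<inter> ?K = {}" "h ` inside (path_image \<beta> \<union> path_image \<delta>) \<inter> ?K = {}"
    using drawing_avoiding_region[OF X G E v] by blast
  have vQ: "v \<notin> Q" using v Q(3) by blast
  obtain \<psi> \<alpha> where \<psi>: "\<psi> v = pathstart \<beta>" "inj_on \<psi> (insert v Q)" "\<psi> ` Q \<subseteq> \<beta> ` {0<..<1}"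
    and \<alpha>: "\<And>e. e \<in> fan_edges Q r v \<Longrightarrow> arc (\<alpha> e) \<and> {\<alpha> e 0, \<alpha> e 1} = \<psi> ` e \<and>
      \<alpha> e ` {0<..<1} \<subseteq> (inside (path_image \<beta> \<union> path_image \<delta>) \<union> \<beta> ` {0<..<1}) - \<psi> ` Q"
    and \<alpha>d: "\<And>e f. e \<in> fan_edges Q r v \<Longrightarrow> f \<in> fan_edges Q r v \<Longrightarrow> e \<noteq> f \<Longrightarrow> \<alpha> e ` {0<..<1} \<inter> \<alpha> f ` {0<..<1} = {}"
    using fan_embedding_plane[OF th Q(1,2) vQ, of thesis] by blast
  have new: "\<not> e \<subseteq> verts G" "e \<subseteq> insert v Q" if "e \<in> fan_edges Q r v" for e
    using that Q(3) by (auto simp: fan_edges_def consecutive_def)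
  have old: "e \<subseteq> verts G" if "e \<in> edges G" for e using that G by (auto simp: simple_graph_def)
  define \<phi>' where "\<phi>' p = (if p \<in> Q then h (\<psi> p) else \<phi> p)" for p
  define \<gamma>' where "\<gamma>' e = (if e \<in> edges G then \<gamma> e else h \<circ> \<alpha> e)" for e
  have \<phi>'G: "\<phi>' p = \<phi> p" if "p \<in> verts G" for p using that Q(3) by (auto simp: \<phi>'_def)
  have \<phi>'Q: "\<phi>' p = h (\<psi> p)" if "p \<in> insert v Q" for p using that \<psi>(1) h(3) vQ by (auto simp: \<phi>'_def)
  have \<gamma>'G: "\<gamma>' e = \<gamma> e" if "e \<in> edges G" for e using that by (simp add: \<gamma>'_def)
  have \<gamma>'Q: "\<gamma>' e = h \<circ> \<alpha> e" if "e \<in> fan_edges Q r v" for e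
    using new(1)[OF that] old by (auto simp: \<gamma>'_def)
  have topX: "range h \<subseteq> topspace X" using h(2) continuous_map_image_subset_topspace by fastforce
  have VK: "\<phi> ` verts G \<subseteq> ?K" and EK: "\<And>e. e \<in> edges G \<Longrightarrow> \<gamma> e ` {0..1} \<subseteq> ?K" by (auto simp: drawing_def)
  have QK: "\<phi>' ` Q \<inter> ?K = {}"
  proof -
    have "\<phi>' ` Q = h ` \<psi> ` Q" using \<phi>'Q by (simp add: image_image)
    then show ?thesis using \<psi>(3) av(1) by blast
  qed
  have NK: "\<gamma>' e ` {0<..<1} \<inter> ?K = {}" "\<gamma>' e ` {0<..<1} \<inter> \<phi>' ` Q = {}" if "e \<in> fan_edges Q r v" for e
  proof -
    have im: "\<gamma>' e ` {0<..<1} = h ` (\<alpha> e ` {0<..<1})" by (simp add: \<gamma>'Q[OF that] image_comp)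
    show "\<gamma>' e ` {0<..<1} \<inter> ?K = {}" unfolding im using \<alpha>[OF that] av by blast
    have "\<phi>' ` Q = h ` \<psi> ` Q" using \<phi>'Q by (simp add: image_image)
    moreover have "\<alpha> e ` {0<..<1} \<inter> \<psi> ` Q = {}" using \<alpha>[OF that] by blast
    ultimately show "\<gamma>' e ` {0<..<1} \<inter> \<phi>' ` Q = {}" unfolding im using h(1) by (simp add: image_Int[symmetric])
  qed
  have \<phi>'V: "\<phi>' ` verts G = \<phi> ` verts G" using \<phi>'G by simp
  have sub01: "{0<..<1} \<subseteq> {0..1::real}" by auto
  have "graph_embedding (verts G \<union> Q, edges G \<union> fan_edges Q r v) X \<phi>' \<gamma>'"
    unfolding graph_embedding_def fst_conv snd_conv
  proof (intro conjI ballI impI)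
    show "\<phi>' ` (verts G \<union> Q) \<subseteq> topspace X"
    proof -
      have "\<phi> ` verts G \<subseteq> topspace X" using E by (simp add: graph_embedding_def)
      moreover have "\<phi>' ` Q \<subseteq> range h" using \<phi>'Q by auto
      ultimately show ?thesis unfolding image_Un \<phi>'V using topX by blast
    qed
    have "inj_on \<phi>' (verts G)" using E \<phi>'G by (auto simp: graph_embedding_def inj_on_def)
    moreover have "inj_on \<phi>' Q" using \<psi>(2) \<phi>'Q h(1) by (auto simp: inj_on_def)
    moreover have "\<phi>' ` verts G \<inter> \<phi>' ` Q = {}" using QK VK \<phi>'V by blast
    ultimately show "inj_on \<phi>' (verts G \<union> Q)" by (auto simp: inj_on_Un)
  next
    fix e assume e: "e \<in> edges G \<union> fan_edges Q r v"
    show "pathin X (\<gamma>' e)"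
    proof (cases "e \<in> edges G")
      case False
      then have "path (\<alpha> e)" using e \<alpha> arc_imp_path by blast
      then have "continuous_map (top_of_set {0..1}) X (h \<circ> \<alpha> e)"
        by (intro continuous_map_compose[OF _ h(2)]) (simp add: path_def)
      then show ?thesis using False e \<gamma>'Q by (simp add: pathin_def)
    qed (use E \<gamma>'G in \<open>auto simp: graph_embedding_def\<close>)
    show "inj_on (\<gamma>' e) {0..1}"
    proof (cases "e \<in> edges G")
      case False
      then show ?thesis using e \<alpha>[of e] \<gamma>'Q[of e] h(1) by (auto simp: arc_def intro!: comp_inj_on intro: inj_on_subset)
    next
      case True
      then show ?thesis using E \<gamma>'G by (simp add: graph_embedding_def)
    qed
    show "{\<gamma>' e 0, \<gamma>' e 1} = \<phi>' ` e"
    proof (cases "e \<in> edges G")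
      case False
      then have e': "e \<in> fan_edges Q r v" using e by blast
      have "\<phi>' ` e = h ` \<psi> ` e" unfolding image_image by (rule image_cong) (use new(2)[OF e'] \<phi>'Q in auto)
      also have "\<psi> ` e = {\<alpha> e 0, \<alpha> e 1}" using \<alpha>[OF e'] by simp
      finally show ?thesis using \<gamma>'Q[OF e'] by simp
    next
      case True
      have "\<phi>' ` e = \<phi> ` e" by (rule image_cong) (use old[OF True] \<phi>'G in auto)
      then show ?thesis using True E \<gamma>'G by (simp add: graph_embedding_def)
    qed
    show "\<gamma>' e ` {0<..<1} \<inter> \<phi>' ` (verts G \<union> Q) = {}"
    proof (cases "e \<in> edges G")
      case False
      then have e': "e \<in> fan_edges Q r v" using e by blast
      show ?thesis unfolding image_Un \<phi>'V using NK[OF e'] VK by blast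
    next
      case True
      have "\<gamma> e ` {0<..<1} \<inter> \<phi> ` verts G = {}" using E True by (simp add: graph_embedding_def)
      moreover have "\<gamma> e ` {0<..<1} \<subseteq> ?K" by (rule order_trans[OF image_mono[OF sub01] EK[OF True]])
      ultimately show ?thesis unfolding image_Un \<phi>'V \<gamma>'G[OF True] using QK by blast
    qed
    fix f assume f: "f \<in> edges G \<union> fan_edges Q r v" and ef: "e \<noteq> f"
    have K: "\<gamma>' a ` {0<..<1} \<subseteq> ?K" if "a \<in> edges G" for a
      unfolding \<gamma>'G[OF that] by (rule order_trans[OF image_mono[OF sub01] EK[OF that]])
    show "\<gamma>' e ` {0<..<1} \<inter> \<gamma>' f ` {0<..<1} = {}"
    proof -
      consider "e \<in> edges G" "f \<in> edges G" | "e \<in> edges G" "f \<in> fan_edges Q r v"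
        | "e \<in> fan_edges Q r v" "f \<in> edges G" | "e \<in> fan_edges Q r v" "f \<in> fan_edges Q r v" using e f by blast
      then show ?thesis
      proof cases
        case 1
        then show ?thesis using E ef \<gamma>'G by (simp add: graph_embedding_def)
      next
        case 2
        then show ?thesis using K[OF 2(1)] NK(1)[OF 2(2)] by blast
      next
        case 3
        then show ?thesis using K[OF 3(2)] NK(1)[OF 3(1)] by blast
      next
        case 4
        have "\<gamma>' e ` {0<..<1} \<inter> \<gamma>' f ` {0<..<1} = h ` (\<alpha> e ` {0<..<1}) \<inter> h ` (\<alpha> f ` {0<..<1})"
          by (simp add: \<gamma>'Q 4 image_comp)
        also have "\<dots> = h ` (\<alpha> e ` {0<..<1} \<inter> \<alpha> f ` {0<..<1})" using h(1) by (rule image_Int[symmetric])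
        finally show ?thesis using \<alpha>d[OF 4 ef] by simp
      qed
    qed
  qed
  then show ?thesis unfolding embeds_in_def by blast
qed

section \<open>Growth of a proper minor-closed class\<close>

definition clique :: "'a graph \<Rightarrow> 'a set \<Rightarrow> bool" where
  "clique G C \<longleftrightarrow> C \<subseteq> verts G \<and> (\<forall>x\<in>C. \<forall>y\<in>C. x \<noteq> y \<longrightarrow> {x, y} \<in> edges G)"

text \<open>Sparsity provides a vertex of degree at most \<open>2 * d\<close>. The cliques through
  it correspond to subsets of its neighbours, at most \<open>4 ^ d\<close> of them, and the vertex
  is deleted. The summand 1 is the empty clique.\<close>

lemma card_cliques:
  assumes D: "minor_closed D" and sparse: "\<And>H. H \<in> D \<Longrightarrow> card (edges H) \<le> d * card (verts H)"
    and G: "G \<in> D"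
  shows "card {C. clique G C} \<le> 1 + 4 ^ d * card (verts G)"
  using G
proof (induction "card (verts G)" arbitrary: G rule: less_induct)
  case less
  note G = less.prems
  have sG: "simple_graph G" using minor_closedD(1)[OF D G] .
  have fin: "finite (verts G)" "verts G \<noteq> {}" using sG by (auto simp: simple_graph_def)
  have finC: "finite {C. clique H C}" if "finite (verts H)" for H :: "'a graph"
    by (rule finite_subset[of _ "Pow (verts H)"]) (use that in \<open>auto simp: clique_def\<close>)
  have "\<exists>v\<in>verts G. degree G v \<le> 2 * d"
  proof (rule ccontr)
    assume "\<not> ?thesis"
    then have "2 * d < degree G v" if "v \<in> verts G" for v using that by (meson not_le)
    then have "(\<Sum>v\<in>verts G. 2 * d) < (\<Sum>v\<in>verts G. degree G v)" by (rule sum_strict_mono[OF fin])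
    then show False using sum_degree[OF sG] sparse[OF G] by (simp add: mult.commute)
  qed
  then obtain v where v: "v \<in> verts G" "degree G v \<le> 2 * d" by blast
  let ?N = "nbrs G v"
  have with_v: "{C. clique G C \<and> v \<in> C} \<subseteq> insert v ` Pow ?N"
  proof
    fix C assume "C \<in> {C. clique G C \<and> v \<in> C}"
    then have "C - {v} \<subseteq> ?N" "C = insert v (C - {v})" by (auto simp: clique_def nbrs_def)
    then show "C \<in> insert v ` Pow ?N" by blast
  qed
  have finN: "finite ?N" using finite_nbrs[OF sG] .
  have "card {C. clique G C \<and> v \<in> C} \<le> card (insert v ` Pow ?N)"
    using with_v finN by (intro card_mono) auto
  also have "\<dots> \<le> card (Pow ?N)" using finN by (intro card_image_le) auto
  also have "\<dots> = 2 ^ card ?N" using finN by (simp add: card_Pow)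
  also have "\<dots> \<le> 2 ^ (2 * d)" using v(2) degree_eq_card_nbrs[OF sG] by (intro power_increasing) auto
  also have "\<dots> = 4 ^ d" by (simp add: power_mult)
  finally have c1: "card {C. clique G C \<and> v \<in> C} \<le> 4 ^ d" .
  have c2: "card {C. clique G C \<and> v \<notin> C} \<le> 1 + 4 ^ d * (card (verts G) - 1)"
  proof (cases "verts G = {v}")
    case True
    then have "{C. clique G C \<and> v \<notin> C} \<subseteq> {{}}" by (auto simp: clique_def)
    then have "card {C. clique G C \<and> v \<notin> C} \<le> card {{} :: 'a set}" by (intro card_mono) auto
    then show ?thesis by simp
  next
    case False
    let ?H = "delete_vertex v G"
    have H: "?H \<in> D" using minor_closedD(2)[OF D G v(1) False] .
    have "{C. clique G C \<and> v \<notin> C} \<subseteq> {C. clique ?H C}" by (auto simp: clique_def delete_vertex_def)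
    then have "card {C. clique G C \<and> v \<notin> C} \<le> card {C. clique ?H C}"
      using fin by (intro card_mono finC) (auto simp: delete_vertex_def)
    also have "\<dots> \<le> 1 + 4 ^ d * card (verts ?H)"
    proof (rule less.hyps[OF _ H])
      show "card (verts ?H) < card (verts G)"
        unfolding delete_vertex_def fst_conv by (rule card_Diff1_less[OF fin(1) v(1)])
    qed
    finally show ?thesis using fin v(1) by (simp add: delete_vertex_def)
  qed
  have "{C. clique G C} = {C. clique G C \<and> v \<in> C} \<union> {C. clique G C \<and> v \<notin> C}" by auto
  then have "card {C. clique G C} \<le> card {C. clique G C \<and> v \<in> C} + card {C. clique G C \<and> v \<notin> C}"
    by (metis card_Un_le)
  also have "\<dots> \<le> 1 + (4 ^ d * (card (verts G) - 1) + 4 ^ d)" using c1 c2 by linarith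
  also have "4 ^ d * (card (verts G) - 1) + 4 ^ d = 4 ^ d * card (verts G)"
    using fin v(1) by (metis Suc_pred' add.commute card_gt_0_iff mult_Suc_right)
  finally show ?case .
qed

text \<open>The first kind of reducible pair: one twin can be deleted, since its neighbourhood is
  still visible at the other.\<close>

definition twins :: "'a graph \<Rightarrow> ('a \<times> 'a) set" where
  "twins G = {(u, v) \<in> verts G \<times> verts G. u \<noteq> v \<and> nbrs G u = nbrs G v}"

text \<open>The second kind of reducible pair: the edge can be contracted, and the bounded degrees
  leave boundedly many ways to undo this.\<close>

definition low_edges :: "nat \<Rightarrow> 'a graph \<Rightarrow> ('a \<times> 'a) set" where
  "low_edges L G = {(u, v) \<in> verts G \<times> verts G. {u, v} \<in> edges G \<and> degree G u < L \<and> degree G v < L}"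

lemma card_le_image_plus_twins:
  assumes "finite T"
  shows "card T \<le> card (f ` T) + card {s \<in> T. \<exists>s'\<in>T. s' \<noteq> s \<and> f s' = f s}"
proof -
  let ?U = "{s \<in> T. \<exists>s'\<in>T. s' \<noteq> s \<and> f s' = f s}"
  have "card (T - ?U) \<le> card (f ` T)"
    using assms by (intro card_inj_on_le[of f]) (auto simp: inj_on_def)
  moreover have "card T = card (T - ?U) + card ?U"
    using assms by (subst card_Un_disjoint[symmetric]) (auto intro: arg_cong[where f = card])
  ultimately show ?thesis by linarith
qed

text \<open>Contracting a vertex of the independent set \<open>S\<close> into one of two non-adjacent neighbours adds an
  edge to the sparse graph on \<open>B\<close>, so this can happen at most \<open>d \<cdot> card B\<close> times; afterwards every
  remaining neighbourhood is a clique, and there are few cliques.\<close>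

lemma many_twins:
  assumes D: "minor_closed D" and sparse: "\<And>H. H \<in> D \<Longrightarrow> card (edges H) \<le> d * card (verts H)"
    and G: "G \<in> D" and S: "S \<subseteq> verts G" "\<And>s. s \<in> S \<Longrightarrow> nbrs G s \<inter> S = {}"
  shows "card (verts G) \<le> card (twins G) + 1 + (1 + d + 4 ^ d) * card (verts G - S)"
proof -
  let ?V = "verts G" and ?B = "verts G - S"
  have sG: "simple_graph G" using minor_closedD(1)[OF D G] .
  have fin: "finite ?V" "?V \<noteq> {}" using sG by (auto simp: simple_graph_def)
  have finS: "finite S" using fin S(1) finite_subset by blast
  \<comment> \<open>\<open>R\<close> is the part of \<open>S\<close> contracted so far and
    \<open>H\<close> the resulting graph. The remaining vertices of \<open>S\<close> keep their
    neighbourhoods, and each contraction has been paid for by an edge inside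
    \<open>?B\<close>.\<close>
  define P where "P R H \<longleftrightarrow> R \<subseteq> S \<and> H \<in> D \<and> verts H = ?V - R \<and> (\<forall>s\<in>S - R. nbrs H s = nbrs G s) \<and>
    card R \<le> card {e \<in> edges H. e \<subseteq> ?B}" for R H
  have P0: "P {} G" using G by (simp add: P_def)
  have bd: "card R \<le> card S" if "P R H" for R H using that finS by (auto simp: P_def intro: card_mono)
  obtain m where m: "\<exists>R H. P R H \<and> card R = m" and mmax: "\<And>R H. P R H \<Longrightarrow> card R \<le> m"
  proof -
    have 1: "\<exists>R H. P R H \<and> card R = 0" using P0 by (metis card.empty)
    have 2: "\<forall>k. (\<exists>R H. P R H \<and> card R = k) \<longrightarrow> k \<le> card S" using bd by blast
    show thesis using Nat.ex_has_greatest_nat[of "\<lambda>k. \<exists>R H. P R H \<and> card R = k", OF 1 2] that by blast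
  qed
  obtain R H where RH: "P R H" "card R = m" using m by blast
  have R: "R \<subseteq> S" "H \<in> D" "verts H = ?V - R" "\<And>s. s \<in> S - R \<Longrightarrow> nbrs H s = nbrs G s"
    "card R \<le> card {e \<in> edges H. e \<subseteq> ?B}" using RH(1) by (auto simp: P_def)
  have sH: "simple_graph H" using minor_closedD(1)[OF D R(2)] .
  have nB: "nbrs G s \<subseteq> ?B" if "s \<in> S" for s using nbrs_subset[OF sG, of s] S(2)[OF that] by blast
  \<comment> \<open>Two non-adjacent neighbours would permit one more contraction, against the
    choice of \<open>R\<close> with maximal size.\<close>
  have adj: "{x, y} \<in> edges H" if s: "s \<in> S - R" and xy: "x \<in> nbrs G s" "y \<in> nbrs G s" "x \<noteq> y" for s x y
  proof (rule ccontr)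
    assume nxy: "{x, y} \<notin> edges H"
    let ?H = "contract_edge x s H" and ?f = "\<lambda>z. if z = s then x else z"
    have xs: "{x, s} \<in> edges H" "{y, s} \<in> edges H"
      using xy R(4)[OF s] by (auto simp: nbrs_def insert_commute)
    have B: "x \<in> ?B" "y \<in> ?B" using nB xy s by auto
    have ne: "x \<noteq> s" "y \<noteq> s" using B s by auto
    have HD: "?H \<in> D" using minor_closedD(4)[OF D R(2) xs(1) ne(1)] .
    have fe: "?f ` e = e" if "s \<notin> e" for e using that by auto
    have keep: "e \<in> edges ?H" if "e \<in> edges H" "s \<notin> e" for e
    proof -
      have "card e = 2" using sH that(1) by (auto simp: simple_graph_def)
      then show ?thesis using contract_edgeI[OF that(1), of s x] unfolding fe[OF that(2)] by simp
    qed
    have "?f ` {y, s} = {y, x}" using ne by auto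
    then have new: "{x, y} \<in> edges ?H"
      using contract_edgeI[OF xs(2), of s x] xy(3) by (simp add: insert_commute)
    \<comment> \<open>\<open>S\<close> is independent, so the contraction of \<open>s\<close> does
      not touch the neighbourhoods of its other members.\<close>
    have nbr: "nbrs ?H s' = nbrs G s'" if s': "s' \<in> S - insert s R" for s'
    proof -
      have s's: "s' \<noteq> s" "s' \<in> S - R" using s' by auto
      have nn: "nbrs H s' = nbrs G s'" using R(4)[OF s's(2)] .
      have "s \<notin> nbrs H s'" using nn S(2)[of s'] s s's by blast
      then have sns: "{s', s} \<notin> edges H" by (simp add: nbrs_def)
      have x's: "x \<noteq> s'" using B s' by blast
      have "{s', z} \<in> edges ?H \<longleftrightarrow> {s', z} \<in> edges H" for z
      proof
        assume a: "{s', z} \<in> edges ?H"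
        then obtain e where e: "e \<in> edges H" "?f ` e = {s', z}" by (metis contract_edgeE)
        have "s' \<in> ?f ` e" using e(2) by auto
        then have "s' \<in> e" using x's s's by (auto split: if_splits)
        then obtain y where y: "e = {s', y}" using edge_atE[OF sH e(1)] by blast
        then have "s \<notin> e" using sns s's(1) e(1) by auto
        then show "{s', z} \<in> edges H" using e fe by metis
      next
        assume a: "{s', z} \<in> edges H"
        then have "s \<notin> {s', z}" using sns s's by auto
        then show "{s', z} \<in> edges ?H" using keep a by blast
      qed
      then show ?thesis using nn by (simp add: nbrs_def)
    qed
    have "P (insert s R) ?H"
      unfolding P_def
    proof (intro conjI ballI)
      show "insert s R \<subseteq> S" using s R(1) by blast
      show "?H \<in> D" by (rule HD)
      show "verts ?H = ?V - insert s R" using R(3) by (auto simp: contract_edge_def)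
      show "nbrs ?H s' = nbrs G s'" if "s' \<in> S - insert s R" for s' using nbr[OF that] .
      have fin': "finite {e \<in> edges ?H. e \<subseteq> ?B}" using finite_edges[OF minor_closedD(1)[OF D HD]] by simp
      have "insert {x, y} {e \<in> edges H. e \<subseteq> ?B} \<subseteq> {e \<in> edges ?H. e \<subseteq> ?B}"
        using new keep B s by auto
      then have "card (insert {x, y} {e \<in> edges H. e \<subseteq> ?B}) \<le> card {e \<in> edges ?H. e \<subseteq> ?B}"
        by (rule card_mono[OF fin'])
      moreover have "card (insert {x, y} {e \<in> edges H. e \<subseteq> ?B}) = Suc (card {e \<in> edges H. e \<subseteq> ?B})"
        using nxy finite_edges[OF sH] by (subst card_insert_disjoint) auto
      moreover have "card (insert s R) = Suc (card R)" using s finite_subset[OF R(1) finS] by simp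
      ultimately show "card (insert s R) \<le> card {e \<in> edges ?H. e \<subseteq> ?B}" using R(5) by linarith
    qed
    then have "card (insert s R) \<le> m" by (rule mmax)
    then show False using RH(2) s finite_subset[OF R(1) finS] by simp
  qed
  let ?HB = "(?B, {e \<in> edges H. e \<subseteq> ?B})" and ?T = "S - R"
  have finT: "finite ?T" using finS by simp
  have HB: "?HB \<in> D" if "?B \<noteq> {}"
    by (rule minor_closed_subgraph[OF D R(2)]) (use R(1,3) that in auto)
  have cR: "card R \<le> d * card ?B"
  proof (cases "?B = {}")
    case True
    have "{e \<in> edges H. e \<subseteq> ?B} = {}" unfolding True using sH by (auto simp: simple_graph_def)
    then show ?thesis using R(5) by (metis card.empty le_zero_eq zero_le)
  next
    case False
    then show ?thesis using sparse[OF HB[OF False]] R(5) by simp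
  qed
  have img: "nbrs G ` ?T \<subseteq> {C. clique ?HB C}"
  proof (clarsimp simp: clique_def, intro conjI ballI impI)
    fix s assume s: "s \<in> S" "s \<notin> R"
    show "nbrs G s \<subseteq> ?B" by (rule nB[OF s(1)])
    fix x y assume xy: "x \<in> nbrs G s" "y \<in> nbrs G s" "x \<noteq> y"
    show "{x, y} \<in> edges H" using adj[OF _ xy] s by blast
    show "x \<in> ?V" "x \<notin> S" "y \<in> ?V" "y \<notin> S" using nB[OF s(1)] xy by auto
  qed
  have cimg: "card (nbrs G ` ?T) \<le> 1 + 4 ^ d * card ?B"
  proof (cases "?B = {}")
    case True
    then have "nbrs G ` ?T \<subseteq> {{}}" using nB by auto
    then have "card (nbrs G ` ?T) \<le> card {{} :: 'a set}" by (intro card_mono) auto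
    then show ?thesis by simp
  next
    case False
    have "finite {C. clique ?HB C}"
      by (rule finite_subset[of _ "Pow ?B"]) (use fin in \<open>auto simp: clique_def\<close>)
    then have "card (nbrs G ` ?T) \<le> card {C. clique ?HB C}" using img by (rule card_mono)
    then show ?thesis using card_cliques[OF D sparse HB[OF False]] by simp
  qed
  have finTw: "finite (twins G)" using fin by (auto simp: twins_def intro: finite_subset[of _ "?V \<times> ?V"])
  \<comment> \<open>Members of \<open>S\<close> that share their neighbourhood are twins; the others
    are counted by the cliques that are their neighbourhoods.\<close>
  have "{s \<in> ?T. \<exists>s'\<in>?T. s' \<noteq> s \<and> nbrs G s' = nbrs G s} \<subseteq> snd ` twins G"
    using S(1) by (force simp: twins_def)
  then have "card {s \<in> ?T. \<exists>s'\<in>?T. s' \<noteq> s \<and> nbrs G s' = nbrs G s} \<le> card (twins G)"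
    using finTw by (meson card_image_le card_mono finite_imageI order_trans)
  then have cT: "card ?T \<le> card (twins G) + 1 + 4 ^ d * card ?B"
    using card_le_image_plus_twins[OF finT, of "nbrs G"] cimg by linarith
  have "card ?V = card ?B + card S" using fin S(1) card_Diff_subset[OF finS S(1)] card_mono[OF fin(1) S(1)] by linarith
  moreover have "card S = card R + card ?T" using finS R(1) card_Diff_subset[of R S] card_mono[OF finS R(1)] finite_subset[OF R(1)] by simp
  ultimately show ?thesis using cT cR by (simp add: algebra_simps)
qed

text \<open>The degree sum is at most \<open>2 * d\<close> times the order, so at most a fraction
  \<open>1 / (2 * M)\<close> of the vertices have degree at least \<open>4 * d * M\<close>. The low
  vertices with high neighbours only form an independent set \<open>S\<close>; every other vertex is
  high or an end of a low edge. \<open>many_twins\<close> for this \<open>S\<close> leaves half of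
  the order to the reducible pairs.\<close>

lemma many_reducible_pairs:
  assumes D: "minor_closed D" and sparse: "\<And>H. H \<in> D \<Longrightarrow> card (edges H) \<le> d * card (verts H)" and d: "d \<ge> 1"
  defines "M \<equiv> 1 + d + 4 ^ d"
  assumes G: "G \<in> D" and n: "card (verts G) \<ge> 4"
  shows "card (verts G) \<le> 4 * M * (card (twins G) + card (low_edges (4 * d * M) G))"
proof -
  let ?L = "4 * d * M" and ?V = "verts G"
  have sG: "simple_graph G" using minor_closedD(1)[OF D G] .
  have fin: "finite ?V" using sG by (auto simp: simple_graph_def)
  have M: "M \<ge> 1" by (simp add: M_def)
  define Hi where "Hi = {v \<in> ?V. ?L \<le> degree G v}"
  define S where "S = {v \<in> ?V. degree G v < ?L \<and> (\<forall>u\<in>nbrs G v. ?L \<le> degree G u)}"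
  have S: "S \<subseteq> ?V" "nbrs G s \<inter> S = {}" if "s \<in> S" for s using that by (auto simp: S_def)
  have S1: "S \<subseteq> ?V" by (auto simp: S_def)
  have finLE: "finite (low_edges ?L G)" using fin by (auto simp: low_edges_def intro: finite_subset[of _ "?V \<times> ?V"])
  have "?V - S \<subseteq> Hi \<union> fst ` low_edges ?L G"
  proof
    fix v assume v: "v \<in> ?V - S"
    show "v \<in> Hi \<union> fst ` low_edges ?L G"
    proof (cases "?L \<le> degree G v")
      case False
      then obtain u where u: "u \<in> nbrs G v" "degree G u < ?L" using v by (auto simp: S_def not_le)
      then have "(v, u) \<in> low_edges ?L G" using False v nbrs_subset[OF sG, of v] by (auto simp: low_edges_def nbrs_def)
      then show ?thesis by force
    qed (use v in \<open>simp add: Hi_def\<close>)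
  qed
  then have "card (?V - S) \<le> card (Hi \<union> fst ` low_edges ?L G)"
    using fin finLE by (intro card_mono) (auto simp: Hi_def)
  also have "\<dots> \<le> card Hi + card (low_edges ?L G)"
    using card_Un_le[of Hi "fst ` low_edges ?L G"] card_image_le[OF finLE, of fst] by linarith
  finally have cB: "card (?V - S) \<le> card Hi + card (low_edges ?L G)" .
  have "card Hi * ?L \<le> (\<Sum>v\<in>Hi. degree G v)" using sum_bounded_below[of Hi ?L "degree G"] by (simp add: Hi_def)
  also have "\<dots> \<le> (\<Sum>v\<in>?V. degree G v)" using fin by (intro sum_mono2) (auto simp: Hi_def)
  also have "\<dots> \<le> 2 * (d * card ?V)" using sum_degree[OF sG] sparse[OF G] by simp
  finally have "2 * d * (2 * (M * card Hi)) \<le> 2 * d * card ?V" by (simp add: algebra_simps)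
  then have cH: "2 * (M * card Hi) \<le> card ?V" using d by simp
  have "card ?V \<le> card (twins G) + 1 + M * card (?V - S)"
    unfolding M_def by (rule many_twins[OF D sparse G S1]) (use S in auto)
  also have "\<dots> \<le> card (twins G) + 1 + (M * card Hi + M * card (low_edges ?L G))"
    using mult_le_mono2[OF cB, of M] by (simp add: algebra_simps)
  finally have *: "2 * card ?V \<le> 2 * card (twins G) + 2 + card ?V + 2 * (M * card (low_edges ?L G))" using cH by linarith
  define X where "X = M * card (low_edges ?L G)"
  \<comment> \<open>The constant 2 is at most half of the order, which is at least 4.\<close>
  have "card ?V \<le> 4 * (card (twins G) + X)" using * n unfolding X_def[symmetric] by presburger
  also have "\<dots> \<le> 4 * (M * card (twins G) + M * card (low_edges ?L G))" using M by (simp add: X_def)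
  finally show ?thesis by (simp add: algebra_simps)
qed

text \<open>\<open>labelled\<close> for arbitrary vertex sets: removing a vertex leads away from the
  sets \<open>{1..n}\<close>, and by \<open>card_on_verts_eq\<close> only the size of the set
  matters.\<close>

definition on_verts :: "nat graph set \<Rightarrow> nat set \<Rightarrow> nat graph set" where
  "on_verts D S = {G \<in> D. verts G = S}"

lemma finite_on_verts:
  assumes "\<And>G. G \<in> D \<Longrightarrow> simple_graph G" "finite S"
  shows "finite (on_verts D S)"
proof (rule finite_subset)
  show "on_verts D S \<subseteq> {S} \<times> Pow (Pow S)"
    using assms(1) by (force simp: on_verts_def simple_graph_def)
qed (use assms in auto)

lemma card_on_verts_le:
  assumes D: "iso_closed D" "\<And>G. G \<in> D \<Longrightarrow> simple_graph G" and S: "finite S" "finite T" "card S = card T"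
  shows "card (on_verts D S) \<le> card (on_verts D T)"
proof -
  obtain f where f: "bij_betw f S T" using finite_same_card_bij[OF S(1,2,3)] by blast
  have inj: "inj_on f S" and im: "f ` S = T" using f by (auto simp: bij_betw_def)
  have "relabel (the_inv_into S f) (relabel f G) = G" if "G \<in> on_verts D S" for G
  proof -
    have v: "verts G = S" "G \<in> D" using that by (simp_all add: on_verts_def)
    show ?thesis using relabel_inverse[OF D(2)[OF v(2)], of f] inj unfolding v(1) by simp
  qed
  then have "inj_on (relabel f) (on_verts D S)" by (rule inj_on_inverseI)
  moreover have "relabel f ` on_verts D S \<subseteq> on_verts D T"
    using D(1) inj im by (auto simp: on_verts_def iso_closed_def) (auto simp: relabel_def)
  ultimately show ?thesis using finite_on_verts[OF D(2) S(2)] by (rule card_inj_on_le)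
qed

lemma card_on_verts_eq:
  assumes "iso_closed D" "\<And>G. G \<in> D \<Longrightarrow> simple_graph G" "finite S" "finite T" "card S = card T"
  shows "card (on_verts D S) = card (on_verts D T)"
  using card_on_verts_le[OF assms] card_on_verts_le[OF assms(1,2,4,3) assms(5)[symmetric]] by linarith

lemma graph_eq_from_deleted_vertex:
  assumes "simple_graph G" "simple_graph H" "verts G = verts H" "nbrs G v = nbrs H v"
    and "{e \<in> edges G. v \<notin> e} = {e \<in> edges H. v \<notin> e}"
  shows "G = H"
proof -
  have sub: "e \<in> edges H" if F: "simple_graph G" "nbrs G v = nbrs H v" "{e \<in> edges G. v \<notin> e} = {e \<in> edges H. v \<notin> e}" "e \<in> edges G"
    for G H :: "'a graph" and e
  proof (cases "v \<in> e")
    case True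
    then obtain y where y: "e = {v, y}" using edge_atE[OF F(1,4) True] by metis
    then have "y \<in> nbrs H v" using F(2,4) by (auto simp: nbrs_def)
    then show ?thesis using y by (simp add: nbrs_def)
  next
    case False
    then show ?thesis using that(3,4) by blast
  qed
  have "edges G = edges H"
    using sub[OF assms(1,4,5)] sub[OF assms(2) assms(4)[symmetric] assms(5)[symmetric]] by blast
  then show ?thesis using assms(3) by (simp add: prod_eq_iff)
qed

text \<open>Deleting \<open>v\<close> loses no information: twins are not adjacent, so the
  neighbours of \<open>u\<close> survive, and they are also those of \<open>v\<close>.\<close>

lemma card_twins_le:
  assumes D: "minor_closed D" and S: "finite S" "u \<in> S" "u \<noteq> v"
  shows "card {G \<in> on_verts D S. (u, v) \<in> twins G} \<le> card (on_verts D (S - {v}))"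
proof (rule card_inj_on_le[of "delete_vertex v"])
  show "inj_on (delete_vertex v) {G \<in> on_verts D S. (u, v) \<in> twins G}"
  proof (rule inj_onI)
    fix G H assume G: "G \<in> {G \<in> on_verts D S. (u, v) \<in> twins G}" and H: "H \<in> {G \<in> on_verts D S. (u, v) \<in> twins G}"
      and eq: "delete_vertex v G = delete_vertex v H"
    have sG: "simple_graph G" "simple_graph H" using G H minor_closedD(1)[OF D] by (auto simp: on_verts_def)
    have e: "{e \<in> edges G. v \<notin> e} = {e \<in> edges H. v \<notin> e}" using eq by (simp add: delete_vertex_def)
    have nv: "nbrs F v = {x. {u, x} \<in> {e \<in> edges F. v \<notin> e}}" if "F \<in> {G \<in> on_verts D S. (u, v) \<in> twins G}" for F
    proof -
      have t: "nbrs F u = nbrs F v" "simple_graph F" using that minor_closedD(1)[OF D] by (auto simp: twins_def on_verts_def)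
      have "v \<notin> nbrs F u" using t nbrs_subset[OF t(2), of v] by blast
      then have "nbrs F u = {x. {u, x} \<in> {e \<in> edges F. v \<notin> e}}" using S(3) by (auto simp: nbrs_def)
      then show ?thesis using t(1) by simp
    qed
    have "nbrs G v = nbrs H v" unfolding nv[OF G] nv[OF H] e ..
    then show "G = H" using graph_eq_from_deleted_vertex[OF sG _ _ e] G H by (simp add: on_verts_def)
  qed
  show "delete_vertex v ` {G \<in> on_verts D S. (u, v) \<in> twins G} \<subseteq> on_verts D (S - {v})"
  proof clarsimp
    fix a b assume "(a, b) \<in> on_verts D S" "(u, v) \<in> twins (a, b)"
    then show "delete_vertex v (a, b) \<in> on_verts D (S - {v})"
      using minor_closedD(2)[OF D, of "(a, b)" v] S(3) by (auto simp: on_verts_def twins_def delete_vertex_def)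
  qed
qed (use finite_on_verts minor_closedD(1)[OF D] S in auto)

text \<open>A graph is determined by its contraction and the two old neighbourhoods. Both are
  subsets of the new neighbourhood of \<open>u\<close> with \<open>u\<close> and \<open>v\<close>
  added, a set of at most \<open>L + L + 2\<close> elements. Two such subsets account for a power of
  4, rounded up to one of 16.\<close>

lemma card_low_edges_le:
  assumes D: "minor_closed D" and S: "finite S"
  shows "card {G \<in> on_verts D S. (u, v) \<in> low_edges L G} \<le> card (on_verts D (S - {v})) * 16 ^ (L + L + 2)"
proof -
  let ?A = "{G \<in> on_verts D S. (u, v) \<in> low_edges L G}"
  let ?f = "\<lambda>y. if y = v then u else y"
  define W where "W H = insert u (insert v (nbrs H u))" for H :: "nat graph"
  define T where "T = {H \<in> on_verts D (S - {v}). card (nbrs H u) \<le> L + L}"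
  have finD: "finite (on_verts D (S - {v}))" using finite_on_verts minor_closedD(1)[OF D] S by auto
  have simp: "simple_graph G" if "G \<in> on_verts D R" for G R using that minor_closedD(1)[OF D] by (auto simp: on_verts_def)
  have A: "G \<in> D" "verts G = S" "{u, v} \<in> edges G" "u \<noteq> v" "simple_graph G" "card (nbrs G u) < L" "card (nbrs G v) < L" if "G \<in> ?A" for G
  proof -
    have G: "G \<in> on_verts D S" "(u, v) \<in> low_edges L G" using that by auto
    show s: "simple_graph G" using simp[OF G(1)] .
    show "G \<in> D" "verts G = S" "{u, v} \<in> edges G" using G by (auto simp: on_verts_def low_edges_def)
    then show "u \<noteq> v" using edge_ends[OF s] by blast
    show "card (nbrs G u) < L" "card (nbrs G v) < L" using G(2) degree_eq_card_nbrs[OF s] by (auto simp: low_edges_def)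
  qed
  have nb: "nbrs (contract_edge u v G) u = nbrs G u \<union> nbrs G v - {u, v}" if "G \<in> ?A" for G
  proof (intro equalityI subsetI)
    note a = A[OF that]
    fix x assume "x \<in> nbrs (contract_edge u v G) u"
    then have "{u, x} \<in> edges (contract_edge u v G)" by (simp add: nbrs_def)
    then obtain e where e: "e \<in> edges G" "{u, x} = ?f ` e" "card {u, x} = 2" by (metis contract_edgeE)
    have xu: "x \<noteq> u" using e(3) by auto
    have "u \<in> ?f ` e" "x \<in> ?f ` e" unfolding e(2)[symmetric] by simp_all
    then obtain z where z: "z \<in> e" "x = ?f z" by blast
    have xe: "x = z" "x \<noteq> v" using z(2) xu a(4) by (cases "z = v"; simp)+
    then obtain y where y: "e = {x, y}" "x \<noteq> y" using edge_atE[OF a(5) e(1)] z(1) by metis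
    obtain z' where z': "z' \<in> e" "u = ?f z'" using \<open>u \<in> ?f ` e\<close> by blast
    have "z' \<noteq> x" using z'(2) xu xe(2) by auto
    then have "z' = y" using z'(1) y(1) by blast
    note xv = xe(2)
    have "?f y = u" using z'(2) unfolding \<open>z' = y\<close> by (rule sym)
    then have "y = u \<or> y = v" by (cases "y = v") simp_all
    then have "x \<in> nbrs G u \<or> x \<in> nbrs G v" using y e(1) by (auto simp: nbrs_def insert_commute)
    then show "x \<in> nbrs G u \<union> nbrs G v - {u, v}" using xu xv by blast
  next
    note a = A[OF that]
    fix x assume x: "x \<in> nbrs G u \<union> nbrs G v - {u, v}"
    then have "?f ` {u, x} = {u, x}" "?f ` {v, x} = {u, x}" by auto
    note f = this
    have c: "card {u, x} = 2" using x by auto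
    have "{u, x} \<in> edges G \<or> {v, x} \<in> edges G" using x by (auto simp: nbrs_def)
    then have "{u, x} \<in> edges (contract_edge u v G)"
    proof
      assume "{u, x} \<in> edges G"
      from contract_edgeI[OF this, of v u] show ?thesis unfolding f(1) using c by blast
    next
      assume "{v, x} \<in> edges G"
      from contract_edgeI[OF this, of v u] show ?thesis unfolding f(2) using c by blast
    qed
    then show "x \<in> nbrs (contract_edge u v G) u" by (simp only: nbrs_def mem_Collect_eq)
  qed
  let ?g = "\<lambda>G. (contract_edge u v G, (nbrs G u, nbrs G v))"
  have rest: "{e \<in> edges G. v \<notin> e \<and> u \<notin> e} = {e \<in> edges (contract_edge u v G). u \<notin> e}" if "G \<in> ?A" for G
  proof (intro equalityI subsetI)
    note a = A[OF that]
    fix e assume e: "e \<in> {e \<in> edges G. v \<notin> e \<and> u \<notin> e}"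
    then have fe: "?f ` e = e" and c: "card e = 2" using a(5) by (auto simp: simple_graph_def)
    have "e \<in> edges G" using e by blast
    from contract_edgeI[OF this, of v u] have "e \<in> edges (contract_edge u v G)" unfolding fe using c by blast
    then show "e \<in> {e \<in> edges (contract_edge u v G). u \<notin> e}" using e by blast
  next
    note a = A[OF that]
    fix e assume e: "e \<in> {e \<in> edges (contract_edge u v G). u \<notin> e}"
    then have "e \<in> edges (contract_edge u v G)" by blast
    then obtain e' where e': "e' \<in> edges G" "e = ?f ` e'" by (rule contract_edgeE)
    have v: "v \<notin> e'"
    proof
      assume "v \<in> e'"
      then have "?f v \<in> e" unfolding e'(2) by (rule imageI)
      then show False using e by simp
    qed
    have "?f ` e' = e'" using v by force
    then have "e = e'" using e'(2) by simp
    then show "e \<in> {e \<in> edges G. v \<notin> e \<and> u \<notin> e}" using e e'(1) v by blast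
  qed
  \<comment> \<open>Edges that avoid \<open>u\<close> and \<open>v\<close> are not changed by the
    contraction; all others are read off from the recorded neighbourhoods.\<close>
  have inj: "inj_on ?g ?A"
  proof (rule inj_onI)
    fix G H assume GH: "G \<in> ?A" "H \<in> ?A" "?g G = ?g H"
    have c: "contract_edge u v G = contract_edge u v H" and nu: "nbrs G u = nbrs H u" and nv: "nbrs G v = nbrs H v"
      using GH(3) by auto
    have r: "{e \<in> edges G. v \<notin> e \<and> u \<notin> e} = {e \<in> edges H. v \<notin> e \<and> u \<notin> e}" using rest[OF GH(1)] rest[OF GH(2)] c by simp
    have sub: "{e \<in> edges F. v \<notin> e} \<subseteq> {e \<in> edges F'. v \<notin> e}"
      if F: "simple_graph F" and n: "nbrs F u = nbrs F' u" and r: "{e \<in> edges F. v \<notin> e \<and> u \<notin> e} = {e \<in> edges F'. v \<notin> e \<and> u \<notin> e}"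
      for F F' :: "nat graph"
    proof
      fix e assume e: "e \<in> {e \<in> edges F. v \<notin> e}"
      show "e \<in> {e \<in> edges F'. v \<notin> e}"
      proof (cases "u \<in> e")
        case True
        obtain y where y: "e = {u, y}" using edge_atE[OF F _ True] e by blast
        then have "y \<in> nbrs F' u" using e n by (auto simp: nbrs_def)
        then show ?thesis using e y by (simp add: nbrs_def)
      next
        case False
        then show ?thesis using e r by blast
      qed
    qed
    have "{e \<in> edges G. v \<notin> e} = {e \<in> edges H. v \<notin> e}"
      using sub[OF A(5)[OF GH(1)] nu r] sub[OF A(5)[OF GH(2)] nu[symmetric] r[symmetric]] by blast
    then show "G = H" using graph_eq_from_deleted_vertex[OF A(5)[OF GH(1)] A(5)[OF GH(2)] _ nv] A(2)[OF GH(1)] A(2)[OF GH(2)] by simp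
  qed
  have img: "?g ` ?A \<subseteq> (SIGMA H:T. Pow (W H) \<times> Pow (W H))"
  proof
    fix y assume "y \<in> ?g ` ?A"
    then obtain G where G: "G \<in> ?A" "y = ?g G" by blast
    note a = A[OF G(1)]
    have "contract_edge u v G \<in> on_verts D (S - {v})"
      using minor_closedD(4)[OF D a(1,3,4)] a(2) by (auto simp: on_verts_def contract_edge_def)
    moreover have "card (nbrs G u \<union> nbrs G v - {u, v}) \<le> L + L"
    proof -
      have "card (nbrs G u \<union> nbrs G v - {u, v}) \<le> card (nbrs G u \<union> nbrs G v)"
        using finite_nbrs[OF a(5)] by (intro card_mono) auto
      also have "\<dots> \<le> card (nbrs G u) + card (nbrs G v)" by (rule card_Un_le)
      finally show ?thesis using a(6,7) by linarith
    qed
    moreover have "nbrs G u \<subseteq> W (contract_edge u v G)" "nbrs G v \<subseteq> W (contract_edge u v G)"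
      unfolding W_def nb[OF G(1)] by auto
    ultimately show "y \<in> (SIGMA H:T. Pow (W H) \<times> Pow (W H))" unfolding G(2) T_def using nb[OF G(1)] by auto
  qed
  have finW: "finite (W H)" if "H \<in> T" for H
    using finite_nbrs[OF simp[of H "S - {v}"]] that by (simp add: W_def T_def)
  have fin: "finite (SIGMA H:T. Pow (W H) \<times> Pow (W H))"
    using finD finW by (intro finite_SigmaI) (auto simp: T_def)
  have "card ?A \<le> card (SIGMA H:T. Pow (W H) \<times> Pow (W H))" by (rule card_inj_on_le[OF inj img fin])
  also have "\<dots> = (\<Sum>H\<in>T. card (Pow (W H) \<times> Pow (W H)))"
    using finD finW by (intro card_SigmaI) (auto simp: T_def)
  also have "\<dots> \<le> (\<Sum>H\<in>T. 16 ^ (L + L + 2))"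
  proof (rule sum_mono)
    fix H assume H: "H \<in> T"
    have "card (W H) \<le> L + L + 2"
    proof -
      have "W H = {u, v} \<union> nbrs H u" by (auto simp: W_def)
      then have "card (W H) \<le> card {u, v} + card (nbrs H u)" by (metis card_Un_le)
      moreover have "card {u, v} \<le> 2" by (simp add: card_insert_if)
      ultimately have "card (W H) \<le> 2 + card (nbrs H u)" by linarith
      then show ?thesis using H by (simp add: T_def)
    qed
    then have "(2::nat) ^ card (W H) * 2 ^ card (W H) \<le> 2 ^ (L + L + 2) * 2 ^ (L + L + 2)"
      by (intro mult_le_mono power_increasing) auto
    also have "\<dots> = 4 ^ (L + L + 2)" by (simp flip: power_mult_distrib)
    also have "\<dots> \<le> 16 ^ (L + L + 2)" by (intro power_mono) auto
    finally show "card (Pow (W H) \<times> Pow (W H)) \<le> 16 ^ (L + L + 2)"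
      using finW[OF H] by (simp add: card_cartesian_product card_Pow)
  qed
  also have "\<dots> \<le> card (on_verts D (S - {v})) * 16 ^ (L + L + 2)"
    using card_mono[OF finD, of T] by (simp add: T_def)
  finally show ?thesis .
qed

text \<open>Double counting of graphs on \<open>Suc n\<close> vertices together with a reducible
  pair. Each graph has at least \<open>Suc n / (4 * M)\<close> such pairs. Each of the
  \<open>Suc n * Suc n\<close> pairs of vertices is reducible in at most \<open>1 + C\<close> times
  as many graphs as there are on \<open>n\<close> vertices. One factor \<open>Suc n\<close>
  cancels.\<close>

lemma minor_closed_growth:
  assumes D: "minor_closed D" "iso_closed D" and G: "simple_graph G" "G \<notin> D"
  obtains K :: nat where "K \<ge> 1"
    "\<And>n. n \<ge> 3 \<Longrightarrow> card (on_verts D {1..Suc n}) \<le> K * Suc n * card (on_verts D {1..n})"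
proof -
  obtain d where d: "d \<ge> 1" and sparse: "\<And>H. H \<in> D \<Longrightarrow> card (edges H) \<le> d * card (verts H)"
    using sparse_minor_closed[OF D G] by metis
  define M where "M = 1 + d + 4 ^ d"
  define L where "L = 4 * d * M"
  define C :: nat where "C = 16 ^ (L + L + 2)"
  have simple: "\<And>G. G \<in> D \<Longrightarrow> simple_graph G" using minor_closedD(1)[OF D(1)] .
  have step: "card (on_verts D {1..Suc n}) \<le> (4 * M * (1 + C)) * Suc n * card (on_verts D {1..n})" if n: "n \<ge> 3" for n
  proof -
    let ?S = "{1..Suc n}" and ?N = "card (on_verts D {1..n})"
    let ?X = "on_verts D ?S"
    have finX: "finite ?X" using finite_on_verts[OF simple] by auto
    have N: "card (on_verts D (?S - {v})) = ?N" if "v \<in> ?S" for v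
      by (rule card_on_verts_eq[OF D(2) simple]) (use that in auto)
    have pairs: "(\<Sum>G\<in>?X. card (Z G)) = (\<Sum>p\<in>?S \<times> ?S. card {G \<in> ?X. p \<in> Z G})"
      if Z: "\<And>G. G \<in> ?X \<Longrightarrow> Z G \<subseteq> ?S \<times> ?S" for Z :: "nat graph \<Rightarrow> (nat \<times> nat) set"
    proof -
      have "(\<Sum>G\<in>?X. card (Z G)) = (\<Sum>G\<in>?X. \<Sum>p\<in>?S \<times> ?S. if p \<in> Z G then 1 else 0)"
      proof (rule sum.cong[OF HOL.refl])
        fix G assume "G \<in> ?X"
        then show "card (Z G) = (\<Sum>p\<in>?S \<times> ?S. if p \<in> Z G then 1 else 0)"
          using Z[of G] by (simp add: sum.If_cases Int_absorb1)
      qed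
      also have "\<dots> = (\<Sum>p\<in>?S \<times> ?S. \<Sum>G\<in>?X. if p \<in> Z G then 1 else 0)" by (rule sum.swap)
      also have "\<dots> = (\<Sum>p\<in>?S \<times> ?S. card {G \<in> ?X. p \<in> Z G})"
        using finX by (simp add: sum.If_cases Int_def)
      finally show ?thesis .
    qed
    have t: "(\<Sum>G\<in>?X. card (twins G)) \<le> (Suc n * Suc n) * ?N"
    proof -
      have "(\<Sum>G\<in>?X. card (twins G)) = (\<Sum>p\<in>?S \<times> ?S. card {G \<in> ?X. p \<in> twins G})"
        by (rule pairs) (auto simp: twins_def on_verts_def)
      also have "\<dots> \<le> (\<Sum>p\<in>?S \<times> ?S. ?N)"
      proof (rule sum_mono)
        fix p assume "p \<in> ?S \<times> ?S"
        then obtain u v where p: "p = (u, v)" "u \<in> ?S" "v \<in> ?S" by auto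
        show "card {G \<in> ?X. p \<in> twins G} \<le> ?N"
        proof (cases "u = v")
          case True
          then have "{G \<in> ?X. p \<in> twins G} = {}" using p by (auto simp: twins_def)
          then show ?thesis by (simp only: card.empty le0)
        next
          case False
          then show ?thesis using card_twins_le[OF D(1), of ?S u v] N[OF p(3)] p by simp
        qed
      qed
      finally show ?thesis by (simp add: card_cartesian_product)
    qed
    have l: "(\<Sum>G\<in>?X. card (low_edges L G)) \<le> (Suc n * Suc n) * (?N * C)"
    proof -
      have "(\<Sum>G\<in>?X. card (low_edges L G)) = (\<Sum>p\<in>?S \<times> ?S. card {G \<in> ?X. p \<in> low_edges L G})"
      proof (rule pairs)
        fix G assume "G \<in> ?X"
        then have "verts G = ?S" by (simp add: on_verts_def)
        then show "low_edges L G \<subseteq> ?S \<times> ?S" unfolding low_edges_def by blast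
      qed
      also have "\<dots> \<le> (\<Sum>p\<in>?S \<times> ?S. ?N * C)"
      proof (rule sum_mono)
        fix p assume "p \<in> ?S \<times> ?S"
        then obtain u v where p: "p = (u, v)" "u \<in> ?S" "v \<in> ?S" by auto
        show "card {G \<in> ?X. p \<in> low_edges L G} \<le> ?N * C"
          using card_low_edges_le[OF D(1), of ?S u v L] N[OF p(3)] p by (simp add: C_def)
      qed
      finally show ?thesis by (simp add: card_cartesian_product)
    qed
    have "card ?X * Suc n \<le> (\<Sum>G\<in>?X. 4 * M * (card (twins G) + card (low_edges L G)))"
    proof -
      \<comment> \<open>\<open>n \<ge> 3\<close> provides the four vertices that
        \<open>many_reducible_pairs\<close> asks for.\<close>
      have "Suc n \<le> 4 * M * (card (twins G) + card (low_edges L G))" if "G \<in> ?X" for G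
        using many_reducible_pairs[OF D(1) sparse d, of G] that n unfolding M_def L_def by (auto simp: on_verts_def)
      then show ?thesis using sum_bounded_below[of ?X "Suc n" "\<lambda>G. 4 * M * (card (twins G) + card (low_edges L G))"] by simp
    qed
    also have "\<dots> = 4 * M * ((\<Sum>G\<in>?X. card (twins G)) + (\<Sum>G\<in>?X. card (low_edges L G)))"
      unfolding sum.distrib[symmetric] sum_distrib_left by (rule HOL.refl)
    also have "\<dots> \<le> 4 * M * ((Suc n * Suc n) * ?N + (Suc n * Suc n) * (?N * C))"
      using t l by (intro mult_le_mono2 add_mono)
    also have "\<dots> = ((4 * M * (1 + C)) * Suc n * ?N) * Suc n" by (simp add: algebra_simps)
    finally show ?thesis by (metis mult_le_cancel2 zero_less_Suc)
  qed
  show thesis by (rule that[OF _ step]) (simp add: M_def)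
qed

section \<open>Random graphs in a class closed under fans\<close>

text \<open>Only an inclusion is asked of the edges. The effect of an operation then merely has to
  be contained in another graph with a fan.\<close>

definition fan_extension :: "nat graph set \<Rightarrow> nat graph set" where
  "fan_extension D = {H. simple_graph H \<and> (\<exists>M\<in>D. \<exists>v\<in>verts M. \<exists>Q r. finite Q \<and> inj_on r Q \<and> Q \<inter> verts M = {} \<and>
     verts H = verts M \<union> Q \<and> edges H \<subseteq> edges M \<union> fan_edges Q r v)}"

lemma fan_extensionI:
  assumes "simple_graph H" "M \<in> D" "v \<in> verts M" "finite Q" "inj_on r Q" "Q \<inter> verts M = {}"
    "verts H = verts M \<union> Q" "edges H \<subseteq> edges M \<union> fan_edges Q r v"
  shows "H \<in> fan_extension D"
  unfolding fan_extension_def using assms by blast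

lemma consecutive_subset:
  "consecutive Q r p q \<Longrightarrow> Q' \<subseteq> Q \<Longrightarrow> p \<in> Q' \<Longrightarrow> q \<in> Q' \<Longrightarrow> consecutive Q' r p q"
  by (auto simp: consecutive_def)

lemma fan_edges_delete_vertex:
  assumes "e \<in> fan_edges Q r v" "x \<notin> e"
  shows "e \<in> fan_edges (Q - {x}) r v"
  using assms consecutive_subset[of Q r _ _ "Q - {x}"] by (auto simp: fan_edges_def; blast dest: consecutive_def[THEN iffD1])

text \<open>Without its centre the fan is a path, and a path lies in a fan around any of its own
  vertices: the path edges at \<open>p\<close> become spokes.\<close>

lemma fan_edges_delete_centre:
  assumes "e \<in> fan_edges Q r v" "v \<notin> e" "p \<in> Q"
  shows "e \<in> fan_edges (Q - {p}) r p"
proof -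
  obtain a b where ab: "consecutive Q r a b" "e = {a, b}" using assms(1,2) by (auto simp: fan_edges_def)
  then have abQ: "a \<in> Q" "b \<in> Q" "a \<noteq> b" by (auto simp: consecutive_def)
  consider "a = p" | "b = p" | "a \<noteq> p" "b \<noteq> p" by blast
  then show ?thesis
  proof cases
    case 1
    then show ?thesis using ab abQ by (auto simp: fan_edges_def)
  next
    case 2
    then have "e = {p, a}" using ab by auto
    then show ?thesis using 2 abQ by (auto simp: fan_edges_def)
  next
    case 3
    then have "consecutive (Q - {p}) r a b" using ab abQ by (intro consecutive_subset[OF ab(1)]) auto
    then show ?thesis using ab by (auto simp: fan_edges_def)
  qed
qed

lemma fan_extension_simple: "H \<in> fan_extension D \<Longrightarrow> simple_graph H"
  by (simp add: fan_extension_def)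

lemma single_vertex_graph:
  assumes D: "minor_closed D" "iso_closed D" and G: "G \<in> D"
  shows "({x}, {}) \<in> D"
proof -
  obtain y where y: "y \<in> verts G" using minor_closedD(1)[OF D(1) G] by (auto simp: simple_graph_def)
  then have "({y}, {}) \<in> D" by (intro minor_closed_subgraph[OF D(1) G]) auto
  then have "relabel (\<lambda>_. x) ({y}, {}) \<in> D" using D(2) by (auto simp: iso_closed_def)
  then show ?thesis by (simp add: relabel_def)
qed

text \<open>Contracting a spoke turns the path edges at \<open>b\<close> into spokes; contracting a
  path edge shortens the path by one vertex. The remaining vertices keep their order.\<close>

lemma merge_doubleton_fan_edge:
  fixes Q :: "nat set" and r :: "nat \<Rightarrow> nat"
  assumes r: "inj_on r Q" and b: "b \<in> Q" and ab: "{a, b} \<in> fan_edges Q r v" and vQ: "v \<notin> Q"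
    and e: "e \<in> fan_edges Q r v" and c: "card ((\<lambda>y. if y = b then a else y) ` e) = 2"
  shows "(\<lambda>y. if y = b then a else y) ` e \<in> fan_edges (Q - {b}) r v"
proof -
  let ?f = "\<lambda>y. if y = b then a else y"
  have vb: "v \<noteq> b" using b vQ by blast
  have aQ: "a \<in> insert v Q" "a \<noteq> b"
  proof -
    consider p where "p \<in> Q" "{a, b} = {v, p}" | p q where "consecutive Q r p q" "{a, b} = {p, q}"
      using ab by (auto simp: fan_edges_def)
    then have "a \<in> insert v Q \<and> a \<noteq> b"
    proof cases
      case 1
      then show ?thesis using vQ vb by (auto simp: doubleton_eq_iff)
    next
      case 2
      then show ?thesis by (auto simp: doubleton_eq_iff consecutive_def)
    qed
    then show "a \<in> insert v Q" "a \<noteq> b" by auto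
  qed
  have cons_ab: "consecutive Q r a b \<or> consecutive Q r b a" if "a \<noteq> v"
    using ab that vb by (auto simp: fan_edges_def doubleton_eq_iff)
  consider (spoke) p where "p \<in> Q" "e = {v, p}" | (rim) p q where "consecutive Q r p q" "e = {p, q}"
    using e by (auto simp: fan_edges_def)
  then show ?thesis
  proof cases
    case spoke
    show ?thesis
    proof (cases "p = b")
      case True
      then have fe: "?f ` e = {v, a}" using spoke vb by auto
      then have "a \<noteq> v" using c by auto
      then show ?thesis using fe aQ by (auto simp: fan_edges_def)
    next
      case False
      then have "?f ` e = {v, p}" using spoke vb by auto
      then show ?thesis using spoke False by (auto simp: fan_edges_def)
    qed
  next
    case rim
    have pq: "p \<in> Q" "q \<in> Q" "r p < r q" "\<And>z. z \<in> Q \<Longrightarrow> \<not> (r p < r z \<and> r z < r q)" using rim by (auto simp: consecutive_def)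
    show ?thesis
    proof (cases "b \<in> e")
      case False
      then have "?f ` e = e" by auto
      moreover have "consecutive (Q - {b}) r p q" using rim False pq by (intro consecutive_subset[OF rim(1)]) auto
      ultimately show ?thesis using rim by (auto simp: fan_edges_def)
    next
      case True
      then obtain z where z: "z \<in> Q" "z \<noteq> b" "e = {b, z}" "consecutive Q r b z \<or> consecutive Q r z b"
        using rim pq by (cases "p = b") auto
      have fe: "?f ` e = {a, z}" using z by auto
      have az: "a \<noteq> z" using c fe by auto
      show ?thesis
      proof (cases "a = v")
        case True
        then show ?thesis using fe z by (auto simp: fan_edges_def)
      next
        case False
        note ca = cons_ab[OF False]
        have aQ': "a \<in> Q" using aQ False by blast
        have rinj: "r x = r y \<Longrightarrow> x = y" if "x \<in> Q" "y \<in> Q" for x y using r that by (auto simp: inj_on_def)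
        \<comment> \<open>If \<open>a\<close> and \<open>z\<close> were on the same side of
          \<open>b\<close>, they would be equal. So they are on different sides and become
          consecutive once \<open>b\<close> is gone.\<close>
        have same: "a = z" if "consecutive Q r b z \<and> consecutive Q r b a \<or> consecutive Q r z b \<and> consecutive Q r a b"
          using that rinj[OF aQ' z(1)] unfolding consecutive_def by (metis nat_neq_iff)
        have "consecutive (Q - {b}) r a z \<or> consecutive (Q - {b}) r z a"
        proof -
          have between: "consecutive (Q - {b}) r x y" if xy: "consecutive Q r x b" "consecutive Q r b y" for x y
            unfolding consecutive_def
          proof (intro conjI ballI)
            show "x \<in> Q - {b}" "y \<in> Q - {b}" "r x < r y" using xy by (auto simp: consecutive_def)
            fix w assume w: "w \<in> Q - {b}"
            then have "r w \<noteq> r b" using rinj[of w b] b by auto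
            then show "\<not> (r x < r w \<and> r w < r y)" using xy w unfolding consecutive_def by (metis DiffD1 nat_neq_iff)
          qed
          then show ?thesis using ca z(4) same az by blast
        qed
        then show ?thesis using fe by (auto simp: fan_edges_def insert_commute)
      qed
    qed
  qed
qed

text \<open>An operation within \<open>M\<close> or at a path vertex is absorbed by that part. What
  needs care is the loss of the centre: the path is then assigned to another centre, or a path
  vertex takes the place of the centre.\<close>

lemma minor_closed_fan_extension:
  assumes D: "minor_closed D" "iso_closed D"
  shows "minor_closed (fan_extension D)"
  unfolding minor_closed_def
proof (intro conjI ballI allI impI)
  fix H assume H: "H \<in> fan_extension D"
  then show sH: "simple_graph H" by (rule fan_extension_simple)
  obtain M v Q r where M: "M \<in> D" "v \<in> verts M" and Q: "finite Q" "inj_on r Q" "Q \<inter> verts M = {}"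
    and VH: "verts H = verts M \<union> Q" and EH: "edges H \<subseteq> edges M \<union> fan_edges Q r v"
    using H unfolding fan_extension_def by blast
  have sM: "simple_graph M" using minor_closedD(1)[OF D(1) M(1)] .
  have vQ: "v \<notin> Q" using M(2) Q(3) by blast
  have EM: "e \<subseteq> verts M" if "e \<in> edges M" for e using sM that by (auto simp: simple_graph_def)
  {
    fix x assume x: "x \<in> verts H" "verts H \<noteq> {x}"
    have s: "simple_graph (delete_vertex x H)" using simple_delete_vertex[OF sH x(2)] .
    have V: "verts (delete_vertex x H) = verts H - {x}" and E: "edges (delete_vertex x H) = {e \<in> edges H. x \<notin> e}"
      by (auto simp: delete_vertex_def)
    consider "x \<in> Q" | "x \<in> verts M" "verts M = {x}" | "x \<in> verts M" "verts M \<noteq> {x}" "x = v" | "x \<in> verts M" "verts M \<noteq> {x}" "x \<noteq> v"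
      using x VH by blast
    then show "delete_vertex x H \<in> fan_extension D"
    proof cases
      case 1
      show ?thesis
      proof (rule fan_extensionI[OF s M, of "Q - {x}" r])
        show "edges (delete_vertex x H) \<subseteq> edges M \<union> fan_edges (Q - {x}) r v"
          unfolding E using EH fan_edges_delete_vertex by blast
      qed (use Q VH V 1 in \<open>auto intro: inj_on_subset\<close>)
    next
      case 2
      \<comment> \<open>\<open>M\<close> was the centre alone, so only the path is left. One of its
        vertices becomes the new one-vertex graph and the new centre.\<close>
      then have xv: "x = v" using M(2) by auto
      obtain p where p: "p \<in> Q" using x VH 2 by blast
      show ?thesis
      proof (rule fan_extensionI[OF s single_vertex_graph[OF D M(1), of p], of p "Q - {p}" r])
        show "edges (delete_vertex x H) \<subseteq> edges ({p}, {}) \<union> fan_edges (Q - {p}) r p"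
        proof
          fix e assume e: "e \<in> edges (delete_vertex x H)"
          then have "e \<in> edges H" "x \<notin> e" unfolding E by auto
          then have "e \<in> edges H" "v \<notin> e" unfolding xv by auto
          moreover have "e \<notin> edges M"
          proof
            assume "e \<in> edges M"
            then have "e \<subseteq> {v}" "card e = 2" using EM 2 xv sM by (auto simp: simple_graph_def)
            then show False using card_mono[of "{v}" e] by simp
          qed
          ultimately show "e \<in> edges ({p}, {}) \<union> fan_edges (Q - {p}) r p" using EH fan_edges_delete_centre[OF _ _ p] by blast
        qed
        show "verts (delete_vertex x H) = verts ({p}, {}) \<union> (Q - {p})" using V VH 2 p Q(3) by auto
      qed (use Q in \<open>auto intro: inj_on_subset\<close>)
    next
      case 3
      \<comment> \<open>The spokes disappear with the centre and the path is detached. Since an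
        inclusion of edges suffices, any other vertex \<open>w\<close> may count as its
        centre.\<close>
      obtain w where w: "w \<in> verts M" "w \<noteq> x" using 3 by blast
      have M': "delete_vertex x M \<in> D" using minor_closedD(2)[OF D(1) M(1) 3(1,2)] .
      show ?thesis
      proof (rule fan_extensionI[OF s M', of w Q r])
        show "w \<in> verts (delete_vertex x M)" using w by (simp add: delete_vertex_def)
        show "edges (delete_vertex x H) \<subseteq> edges (delete_vertex x M) \<union> fan_edges Q r w"
          unfolding E using EH 3(3) by (auto simp: delete_vertex_def fan_edges_def)
      qed (use Q VH V 3 vQ in \<open>auto simp: delete_vertex_def\<close>)
    next
      case 4
      have M': "delete_vertex x M \<in> D" using minor_closedD(2)[OF D(1) M(1) 4(1,2)] .
      show ?thesis
      proof (rule fan_extensionI[OF s M', of v Q r])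
        show "v \<in> verts (delete_vertex x M)" using M 4 by (simp add: delete_vertex_def)
        show "edges (delete_vertex x H) \<subseteq> edges (delete_vertex x M) \<union> fan_edges Q r v"
          unfolding E using EH by (auto simp: delete_vertex_def)
      qed (use Q VH V 4 in \<open>auto simp: delete_vertex_def\<close>)
    qed
  next
    fix e assume "e \<in> edges H"
    show "delete_edge e H \<in> fan_extension D"
      by (rule fan_extensionI[OF simple_delete_edge[OF sH] M Q]) (use VH EH in \<open>auto simp: delete_edge_def\<close>)
  next
    fix a b assume ab: "{a, b} \<in> edges H" "a \<noteq> b"
    let ?f = "\<lambda>y. if y = b then a else y"
    let ?H = "contract_edge a b H"
    have s: "simple_graph ?H" using simple_contract_edge[OF sH ab] .
    have V: "verts ?H = verts H - {b}" by (simp add: contract_edge_def)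
    have fM: "?f ` e \<in> edges (contract_edge a b M)" if "e \<in> edges M" "card (?f ` e) = 2" for e
      using contract_edgeI[OF that] .
    show "?H \<in> fan_extension D"
    proof (cases "{a, b} \<in> edges M")
      case True
      have ends: "a \<in> verts M" "b \<in> verts M" using EM[OF True] by auto
      have M': "contract_edge a b M \<in> D" using minor_closedD(4)[OF D(1) M(1) True ab(2)] .
      show ?thesis
      proof (rule fan_extensionI[OF s M', of "?f v" Q r])
        show "?f v \<in> verts (contract_edge a b M)" using M(2) ends ab(2) by (auto simp: contract_edge_def)
        show "edges ?H \<subseteq> edges (contract_edge a b M) \<union> fan_edges Q r (?f v)"
        proof
          fix e assume "e \<in> edges ?H"
          then obtain e' where e': "e' \<in> edges H" "e = ?f ` e'" "card e = 2" by (rule contract_edgeE)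
          then consider "e' \<in> edges M" | "e' \<in> fan_edges Q r v" using EH by blast
          then show "e \<in> edges (contract_edge a b M) \<union> fan_edges Q r (?f v)"
          proof cases
            case 1
            then show ?thesis using fM e' by blast
          next
            case 2
            have fQ: "?f p = p" if "p \<in> Q" for p using that ends Q(3) by auto
            have "?f ` e' \<in> fan_edges Q r (?f v)"
            proof -
              consider p where "p \<in> Q" "e' = {v, p}" | p q where "consecutive Q r p q" "e' = {p, q}"
                using 2 by (auto simp: fan_edges_def)
              then show ?thesis
              proof cases
                case 1
                have "?f ` e' = {?f v, ?f p}" unfolding 1(2) by (simp only: image_insert image_empty)
                then show ?thesis unfolding fQ[OF 1(1)] using 1(1) unfolding fan_edges_def by blast
              next
                case 2
                then have pq: "p \<in> Q" "q \<in> Q" by (auto simp: consecutive_def)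
                have "?f ` e' = {?f p, ?f q}" unfolding 2(2) by (simp only: image_insert image_empty)
                then have "?f ` e' = {p, q}" unfolding fQ[OF pq(1)] fQ[OF pq(2)] .
                then show ?thesis using 2(1) unfolding fan_edges_def by blast
              qed
            qed
            then show ?thesis using e'(2) by blast
          qed
        qed
      qed (use Q VH V ends in \<open>auto simp: contract_edge_def\<close>)
    next
      case False
      then have abF: "{a, b} \<in> fan_edges Q r v" using ab EH by blast
      have abQ: "a \<in> insert v Q" "b \<in> insert v Q" using abF by (auto simp: fan_edges_def doubleton_eq_iff consecutive_def)
      show ?thesis
      proof (cases "b = v")
        case False
        then have bQ: "b \<in> Q" using abQ by blast
        show ?thesis
        proof (rule fan_extensionI[OF s M, of "Q - {b}" r])
          show "edges ?H \<subseteq> edges M \<union> fan_edges (Q - {b}) r v"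
          proof
            fix e assume "e \<in> edges ?H"
            then obtain e' where e': "e' \<in> edges H" "e = ?f ` e'" "card e = 2" by (rule contract_edgeE)
            then consider "e' \<in> edges M" | "e' \<in> fan_edges Q r v" using EH by blast
            then show "e \<in> edges M \<union> fan_edges (Q - {b}) r v"
            proof cases
              case 1
              have "b \<notin> e'" using EM[OF 1] bQ Q(3) by blast
              then have "?f ` e' = e'" by auto
              then show ?thesis using 1 e' by simp
            next
              case 2
              then show ?thesis using merge_doubleton_fan_edge[OF Q(2) bQ abF vQ 2] e' by simp
            qed
          qed
        qed (use Q VH V bQ in \<open>auto intro: inj_on_subset\<close>)
      next
        case True
        \<comment> \<open>The centre is merged into the path vertex \<open>a\<close>. The result is
          contained in the graph obtained by renaming the centre of \<open>M\<close> to
          \<open>a\<close> and taking \<open>a\<close> out of the path.\<close>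
        have aQ: "a \<in> Q" using abQ True ab(2) by blast
        have aM: "a \<notin> verts M" using aQ Q(3) by blast
        have inj: "inj_on ?f (verts M)" using aM by (auto simp: inj_on_def)
        have M': "relabel ?f M \<in> D" using D(2) M(1) inj by (auto simp: iso_closed_def)
        have VM': "verts (relabel ?f M) = insert a (verts M - {v})" using True M(2) by (auto simp: relabel_def)
        show ?thesis
        proof (rule fan_extensionI[OF s M', of a "Q - {a}" r])
          show "a \<in> verts (relabel ?f M)" using VM' by simp
          show "(Q - {a}) \<inter> verts (relabel ?f M) = {}" using VM' Q(3) by auto
          show "verts ?H = verts (relabel ?f M) \<union> (Q - {a})" using V VH VM' True aQ vQ by auto
          show "edges ?H \<subseteq> edges (relabel ?f M) \<union> fan_edges (Q - {a}) r a"
          proof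
            fix e assume "e \<in> edges ?H"
            then obtain e' where e': "e' \<in> edges H" "e = ?f ` e'" "card e = 2" by (rule contract_edgeE)
            then consider "e' \<in> edges M" | "e' \<in> fan_edges Q r v" using EH by blast
            then show "e \<in> edges (relabel ?f M) \<union> fan_edges (Q - {a}) r a"
            proof cases
              case 1
              then show ?thesis using e' by (auto simp: relabel_def)
            next
              case 2
              show ?thesis
              proof (cases "v \<in> e'")
                case False
                then have "?f ` e' = e'" using True by auto
                then show ?thesis using fan_edges_delete_centre[OF 2 False aQ] e' by simp
              next
                case vin: True
                have "\<exists>p\<in>Q. e' = {v, p}" using 2 vin vQ by (auto simp: fan_edges_def consecutive_def)
                then obtain p where p: "p \<in> Q" "e' = {v, p}" by blast
                then have "e = {a, p}" using e'(2) True vQ by auto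
                moreover from this have "p \<noteq> a" using e'(3) by auto
                ultimately show ?thesis using p(1) by (auto simp: fan_edges_def)
              qed
            qed
          qed
        qed (use Q in \<open>auto intro: inj_on_subset\<close>)
      qed
    qed
  }
qed

text \<open>\<open>fan_extension (Minor \<A>)\<close> is closed under minors and contained in
  \<open>\<A>\<close>, so every minor of the new graph lies in \<open>\<A>\<close>.\<close>

lemma Minor_fan_closed:
  assumes iso: "iso_closed \<A>" and sub: "\<And>G. G \<in> \<A> \<Longrightarrow> simple_graph G" and isoM: "iso_closed (Minor \<A>)"
    and fan: "\<And>G v Q r. G \<in> \<A> \<Longrightarrow> v \<in> verts G \<Longrightarrow> finite Q \<Longrightarrow> inj_on r Q \<Longrightarrow> Q \<inter> verts G = {} \<Longrightarrow>
      (verts G \<union> Q, edges G \<union> fan_edges Q r v) \<in> \<A>"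
    and edges: "\<And>G F. G \<in> \<A> \<Longrightarrow> F \<subseteq> edges G \<Longrightarrow> (verts G, F) \<in> \<A>"
    and G: "G \<in> Minor \<A>" "v \<in> verts G" "finite Q" "inj_on r Q" "Q \<inter> verts G = {}"
  shows "(verts G \<union> Q, edges G \<union> fan_edges Q r v) \<in> Minor \<A>"
proof -
  let ?H = "(verts G \<union> Q, edges G \<union> fan_edges Q r v)"
  have MA: "Minor \<A> \<subseteq> \<A>" using minor.refl by (auto simp: Minor_def)
  have ext: "fan_extension (Minor \<A>) \<subseteq> \<A>"
  proof
    fix H assume "H \<in> fan_extension (Minor \<A>)"
    then obtain M v Q r where M: "M \<in> Minor \<A>" "v \<in> verts M" "finite Q" "inj_on r Q" "Q \<inter> verts M = {}"
      and H: "verts H = verts M \<union> Q" "edges H \<subseteq> edges M \<union> fan_edges Q r v" unfolding fan_extension_def by blast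
    have "(verts M \<union> Q, edges M \<union> fan_edges Q r v) \<in> \<A>" using fan[OF _ M(2-5)] M(1) MA by blast
    from edges[OF this, of "edges H"] show "H \<in> \<A>" using H by (metis fst_conv snd_conv prod.collapse)
  qed
  have "?H \<in> \<A>" using fan G MA by blast
  then have sH: "simple_graph ?H" by (rule sub)
  have "?H \<in> fan_extension (Minor \<A>)" by (rule fan_extensionI[OF sH G]) auto
  then have "K \<in> \<A>" if "minor K ?H" for K
    using minor_in_minor_closed[OF that minor_closed_fan_extension[OF minor_closed_Minor isoM]] ext by blast
  then show ?thesis using sH by (simp add: Minor_def)
qed

section \<open>Counting graphs with an attached fan\<close>

definition fan_closed :: "nat graph set \<Rightarrow> bool" where
  "fan_closed D \<longleftrightarrow> (\<forall>G\<in>D. \<forall>v\<in>verts G. \<forall>Q r. finite Q \<longrightarrow> inj_on r Q \<longrightarrow> Q \<inter> verts G = {} \<longrightarrow>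
     (verts G \<union> Q, edges G \<union> fan_edges Q r v) \<in> D)"

lemma nbrs_relabel:
  assumes "simple_graph G" "inj_on f (verts G)" "v \<in> verts G"
  shows "nbrs (relabel f G) (f v) = f ` nbrs G v"
proof (intro equalityI subsetI)
  fix y assume "y \<in> nbrs (relabel f G) (f v)"
  then have "{f v, y} \<in> (`) f ` edges G" by (simp add: nbrs_def relabel_def)
  then obtain e where e: "e \<in> edges G" "f ` e = {f v, y}" by (metis imageE)
  have eV: "e \<subseteq> verts G" using assms(1) e(1) by (auto simp: simple_graph_def)
  have "f v \<in> f ` e" using e(2) by simp
  then have "v \<in> e" using assms(2,3) eV by (meson inj_on_image_mem_iff)
  then obtain x where x: "e = {v, x}" "v \<noteq> x" "x \<in> verts G" using edge_atE[OF assms(1) e(1)] by metis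
  have "f v \<noteq> f x" using assms(2,3) x by (auto simp: inj_on_def)
  then have "y = f x" using e(2) x(1) by (auto simp: doubleton_eq_iff)
  then show "y \<in> f ` nbrs G v" using e(1) x(1) by (auto simp: nbrs_def)
next
  fix y assume "y \<in> f ` nbrs G v"
  then obtain x where x: "{v, x} \<in> edges G" "y = f x" by (auto simp: nbrs_def)
  have "f ` {v, x} \<in> (`) f ` edges G" using x(1) by (rule imageI)
  then show "y \<in> nbrs (relabel f G) (f v)" using x(2) by (simp add: nbrs_def relabel_def)
qed

lemma iso_closed_bounded_nbrs:
  assumes D: "iso_closed D" "\<And>G. G \<in> D \<Longrightarrow> simple_graph G"
  shows "iso_closed {G \<in> D. \<forall>v\<in>verts G. card (nbrs G v) < k}"
  unfolding iso_closed_def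
proof (intro ballI allI impI CollectI conjI)
  fix G :: "nat graph" and f :: "nat \<Rightarrow> nat" assume G: "G \<in> {G \<in> D. \<forall>v\<in>verts G. card (nbrs G v) < k}" and f: "inj_on f (verts G)"
  have GD: "G \<in> D" using G by blast
  then show "relabel f G \<in> D" using D(1) f by (auto simp: iso_closed_def)
  fix w assume "w \<in> verts (relabel f G)"
  then obtain v where v: "v \<in> verts G" "w = f v" by (auto simp: relabel_def)
  have "nbrs G v \<subseteq> verts G" using nbrs_subset[OF D(2)[OF GD], of v] by blast
  then have "card (f ` nbrs G v) = card (nbrs G v)" using f by (meson card_image inj_on_subset)
  then show "card (nbrs (relabel f G) w) < k" using nbrs_relabel[OF D(2)[OF GD] f v(1)] G v by simp
qed

text \<open>The rank of a path vertex is its index in the list, so lists of labels can be counted in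
  place of sets with an order.\<close>

definition list_fan :: "nat list \<Rightarrow> nat graph \<Rightarrow> nat \<Rightarrow> nat graph" where
  "list_fan ps G v = (verts G \<union> set ps, edges G \<union> fan_edges (set ps) (the_inv_into {..<length ps} ((!) ps)) v)"

lemma list_rank:
  assumes "distinct ps" "i < length ps"
  shows "the_inv_into {..<length ps} ((!) ps) (ps ! i) = i"
  by (rule the_inv_into_f_f) (use assms in \<open>auto simp: inj_on_nth\<close>)

lemma inj_list_rank:
  assumes "distinct ps"
  shows "inj_on (the_inv_into {..<length ps} ((!) ps)) (set ps)"
proof -
  have "inj_on ((!) ps) {..<length ps}" using assms by (simp add: inj_on_nth)
  moreover have "(!) ps ` {..<length ps} = set ps" by (auto simp: set_conv_nth)
  ultimately show ?thesis using inj_on_the_inv_into by metis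
qed

lemma consecutive_list_iff:
  assumes ps: "distinct ps"
  shows "consecutive (set ps) (the_inv_into {..<length ps} ((!) ps)) p q \<longleftrightarrow>
    (\<exists>i. Suc i < length ps \<and> p = ps ! i \<and> q = ps ! Suc i)"
proof
  let ?r = "the_inv_into {..<length ps} ((!) ps)"
  assume c: "consecutive (set ps) ?r p q"
  then obtain i j where ij: "i < length ps" "j < length ps" "p = ps ! i" "q = ps ! j"
    by (auto simp: consecutive_def in_set_conv_nth)
  have "i < j" using c list_rank[OF ps ij(1)] list_rank[OF ps ij(2)] ij by (simp add: consecutive_def)
  moreover have "\<not> Suc i < j"
  proof
    assume s: "Suc i < j"
    then have "ps ! Suc i \<in> set ps" "Suc i < length ps" using ij by auto
    then have "\<not> (?r p < ?r (ps ! Suc i) \<and> ?r (ps ! Suc i) < ?r q)" using c by (simp add: consecutive_def)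
    then show False using s list_rank[OF ps ij(1)] list_rank[OF ps ij(2)] list_rank[OF ps \<open>Suc i < length ps\<close>] ij by simp
  qed
  ultimately have "j = Suc i" by linarith
  then show "\<exists>i. Suc i < length ps \<and> p = ps ! i \<and> q = ps ! Suc i" using ij by blast
next
  let ?r = "the_inv_into {..<length ps} ((!) ps)"
  assume "\<exists>i. Suc i < length ps \<and> p = ps ! i \<and> q = ps ! Suc i"
  then obtain i where i: "Suc i < length ps" "p = ps ! i" "q = ps ! Suc i" by blast
  have r: "?r p = i" "?r q = Suc i" using list_rank[OF ps, of i] list_rank[OF ps, of "Suc i"] i by auto
  show "consecutive (set ps) ?r p q"
    unfolding consecutive_def r using i by auto
qed

lemma edges_list_fan:
  assumes "distinct ps"
  shows "{a, b} \<in> edges (list_fan ps G v) \<longleftrightarrow> {a, b} \<in> edges G \<or> (a = v \<and> b \<in> set ps) \<or> (b = v \<and> a \<in> set ps) \<or>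
    (\<exists>i. Suc i < length ps \<and> (a = ps ! i \<and> b = ps ! Suc i \<or> b = ps ! i \<and> a = ps ! Suc i))"
  unfolding list_fan_def fan_edges_def snd_conv Un_iff mem_Collect_eq consecutive_list_iff[OF assms] doubleton_eq_iff
  by blast

lemma nbrs_list_fan:
  assumes ps: "distinct ps" and G: "simple_graph G" "v \<in> verts G" "set ps \<inter> verts G = {}"
  shows "nbrs (list_fan ps G v) v = nbrs G v \<union> set ps"
    and "w \<in> verts G \<Longrightarrow> w \<noteq> v \<Longrightarrow> nbrs (list_fan ps G v) w = nbrs G w"
    and "i < length ps \<Longrightarrow> nbrs (list_fan ps G v) (ps ! i) =
      insert v ({ps ! j |j. Suc j = i} \<union> {ps ! Suc i |_ :: unit. Suc i < length ps})"
proof -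
  have old: "{a, b} \<notin> edges G" if "a \<in> set ps" for a b
    using edge_ends[OF G(1), of a b] that G(3) by blast
  have vps: "v \<notin> set ps" using G(2,3) by blast
  have nth: "ps ! i \<in> set ps" if "i < length ps" for i using that by simp
  show "nbrs (list_fan ps G v) v = nbrs G v \<union> set ps"
    unfolding nbrs_def edges_list_fan[OF ps] using vps nth by (auto dest: Suc_lessD)
  show "nbrs (list_fan ps G v) w = nbrs G w" if "w \<in> verts G" "w \<noteq> v"
  proof -
    have "w \<notin> set ps" using that G(3) by blast
    then show ?thesis unfolding nbrs_def edges_list_fan[OF ps] using that(2) nth by (auto dest: Suc_lessD)
  qed
  show "nbrs (list_fan ps G v) (ps ! i) =
      insert v ({ps ! j |j. Suc j = i} \<union> {ps ! Suc i |_ :: unit. Suc i < length ps})" if i: "i < length ps"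
  proof (intro equalityI subsetI)
    fix b assume "b \<in> nbrs (list_fan ps G v) (ps ! i)"
    then have "b = v \<or> (\<exists>j. Suc j < length ps \<and> (ps ! i = ps ! j \<and> b = ps ! Suc j \<or> b = ps ! j \<and> ps ! i = ps ! Suc j))"
      using old[OF nth[OF i]] vps nth[OF i] unfolding nbrs_def mem_Collect_eq edges_list_fan[OF ps] by metis
    then show "b \<in> insert v ({ps ! j |j. Suc j = i} \<union> {ps ! Suc i |_ :: unit. Suc i < length ps})"
      using nth_eq_iff_index_eq[OF ps i] by (auto dest: Suc_lessD)
  next
    fix b assume "b \<in> insert v ({ps ! j |j. Suc j = i} \<union> {ps ! Suc i |_ :: unit. Suc i < length ps})"
    then consider "b = v" | j where "b = ps ! j" "Suc j = i" | "b = ps ! Suc i" "Suc i < length ps" by blast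
    then show "b \<in> nbrs (list_fan ps G v) (ps ! i)"
      unfolding nbrs_def mem_Collect_eq edges_list_fan[OF ps] using i nth[OF i] by cases blast+
  qed
qed

text \<open>The path is read off vertex by vertex: apart from the centre and its predecessor, a path
  vertex has only its successor as a neighbour. Removing the path then gives back the graph.\<close>

lemma list_fan_inject:
  assumes ps: "distinct ps" "distinct qs" "length ps = length qs" "ps \<noteq> []" "ps ! 0 = qs ! 0"
    and G: "simple_graph G" "v \<in> verts G" "set ps \<inter> verts G = {}"
    and H: "simple_graph H" "v \<in> verts H" "set qs \<inter> verts H = {}"
    and eq: "list_fan ps G v = list_fan qs H v"
  shows "ps = qs" "G = H"
proof -
  have "ps ! i = qs ! i" if "i < length ps" for i
    using that
  proof (induction i rule: less_induct)
    case (less i)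
    show ?case
    proof (cases i)
      case 0
      then show ?thesis using ps(5) by simp
    next
      case (Suc j)
      have j: "j < length ps" "ps ! j = qs ! j" using less Suc by auto
      have "ps ! i \<in> nbrs (list_fan ps G v) (ps ! j)"
        unfolding nbrs_list_fan(3)[OF ps(1) G j(1)] using less.prems Suc by blast
      also have "nbrs (list_fan ps G v) (ps ! j) = nbrs (list_fan qs H v) (qs ! j)" unfolding eq j(2) ..
      finally have "ps ! i \<in> insert v ({qs ! l |l. Suc l = j} \<union> {qs ! Suc j |_ :: unit. Suc j < length qs})"
        using nbrs_list_fan(3)[OF ps(2) H, of j] j(1) ps(3) by simp
      moreover have "ps ! i \<noteq> v" using G(2,3) less.prems by (metis disjoint_iff nth_mem)
      moreover have "ps ! i \<noteq> qs ! l" if "Suc l = j" for l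
      proof -
        have "qs ! l = ps ! l" using less.IH[of l] that Suc less.prems by simp
        then show ?thesis using ps(1) less.prems that Suc by (simp add: nth_eq_iff_index_eq)
      qed
      ultimately show ?thesis using Suc by blast
    qed
  qed
  then show pq: "ps = qs" using ps(3) by (simp add: nth_equalityI)
  have V: "verts F = verts (list_fan ps F v) - set ps" and E: "edges F = {e \<in> edges (list_fan ps F v). e \<inter> set ps = {}}"
    if F: "simple_graph F" "set ps \<inter> verts F = {}" for F
  proof -
    show "verts F = verts (list_fan ps F v) - set ps" using F(2) by (auto simp: list_fan_def)
    have "e \<inter> set ps \<noteq> {}" if "e \<in> fan_edges (set ps) r v" for e r using that by (auto simp: fan_edges_def consecutive_def)
    moreover have "e \<inter> set ps = {}" if "e \<in> edges F" for e using F that by (auto simp: simple_graph_def)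
    ultimately show "edges F = {e \<in> edges (list_fan ps F v). e \<inter> set ps = {}}" by (auto simp: list_fan_def)
  qed
  have "verts G = verts H" "edges G = edges H"
    using V[OF G(1,3)] V[of H] E[OF G(1,3)] E[of H] H eq pq by metis+
  then show "G = H" by (simp add: prod_eq_iff)
qed

text \<open>A list of new labels, a graph of low degree on the other labels and a centre are mapped
  to the extended graph. Path vertices have degree at most 3, so for \<open>k \<ge> 4\<close> the
  centre is the only vertex of degree at least \<open>k\<close>. It has at most \<open>2 * k\<close>
  neighbours, and the choice of the first path vertex among them is the factor lost.\<close>

lemma card_low_degree_le:
  assumes D: "iso_closed D" "\<And>G. G \<in> D \<Longrightarrow> simple_graph G" and fan: "fan_closed D" and k: "k \<ge> 4"
  shows "card {G \<in> on_verts D {1..n}. \<forall>v\<in>verts G. card (nbrs G v) < k} * n * fact (n + k) \<le>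
    2 * k * card (on_verts D {1..n + k}) * fact n"
proof -
  let ?U = "{1..n + k}"
  define Bd where "Bd = {G \<in> D. \<forall>v\<in>verts G. card (nbrs G v) < k}"
  define L where "L = {ps. length ps = k \<and> distinct ps \<and> set ps \<subseteq> ?U}"
  define X where "X = (SIGMA ps:L. on_verts Bd (?U - set ps) \<times> (?U - set ps))"
  \<comment> \<open>The first path vertex is recorded because the centre alone does not tell where
    among its neighbours the path starts.\<close>
  define F where "F = (\<lambda>(ps, G, v). (list_fan ps G v, ps ! 0))"
  define T where "T = {H \<in> on_verts D ?U. \<exists>v. card (nbrs H v) \<le> 2 * k \<and> (\<forall>w. k \<le> card (nbrs H w) \<longrightarrow> w = v)}"
  define W where "W H = {p. \<exists>v. k \<le> card (nbrs H v) \<and> p \<in> nbrs H v}" for H :: "nat graph"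
  have simB: "simple_graph G" if "G \<in> Bd" for G using that D(2) by (simp add: Bd_def)
  have finL: "finite L" unfolding L_def by (rule finite_subset[OF _ finite_lists_length_eq[of ?U k]]) auto
  have cS: "card (?U - set ps) = n" "finite (?U - set ps)" if "ps \<in> L" for ps
  proof -
    have "card (set ps) = k" "set ps \<subseteq> ?U" using that by (auto simp: L_def distinct_card)
    then show "card (?U - set ps) = n" by (simp add: card_Diff_subset)
  qed simp
  have cB: "card (on_verts Bd (?U - set ps)) = card (on_verts Bd {1..n})" if "ps \<in> L" for ps
    by (rule card_on_verts_eq[OF iso_closed_bounded_nbrs[OF D, of k, folded Bd_def] simB]) (use cS[OF that] in auto)
  \<comment> \<open>The number of lists is the quotient of the two factorials in the
    statement.\<close>
  have "fact (n + k) = (fact n :: nat) * card L"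
  proof -
    have "card L = \<Prod>{card ?U - k + 1..card ?U}" unfolding L_def by (rule card_lists_distinct_length_eq) auto
    then have "card L = \<Prod>{Suc n..n + k}" by simp
    then show ?thesis using fact_eq_fact_times[of n "n + k"] by simp
  qed
  moreover have "card X = card L * (card (on_verts Bd {1..n}) * n)"
  proof -
    have "card X = (\<Sum>ps\<in>L. card (on_verts Bd (?U - set ps) \<times> (?U - set ps)))"
      unfolding X_def using finL finite_on_verts[OF simB] by (intro card_SigmaI) auto
    also have "\<dots> = (\<Sum>ps\<in>L. card (on_verts Bd {1..n}) * n)"
      by (rule sum.cong[OF HOL.refl]) (simp only: card_cartesian_product cB cS(1))
    finally show ?thesis by simp
  qed
  moreover have "card X \<le> 2 * k * card (on_verts D ?U)"
  proof -
    have x: "length ps = k" "distinct ps" "set ps \<subseteq> ?U" "G \<in> D" "simple_graph G" "v \<in> verts G" "set ps \<inter> verts G = {}"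
        "verts G \<union> set ps = ?U" "\<And>w. w \<in> verts G \<Longrightarrow> card (nbrs G w) < k" if "(ps, G, v) \<in> X" for ps G v
      using that D(2) by (auto simp: X_def L_def on_verts_def Bd_def)
    have degs: "k \<le> card (nbrs (list_fan ps G v) v)" "card (nbrs (list_fan ps G v) v) \<le> 2 * k"
        "\<And>w. k \<le> card (nbrs (list_fan ps G v) w) \<Longrightarrow> w = v" "ps ! 0 \<in> nbrs (list_fan ps G v) v" if "(ps, G, v) \<in> X" for ps G v
    proof -
      note x = x[OF that]
      note N = nbrs_list_fan[OF x(2,5,6,7)]
      have cps: "card (set ps) = k" using x(1,2) by (simp add: distinct_card)
      show "k \<le> card (nbrs (list_fan ps G v) v)" unfolding N(1)
        using card_mono[of "nbrs G v \<union> set ps" "set ps"] finite_nbrs[OF x(5)] cps by simp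
      show "card (nbrs (list_fan ps G v) v) \<le> 2 * k" unfolding N(1)
        using card_Un_le[of "nbrs G v" "set ps"] cps x(9)[OF x(6)] by simp
      show "ps ! 0 \<in> nbrs (list_fan ps G v) v" unfolding N(1) using x(1) k by simp
      fix w assume w: "k \<le> card (nbrs (list_fan ps G v) w)"
      show "w = v"
      proof (rule ccontr)
        assume wv: "w \<noteq> v"
        consider "w \<in> verts G" | i where "i < length ps" "w = ps ! i" | "w \<notin> verts G" "w \<notin> set ps" by (metis in_set_conv_nth)
        then show False
        proof cases
          case 1
          then show False using w N(2)[OF 1 wv] x(9)[OF 1] by simp
        next
          case 2
          have "nbrs (list_fan ps G v) w \<subseteq> {v, ps ! (i - 1), ps ! Suc i}" unfolding 2(2) N(3)[OF 2(1)] by auto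
          then have "card (nbrs (list_fan ps G v) w) \<le> card {v, ps ! (i - 1), ps ! Suc i}" by (intro card_mono) auto
          also have "\<dots> \<le> 3" by (simp add: card_insert_if)
          finally show False using w k by simp
        next
          case 3
          have "nbrs (list_fan ps G v) w = {}"
          proof -
            have "{w, b} \<notin> edges (list_fan ps G v)" for b
              unfolding edges_list_fan[OF x(2)] using 3 wv edge_ends[OF x(5), of w b] nth_mem[of _ ps] by (metis Suc_lessD)
            then show ?thesis by (simp add: nbrs_def)
          qed
          then show False using w k by simp
        qed
      qed
    qed
    have fanD: "list_fan ps G v \<in> on_verts D ?U" if "(ps, G, v) \<in> X" for ps G v
    proof -
      note x = x[OF that]
      have "list_fan ps G v \<in> D" unfolding list_fan_def
        using fan x(4,6,7) inj_list_rank[OF x(2)] by (auto simp: fan_closed_def)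
      then show ?thesis using x(8) by (simp add: on_verts_def list_fan_def)
    qed
    have inj: "inj_on F X"
    proof (rule inj_onI)
      fix a b assume ab: "a \<in> X" "b \<in> X" "F a = F b"
      obtain ps G v where a: "a = (ps, G, v)" by (metis prod.collapse)
      obtain qs H w where b: "b = (qs, H, w)" by (metis prod.collapse)
      note xa = x[OF ab(1)[unfolded a]] and xb = x[OF ab(2)[unfolded b]]
      have e: "list_fan ps G v = list_fan qs H w" "ps ! 0 = qs ! 0" using ab(3) by (auto simp: F_def a b)
      have vw: "v = w" using degs(1)[OF ab(1)[unfolded a]] degs(3)[OF ab(2)[unfolded b], of v] e(1) by simp
      have "ps \<noteq> []" using xa(1) k by auto
      from list_fan_inject[OF xa(2) xb(2) _ this e(2) xa(5-7) xb(5) xb(6)[folded vw] xb(7) e(1)[folded vw]]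
      show "a = b" using xa(1) xb(1) vw a b by simp
    qed
    have img: "F ` X \<subseteq> (SIGMA H:T. W H)"
    proof
      fix y assume "y \<in> F ` X"
      then obtain ps G v where g: "(ps, G, v) \<in> X" "y = (list_fan ps G v, ps ! 0)" by (auto simp: F_def)
      have "list_fan ps G v \<in> T" unfolding T_def using fanD[OF g(1)] degs(2,3)[OF g(1)] by blast
      moreover have "ps ! 0 \<in> W (list_fan ps G v)" unfolding W_def using degs(1,4)[OF g(1)] by blast
      ultimately show "y \<in> (SIGMA H:T. W H)" using g(2) by blast
    qed
    have finT: "finite (on_verts D ?U)" using finite_on_verts[OF D(2)] by auto
    have finT': "finite T" using finT by (simp add: T_def)
    have W: "finite (W H)" "card (W H) \<le> 2 * k" if H: "H \<in> T" for H
    proof -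
      obtain v where v: "card (nbrs H v) \<le> 2 * k" "\<And>w. k \<le> card (nbrs H w) \<Longrightarrow> w = v" using H by (auto simp: T_def)
      have "simple_graph H" using H D(2) by (auto simp: T_def on_verts_def)
      then have fin: "finite (nbrs H v)" by (rule finite_nbrs)
      have sub: "W H \<subseteq> nbrs H v" using v(2) by (auto simp: W_def)
      show "finite (W H)" "card (W H) \<le> 2 * k" using finite_subset[OF sub fin] card_mono[OF fin sub] v(1) by auto
    qed
    have "card X \<le> card (SIGMA H:T. W H)" by (rule card_inj_on_le[OF inj img finite_SigmaI[OF finT' W(1)]])
    also have "\<dots> = (\<Sum>H\<in>T. card (W H))" using finT' W(1) by (intro card_SigmaI) auto
    also have "\<dots> \<le> (\<Sum>H\<in>T. 2 * k)" by (rule sum_mono) (rule W(2))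
    also have "\<dots> \<le> 2 * k * card (on_verts D ?U)" using card_mono[OF finT, of T] by (simp add: T_def)
    finally show ?thesis .
  qed
  moreover have "{G \<in> on_verts D {1..n}. \<forall>v\<in>verts G. card (nbrs G v) < k} = on_verts Bd {1..n}"
    by (auto simp: on_verts_def Bd_def)
  ultimately show ?thesis
  proof -
    assume a: "fact (n + k) = fact n * card L" "card X = card L * (card (on_verts Bd {1..n}) * n)"
      "card X \<le> 2 * k * card (on_verts D ?U)"
      "{G \<in> on_verts D {1..n}. \<forall>v\<in>verts G. card (nbrs G v) < k} = on_verts Bd {1..n}"
    have "card (on_verts Bd {1..n}) * n * fact (n + k) = card X * fact n" unfolding a(1,2) by (simp add: algebra_simps)
    also have "\<dots> \<le> 2 * k * card (on_verts D ?U) * fact n" using a(3) by simp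
    finally show ?thesis unfolding a(4) .
  qed
qed

lemma growth_iterated:
  assumes step: "\<And>n. n \<ge> 3 \<Longrightarrow> N (Suc n) \<le> K * Suc n * N n" and n: "n \<ge> 3"
  shows "N (n + k) * fact n \<le> K ^ k * fact (n + k) * (N n :: nat)"
proof (induction k)
  case (Suc k)
  have "N (n + Suc k) * fact n \<le> K * Suc (n + k) * (N (n + k) * fact n)"
    using mult_le_mono1[OF step[of "n + k"], of "fact n"] n by (simp add: algebra_simps)
  also have "\<dots> \<le> K * Suc (n + k) * (K ^ k * fact (n + k) * N n)" using Suc by (rule mult_le_mono2)
  also have "\<dots> = K ^ Suc k * fact (n + Suc k) * N n" by (simp add: algebra_simps)
  finally show ?case .
qed simp

text \<open>Makes the uniform distribution on the class meaningful: a fan attached to a single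
  vertex has any prescribed order.\<close>

lemma on_verts_nonempty:
  assumes D: "minor_closed D" "iso_closed D" "fan_closed D" "D \<noteq> {}" and n: "n \<ge> 1"
  shows "on_verts D {1..n} \<noteq> {}"
proof -
  obtain G where "G \<in> D" using D(4) by blast
  then have "({1}, {}) \<in> D" by (rule single_vertex_graph[OF D(1,2)])
  then have "(verts ({1::nat}, {}) \<union> {2..n}, edges ({1::nat}, {}) \<union> fan_edges {2..n} id 1) \<in> D"
    using D(3) unfolding fan_closed_def by (elim ballE[of _ _ "({1}, {})"] ballE[of _ _ 1] allE[of _ "{2..n}"] allE[of _ id]) auto
  moreover have "{1} \<union> {2..n} = {1..n}" using n by auto
  ultimately show ?thesis by (auto simp: on_verts_def)
qed

text \<open>The number of extended graphs is compared with \<open>k\<close> steps of growth. The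
  factorials from the lists and from the growth cancel exactly, which leaves the power of
  \<open>K\<close>.\<close>

lemma low_degree_fraction:
  assumes D: "minor_closed D" "iso_closed D" "fan_closed D" "D \<noteq> {}" and G: "simple_graph G" "G \<notin> D"
  obtains K :: nat where "K \<ge> 1" "\<And>n k. n \<ge> 3 \<Longrightarrow> k \<ge> 4 \<Longrightarrow>
     card {G \<in> on_verts D {1..n}. \<forall>v\<in>verts G. card (nbrs G v) < k} * n \<le> 2 * k * K ^ k * card (on_verts D {1..n})"
proof -
  obtain K :: nat where K: "K \<ge> 1"
    "\<And>n. n \<ge> 3 \<Longrightarrow> card (on_verts D {1..Suc n}) \<le> K * Suc n * card (on_verts D {1..n})"
    using minor_closed_growth[OF D(1,2) G] by blast
  have "card {G \<in> on_verts D {1..n}. \<forall>v\<in>verts G. card (nbrs G v) < k} * n \<le> 2 * k * K ^ k * card (on_verts D {1..n})"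
    if n: "n \<ge> 3" and k: "k \<ge> 4" for n k
  proof -
    let ?b = "card {G \<in> on_verts D {1..n}. \<forall>v\<in>verts G. card (nbrs G v) < k}"
    have "?b * n * fact (n + k) \<le> 2 * k * (card (on_verts D {1..n + k}) * fact n)"
      using card_low_degree_le[OF D(2) minor_closedD(1)[OF D(1)] D(3) k, of n] by (simp add: mult.assoc)
    also have "\<dots> \<le> 2 * k * (K ^ k * fact (n + k) * card (on_verts D {1..n}))"
      using growth_iterated[of "\<lambda>n. card (on_verts D {1..n})", OF K(2) n] by (rule mult_le_mono2)
    also have "\<dots> = 2 * k * K ^ k * card (on_verts D {1..n}) * fact (n + k)" by (simp add: algebra_simps)
    finally show ?thesis by (simp add: mult_le_cancel2)
  qed
  then show thesis using that K(1) by blast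
qed

section \<open>The sphere\<close>

lemma group_rank_trivial:
  assumes "trivial_group G"
  shows "group_rank G = 0"
proof -
  have G: "group G" "carrier G = {\<one>\<^bsub>G\<^esub>}" using assms by (auto simp: trivial_group_def)
  have "{r. mon (free_Abelian_group {..<r}) G \<noteq> {}} = {0 :: nat}"
  proof (intro equalityI subsetI)
    fix r :: nat assume "r \<in> {r. mon (free_Abelian_group {..<r}) G \<noteq> {}}"
    then obtain h where h: "h \<in> hom (free_Abelian_group {..<r}) G" "inj_on h (carrier (free_Abelian_group {..<r}))"
      by (auto simp: mon_def)
    show "r \<in> {0}"
    proof (rule ccontr)
      assume "r \<notin> {0}"
      then have c: "frag_of 0 \<in> carrier (free_Abelian_group {..<r})" "0 \<in> carrier (free_Abelian_group {..<r})" by auto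
      then have "h (frag_of 0) \<in> carrier G" "h 0 \<in> carrier G" using h(1) unfolding hom_def Pi_iff by blast+
      then have "h (frag_of 0) = h 0" unfolding G(2) by simp
      then have "frag_of (0::nat) = 0" using inj_onD[OF h(2)] c by blast
      then show False by simp
    qed
  next
    fix r :: nat assume "r \<in> {0}"
    then have "(\<lambda>_. \<one>\<^bsub>G\<^esub>) \<in> mon (free_Abelian_group {..<r}) G"
      using G by (auto simp: mon_def hom_def inj_on_def group.is_monoid monoid.one_closed monoid.l_one)
    then show "r \<in> {r. mon (free_Abelian_group {..<r}) G \<noteq> {}}" by blast
  qed
  then show ?thesis by (simp add: group_rank_def)
qed

text \<open>Two independent elements with images \<open>a\<close> and \<open>b\<close> in the
  integers are impossible: \<open>b\<close> times the first minus \<open>a\<close> times the second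
  is in the kernel.\<close>

lemma group_rank_integer:
  assumes "G \<cong> integer_group" "group G"
  shows "group_rank G = 1"
proof -
  obtain j where j: "j \<in> iso G integer_group" using assms(1) by (auto simp: is_iso_def)
  have "integer_group \<cong> G" using group.iso_sym[OF assms(2,1)] .
  then obtain k where k: "k \<in> iso integer_group G" by (auto simp: is_iso_def)
  have "{r. mon (free_Abelian_group {..<r}) G \<noteq> {}} = {0, 1 :: nat}"
  proof (intro equalityI subsetI)
    fix r :: nat assume "r \<in> {r. mon (free_Abelian_group {..<r}) G \<noteq> {}}"
    then obtain h where h: "h \<in> hom (free_Abelian_group {..<r}) G" "inj_on h (carrier (free_Abelian_group {..<r}))"
      by (auto simp: mon_def)
    let ?F = "free_Abelian_group {..<r}"
    define \<phi> where "\<phi> = j \<circ> h"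
    have jh: "j \<in> hom G integer_group" "inj_on j (carrier G)" using j by (auto simp: iso_def bij_betw_def)
    have \<phi>: "\<phi> \<in> hom ?F integer_group" unfolding \<phi>_def using hom_compose[OF h(1) jh(1)] .
    have "h ` carrier ?F \<subseteq> carrier G" using h(1) by (auto simp: hom_def)
    then have inj: "inj_on \<phi> (carrier ?F)" unfolding \<phi>_def using h(2) jh(2) by (meson comp_inj_on inj_on_subset)
    interpret \<phi>: group_hom ?F integer_group \<phi>
      using \<phi> by (simp add: group_hom_def group_hom_axioms_def)
    show "r \<in> {0, 1}"
    proof (rule ccontr)
      assume "r \<notin> {0, 1}"
      then have c: "frag_of 0 \<in> carrier ?F" "frag_of 1 \<in> carrier ?F" by auto
      define a where "a = \<phi> (frag_of 0)"
      define b where "b = \<phi> (frag_of 1)"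
      have pw: "\<phi> (frag_cmul n x) = n * \<phi> x" if "x \<in> carrier ?F" for n x
        using \<phi>.hom_int_pow[OF that, of n] that by (simp add: int_pow_free_Abelian_group)
      have "frag_cmul b (frag_of 0) \<in> carrier ?F" "frag_cmul (- a) (frag_of 1) \<in> carrier ?F"
        using c by (auto simp: keys_cmul[THEN subsetD] intro: order_trans[OF keys_cmul])
      then have "\<phi> (frag_cmul b (frag_of 0) + frag_cmul (- a) (frag_of 1)) =
          \<phi> (frag_cmul b (frag_of 0)) + \<phi> (frag_cmul (- a) (frag_of 1))"
        using \<phi>.hom_mult[of "frag_cmul b (frag_of 0)" "frag_cmul (- a) (frag_of 1)"] by simp
      also have "\<dots> = \<phi> 0" using pw[OF c(1)] pw[OF c(2)] \<phi>.hom_one by (simp add: a_def b_def)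
      finally have "frag_cmul b (frag_of 0) + frag_cmul (- a) (frag_of 1) = (0 :: nat \<Rightarrow>\<^sub>0 int)"
        using \<open>frag_cmul b (frag_of 0) \<in> carrier ?F\<close> \<open>frag_cmul (- a) (frag_of 1) \<in> carrier ?F\<close>
          group.is_monoid[OF group_free_Abelian_group[of "{..<r}"]]
        by (intro inj_onD[OF inj]) (auto dest: keys_add[THEN subsetD])
      then have "poly_mapping.lookup (frag_cmul b (frag_of 0) + frag_cmul (- a) (frag_of (1::nat))) 1 = 0" by simp
      then have "a = 0" by (simp add: lookup_add lookup_one when_def)
      then have "\<phi> (frag_of 0) = \<phi> 0" using \<phi>.hom_one by (simp add: a_def)
      then have "frag_of (0::nat) = 0" by (intro inj_onD[OF inj]) (use c in auto)
      then show False by simp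
    qed
  next
    fix r :: nat assume r: "r \<in> {0, 1}"
    \<comment> \<open>One formula serves both ranks: for rank 1 the coefficient of the only
      generator determines the element, and for rank 0 the free group is trivial.\<close>
    let ?h = "\<lambda>x. k (poly_mapping.lookup x (0::nat))"
    have kh: "k \<in> hom integer_group G" "inj_on k UNIV" using k by (auto simp: iso_def bij_betw_def)
    have "?h \<in> mon (free_Abelian_group {..<r}) G"
      unfolding mon_def
    proof (intro CollectI conjI)
      show "?h \<in> hom (free_Abelian_group {..<r}) G" using kh(1) by (auto simp: hom_def lookup_add)
      show "inj_on ?h (carrier (free_Abelian_group {..<r}))"
      proof (rule inj_onI)
        fix x y assume xy: "x \<in> carrier (free_Abelian_group {..<r})" "y \<in> carrier (free_Abelian_group {..<r})" "?h x = ?h y"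
        have l0: "poly_mapping.lookup x 0 = poly_mapping.lookup y 0" using xy(3) kh(2) by (simp add: inj_eq)
        have "poly_mapping.lookup x i = poly_mapping.lookup y i" for i
        proof (cases "i = 0")
          case False
          then have "i \<notin> Poly_Mapping.keys x" "i \<notin> Poly_Mapping.keys y" using xy(1,2) r by auto
          then show ?thesis by (simp add: in_keys_iff)
        qed (use l0 in simp)
        then show "x = y" by (rule poly_mapping_eqI)
      qed
    qed
    then show "r \<in> {r. mon (free_Abelian_group {..<r}) G \<noteq> {}}" by blast
  qed
  then show ?thesis by (simp add: group_rank_def)
qed

lemma nsphere_2_homeomorphic_sphere:
  obtains f :: "(nat \<Rightarrow> real) \<Rightarrow> real^3" and g where "homeomorphic_maps (nsphere 2) (top_of_set (sphere 0 1)) f g"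
proof -
  obtain f :: "(nat \<Rightarrow> real) \<Rightarrow> real^3" and g where "homeomorphic_maps (nsphere (3 - 1)) (top_of_set (sphere 0 1 \<inter> span Basis)) f g"
    by (rule homeomorphic_maps_nsphere_euclidean_sphere[of "Basis :: (real^3) set" 3])
      (auto simp: independent_Basis orthogonal_Basis)
  then show thesis using that by simp
qed

text \<open>Stereographic projection, after a transfer to the unit sphere of three-dimensional
  space.\<close>

lemma punctured_nsphere_2:
  assumes b: "b \<in> topspace (nsphere 2)"
  shows "subtopology (nsphere 2) (topspace (nsphere 2) - {b}) homeomorphic_space Euclidean_space 2"
proof -
  obtain f :: "(nat \<Rightarrow> real) \<Rightarrow> real^3" and g where fg: "homeomorphic_maps (nsphere 2) (top_of_set (sphere 0 1)) f g"
    using nsphere_2_homeomorphic_sphere .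
  have hm: "homeomorphic_map (nsphere 2) (top_of_set (sphere 0 1)) f" using fg homeomorphic_maps_map by blast
  have im: "f ` topspace (nsphere 2) = sphere 0 1" using homeomorphic_imp_surjective_map[OF hm] by simp
  have inj: "inj_on f (topspace (nsphere 2))" using homeomorphic_imp_injective_map[OF hm] .
  have fb: "f b \<in> sphere 0 1" using im b by blast
  have e: "f ` (topspace (nsphere 2) \<inter> (topspace (nsphere 2) - {b})) = topspace (top_of_set (sphere 0 1)) \<inter> (sphere 0 1 - {f b})"
    using im inj b by (auto simp: inj_on_def)
  have "homeomorphic_maps (subtopology (nsphere 2) (topspace (nsphere 2) - {b}))
      (subtopology (top_of_set (sphere 0 1)) (sphere 0 1 - {f b})) f g"
    by (rule homeomorphic_maps_subtopologies[OF fg e])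
  then have 1: "subtopology (nsphere 2) (topspace (nsphere 2) - {b}) homeomorphic_space top_of_set (sphere 0 1 - {f b})"
    by (auto simp: homeomorphic_space_def subtopology_subtopology Int_absorb1)
  let ?T = "{x :: real^3. axis 1 1 \<bullet> x = 0}"
  have "axis 1 1 \<noteq> (0 :: real^3)" by (simp add: axis_eq_0_iff)
  then have "(sphere 0 1 - {f b}) homeomorphic ?T" "dim ?T = 2"
    using homeomorphic_punctured_sphere_hyperplane[of 1 "f b" 0 "axis 1 1" 0] fb dim_hyperplane[of "axis 1 1 :: real^3"] by auto
  then have "top_of_set (sphere 0 1 - {f b}) homeomorphic_space Euclidean_space 2"
    using homeomorphic_subspace_Euclidean_space[OF subspace_hyperplane, of "axis 1 1 :: real^3" 2]
      homeomorphic_space_iff_homeomorphic homeomorphic_space_trans by blast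
  then show ?thesis using 1 homeomorphic_space_trans by blast
qed

lemma nsphere_2_other_point: "\<exists>b\<in>topspace (nsphere 2). b \<noteq> x"
proof -
  let ?e = "\<lambda>n::nat. if n = 0 then 1 else 0 :: real"
  have e: "?e \<in> topspace (nsphere 2)" by (rule in_topspace_nsphere)
  have "(\<lambda>i. if i = 0 then - ?e i else ?e i) \<in> topspace (nsphere 2)"
    using subsetD[OF continuous_map_image_subset_topspace[OF continuous_map_nsphere_reflection[of 2 0]] imageI[OF e]] .
  moreover have "(\<lambda>i. if i = 0 then - ?e i else ?e i) \<noteq> ?e" by (auto simp: fun_eq_iff)
  ultimately show ?thesis using e by (cases "?e = x") blast+
qed

lemma nsphere_2_path_connected: "path_connected_space (nsphere 2)"
proof -
  obtain f :: "(nat \<Rightarrow> real) \<Rightarrow> real^3" and g where fg: "homeomorphic_maps (nsphere 2) (top_of_set (sphere 0 1)) f g"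
    using nsphere_2_homeomorphic_sphere .
  have "path_connected (sphere (0::real^3) 1)" by (rule path_connected_sphere) simp
  then have "path_connected_space (top_of_set (sphere (0::real^3) 1))"
    unfolding path_connectedin_euclidean[symmetric] path_connectedin_def by simp
  moreover have "nsphere 2 homeomorphic_space top_of_set (sphere (0::real^3) 1)" using fg by (auto simp: homeomorphic_space_def)
  ultimately show ?thesis using homeomorphic_path_connected_space by blast
qed

text \<open>The sphere is the surface that puts one-vertex graphs into the classes, even where
  \<open>g\<close> vanishes. The chart at a point is the complement of some other point.\<close>

lemma surface_nsphere_2: "surface (nsphere 2)"
proof -
  obtain f :: "(nat \<Rightarrow> real) \<Rightarrow> real^3" and g where fg: "homeomorphic_maps (nsphere 2) (top_of_set (sphere 0 1)) f g"
    using nsphere_2_homeomorphic_sphere .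
  then have hs: "nsphere 2 homeomorphic_space top_of_set (sphere (0::real^3) 1)" by (auto simp: homeomorphic_space_def)
  have "compact_space (top_of_set (sphere (0::real^3) 1))" by (simp add: compact_space_subtopology)
  then have "compact_space (nsphere 2)" using homeomorphic_compact_space[OF hs] by simp
  moreover have "Hausdorff_space (top_of_set (sphere (0::real^3) 1))"
    by (simp add: Hausdorff_space_subtopology)
  then have "Hausdorff_space (nsphere 2)" using homeomorphic_Hausdorff_space[OF hs] by simp
  moreover have "connected_space (nsphere 2)"
    using nsphere_2_path_connected path_connected_imp_connected_space by blast
  moreover have "topspace (nsphere 2) \<noteq> {}" using in_topspace_nsphere by blast
  moreover have "\<exists>U. openin (nsphere 2) U \<and> x \<in> U \<and> subtopology (nsphere 2) U homeomorphic_space Euclidean_space 2"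
    if "x \<in> topspace (nsphere 2)" for x
  proof -
    obtain b where b: "b \<in> topspace (nsphere 2)" "b \<noteq> x" using nsphere_2_other_point by blast
    have "openin (nsphere 2) (topspace (nsphere 2) - {b})"
      using open_in_Hausdorff_delete[OF \<open>Hausdorff_space (nsphere 2)\<close> openin_topspace] .
    moreover have "x \<in> topspace (nsphere 2) - {b}" using b(2) that by simp
    ultimately show ?thesis using punctured_nsphere_2[OF b(1)] by blast
  qed
  ultimately show ?thesis unfolding surface_def by blast
qed

lemma homology_nsphere_2:
  "homology_group 0 (nsphere 2) \<cong> integer_group"
  "trivial_group (homology_group 1 (nsphere 2))"
  "homology_group 2 (nsphere 2) \<cong> integer_group"
proof -
  show "homology_group 0 (nsphere 2) \<cong> integer_group"
    using isomorphic_integer_zeroth_homology_group[OF nsphere_2_path_connected] in_topspace_nsphere by blast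
  show "trivial_group (homology_group 1 (nsphere 2))"
    using reduced_homology_group_nsphere(2)[of 1 2] un_reduced_homology_group[of 1 "nsphere 2"] by simp
  show "homology_group 2 (nsphere 2) \<cong> integer_group"
    using reduced_homology_group_nsphere(1)[of 2] un_reduced_homology_group[of 2 "nsphere 2"] by simp
qed

lemma euler_genus_nsphere_2: "euler_genus (nsphere 2) = 0"
proof -
  have "betti 0 (nsphere 2) = 1" "betti 1 (nsphere 2) = 0" "betti 2 (nsphere 2) = 1"
    using group_rank_integer[OF homology_nsphere_2(1)] group_rank_trivial[OF homology_nsphere_2(2)]
      group_rank_integer[OF homology_nsphere_2(3)] by (simp_all add: betti_def)
  then have "euler_characteristic (nsphere 2) = 2"
    by (simp add: euler_characteristic_def numeral_2_eq_2)
  then show ?thesis by (simp add: euler_genus_def)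
qed

text \<open>A generator of the second homology group restricts to a generator at every point,
  because the punctured sphere is contractible. The whole sphere then serves as the neighbourhood
  \<open>U\<close> of each point.\<close>

lemma orientable_nsphere_2: "orientable (nsphere 2)"
proof -
  let ?X = "nsphere 2" and ?S = "topspace (nsphere 2)"
  let ?G = "reduced_homology_group 2 ?X"
  have G: "?G = homology_group 2 ?X" by (rule un_reduced_homology_group) simp
  have "cyclic_group ?G" using cyclic_reduced_homology_group_nsphere .
  then obtain c where c: "c \<in> carrier ?G" "carrier ?G = carrier (subgroup_generated ?G {c})"
    using group.cyclic_group[OF group_reduced_homology_group[of 2 ?X]] unfolding cyclic_group_def by metis
  have "carrier ?G \<inter> {c} = {c}" using c(1) by blast
  then have gen: "generate ?G {c} = carrier ?G"
    using carrier_subgroup_generated[of ?G "{c}"] c(2)[symmetric] by argo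
  define \<mu> where "\<mu> x = hom_induced 2 ?X {} ?X (?S - {x}) id c" for x
  have "orientation ?X \<mu>"
    unfolding orientation_def
  proof (intro conjI ballI)
    fix x assume x: "x \<in> ?S"
    let ?H = "relative_homology_group 2 ?X (?S - {x})"
    have "contractible_space (subtopology ?X (?S - {x}))"
      using homeomorphic_space_contractibility[OF punctured_nsphere_2[OF x]] contractible_Euclidean_space by blast
    moreover have "?S \<inter> (?S - {x}) \<noteq> {}" using nsphere_2_other_point[of x] by blast
    ultimately have iso: "hom_induced 2 ?X {} ?X (?S - {x}) id \<in> iso ?G ?H"
      by (rule iso_reduced_homology_by_contractible)
    then interpret h: group_hom ?G ?H "hom_induced 2 ?X {} ?X (?S - {x}) id"
      by (simp add: group_hom_def group_hom_axioms_def iso_def)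
    have im: "hom_induced 2 ?X {} ?X (?S - {x}) id ` carrier ?G = carrier ?H" using iso by (auto simp: iso_def bij_betw_def)
    show "\<mu> x \<in> carrier ?H" unfolding \<mu>_def using c(1) im by blast
    show "generate ?H {\<mu> x} = carrier ?H"
      using h.generate_img[of "{c}"] c(1) gen im by (simp add: \<mu>_def)
  next
    fix x assume x: "x \<in> ?S"
    have "c \<in> carrier (relative_homology_group 2 ?X (?S - ?S))" using c(1) G by simp
    moreover have "\<forall>y\<in>?S. \<mu> y = hom_induced 2 ?X (?S - ?S) ?X (?S - {y}) id c" by (simp add: \<mu>_def)
    ultimately show "\<exists>U. openin ?X U \<and> x \<in> U \<and> (\<exists>\<alpha>\<in>carrier (relative_homology_group 2 ?X (?S - U)).
        \<forall>y\<in>U. \<mu> y = hom_induced 2 ?X (?S - U) ?X (?S - {y}) id \<alpha>)"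
      using x openin_topspace by blast
  qed
  then show ?thesis by (auto simp: orientable_def)
qed

section \<open>Graph classes of bounded genus\<close>

text \<open>What the counting needs to know about a genus class. All conditions pass to
  intersections, which settles the fourth choice of \<open>\<A>\<close>.\<close>

definition good_class :: "nat graph set \<Rightarrow> bool" where
  "good_class \<A> \<longleftrightarrow> (\<forall>G\<in>\<A>. simple_graph G) \<and> iso_closed \<A> \<and> fan_closed \<A> \<and>
     (\<forall>G\<in>\<A>. \<forall>F\<subseteq>edges G. (verts G, F) \<in> \<A>) \<and> (\<forall>x. ({x}, {}) \<in> \<A>)"

lemma embeds_in_relabel:
  assumes G: "simple_graph G" and E: "embeds_in G X" and f: "inj_on f (verts G)"
  shows "embeds_in (relabel f G) X"
proof -
  obtain \<phi> \<gamma> where E: "graph_embedding G X \<phi> \<gamma>" using E by (auto simp: embeds_in_def)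
  define h where "h = the_inv_into (verts G) f"
  have hf: "h (f x) = x" if "x \<in> verts G" for x using the_inv_into_f_f[OF f that] by (simp add: h_def)
  have eV: "e \<subseteq> verts G" if "e \<in> edges G" for e using G that by (auto simp: simple_graph_def)
  have hfe: "h ` f ` e = e" if "e \<in> edges G" for e
  proof -
    have "h ` f ` e = (\<lambda>x. x) ` e" unfolding image_image by (rule image_cong[OF HOL.refl]) (use hf eV[OF that] in auto)
    then show ?thesis by simp
  qed
  have V: "(\<phi> \<circ> h) ` f ` verts G = \<phi> ` verts G"
    unfolding image_image o_def by (rule image_cong[OF HOL.refl]) (simp add: hf)
  have "graph_embedding (relabel f G) X (\<phi> \<circ> h) (\<lambda>e. \<gamma> (h ` e))"
    unfolding graph_embedding_def relabel_def fst_conv snd_conv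
  proof (intro conjI ballI impI)
    show "(\<phi> \<circ> h) ` f ` verts G \<subseteq> topspace X" unfolding V using E by (simp add: graph_embedding_def)
    show "inj_on (\<phi> \<circ> h) (f ` verts G)" using E hf by (auto simp: graph_embedding_def inj_on_def)
    fix e' assume "e' \<in> (`) f ` edges G"
    then obtain e where e: "e \<in> edges G" "e' = f ` e" by blast
    have he: "h ` e' = e" using hfe[OF e(1)] e(2) by simp
    show "pathin X (\<gamma> (h ` e'))" "inj_on (\<gamma> (h ` e')) {0..1}" "\<gamma> (h ` e') ` {0<..<1} \<inter> (\<phi> \<circ> h) ` f ` verts G = {}"
      unfolding he V using E e(1) by (auto simp: graph_embedding_def)
    have "{\<gamma> e 0, \<gamma> e 1} = \<phi> ` e" using E e(1) by (simp add: graph_embedding_def)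
    then show "{\<gamma> (h ` e') 0, \<gamma> (h ` e') 1} = (\<phi> \<circ> h) ` e'" unfolding image_comp[symmetric] he .
    fix d' assume "d' \<in> (`) f ` edges G" and ne: "e' \<noteq> d'"
    then obtain d where d: "d \<in> edges G" "d' = f ` d" by blast
    have hd: "h ` d' = d" using hfe[OF d(1)] d(2) by simp
    have "e \<noteq> d" using ne e d by blast
    then show "\<gamma> (h ` e') ` {0<..<1} \<inter> \<gamma> (h ` d') ` {0<..<1} = {}"
      unfolding he hd using E e(1) d(1) by (simp add: graph_embedding_def)
  qed
  then show ?thesis by (auto simp: embeds_in_def)
qed

lemma genus_classI:
  assumes "simple_graph G" "surface X" "P X" "euler_genus X \<le> int (g (card (verts G)))" "embeds_in G X"
  shows "G \<in> genus_class P g"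
  using assms unfolding genus_class_def by blast

text \<open>The fan is drawn on the same surface, and a larger order can only raise the permitted
  genus. The sphere must satisfy \<open>P\<close> in order to carry the one-vertex graphs.\<close>

lemma good_class_genus_class:
  assumes g: "mono_on {1..} g" and P: "P (nsphere 2)"
  shows "good_class (genus_class P g)"
  unfolding good_class_def
proof (intro conjI ballI allI impI)
  show "simple_graph G" if "G \<in> genus_class P g" for G using that by (simp add: genus_class_def)
  show "iso_closed (genus_class P g)"
    unfolding iso_closed_def
  proof (intro ballI allI impI)
    fix G and f :: "nat \<Rightarrow> nat" assume G: "G \<in> genus_class P g" and f: "inj_on f (verts G)"
    obtain X where X: "simple_graph G" "surface X" "P X" "euler_genus X \<le> int (g (card (verts G)))" "embeds_in G X"
      using G by (auto simp: genus_class_def)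
    have "card (verts (relabel f G)) = card (verts G)" using f by (simp add: relabel_def card_image)
    then show "relabel f G \<in> genus_class P g"
      using genus_classI[of "relabel f G" X P g, OF simple_relabel[OF X(1) f] X(2,3) _ embeds_in_relabel[OF X(1,5) f]] X(4) by simp
  qed
  show "fan_closed (genus_class P g)"
    unfolding fan_closed_def
  proof (intro ballI allI impI)
    fix G v Q and r :: "nat \<Rightarrow> nat"
    assume G: "G \<in> genus_class P g" and v: "v \<in> verts G" and Q: "finite Q" "inj_on r Q" "Q \<inter> verts G = {}"
    let ?H = "(verts G \<union> Q, edges G \<union> fan_edges Q r v)"
    obtain X where X: "simple_graph G" "surface X" "P X" "euler_genus X \<le> int (g (card (verts G)))" "embeds_in G X"
      using G by (auto simp: genus_class_def)
    have fin: "finite (verts G)" "verts G \<noteq> {}" using X(1) by (auto simp: simple_graph_def)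
    have "e \<subseteq> verts G \<union> Q \<and> card e = 2" if "e \<in> fan_edges Q r v" for e
    proof -
      have "v \<notin> Q" using v Q(3) by blast
      then show ?thesis using that v by (auto simp: fan_edges_def consecutive_def card_insert_if)
    qed
    moreover have "e \<subseteq> verts G \<union> Q \<and> card e = 2" if "e \<in> edges G" for e
      using X(1) that by (auto simp: simple_graph_def)
    ultimately have sH: "simple_graph ?H" unfolding simple_graph_def using fin Q(1) by simp blast
    have "card (verts G) \<le> card (verts G \<union> Q)" using fin Q(1) by (intro card_mono) auto
    \<comment> \<open>\<open>g\<close> is known to be monotone from 1 on, and vertex sets are
      nonempty.\<close>
    moreover have "1 \<le> card (verts G)" using fin by (simp add: Suc_le_eq card_gt_0_iff)
    ultimately have "g (card (verts G)) \<le> g (card (verts G \<union> Q))" using g by (auto simp: mono_on_def)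
    then have "euler_genus X \<le> int (g (card (verts ?H)))" using X(4) by simp
    then show "?H \<in> genus_class P g" using genus_classI[of ?H X P g, OF sH X(2,3)] embeds_in_fan[OF X(2,1,5) v Q] by blast
  qed
  show "(verts G, F) \<in> genus_class P g" if G: "G \<in> genus_class P g" and F: "F \<subseteq> edges G" for G F
  proof -
    obtain X where X: "simple_graph G" "surface X" "P X" "euler_genus X \<le> int (g (card (verts G)))" "embeds_in G X"
      using G by (auto simp: genus_class_def)
    have "simple_graph (verts G, F)" using X(1) F by (auto simp: simple_graph_def)
    moreover obtain \<phi> \<gamma> where "graph_embedding G X \<phi> \<gamma>" using X(5) by (auto simp: embeds_in_def)
    then have "graph_embedding (verts G, F) X \<phi> \<gamma>" using F unfolding graph_embedding_def by (simp add: subset_iff)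
    ultimately show ?thesis using genus_classI[of "(verts G, F)" X P g] X(2-4) by (auto simp: embeds_in_def)
  qed
  show "({x}, {}) \<in> genus_class P g" for x
  proof (rule genus_classI[of _ "nsphere 2"])
    show "simple_graph ({x}, {})" by (simp add: simple_graph_def)
    show "euler_genus (nsphere 2) \<le> int (g (card (verts ({x}, {}))))" by (simp add: euler_genus_nsphere_2)
    obtain p where "p \<in> topspace (nsphere 2)" using in_topspace_nsphere by blast
    then have "graph_embedding ({x}, {}) (nsphere 2) (\<lambda>_. p) (\<lambda>_ _. p)" by (simp add: graph_embedding_def)
    then show "embeds_in ({x}, {}) (nsphere 2)" by (auto simp: embeds_in_def)
  qed (use surface_nsphere_2 P in auto)
qed

lemma good_class_Int:
  assumes A: "good_class A" and B: "good_class B"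
  shows "good_class (A \<inter> B)"
proof -
  have "iso_closed A" "iso_closed B" "fan_closed A" "fan_closed B" using A B by (simp_all add: good_class_def)
  then have "iso_closed (A \<inter> B)" "fan_closed (A \<inter> B)" by (simp_all add: iso_closed_def fan_closed_def)
  then show ?thesis using A B unfolding good_class_def by blast
qed

lemma good_class_cases:
  assumes "mono_on {1..} g" "\<A> \<in> {E_class g, OE_class g, NE_class g, OE_class g \<inter> NE_class g}"
  shows "good_class \<A>"
proof -
  have "good_class (E_class g)" unfolding E_class_def by (rule good_class_genus_class[OF assms(1)]) simp
  moreover have OE: "good_class (OE_class g)" unfolding OE_class_def
    by (rule good_class_genus_class[OF assms(1)]) (rule orientable_nsphere_2)
  moreover have NE: "good_class (NE_class g)" unfolding NE_class_def
    by (rule good_class_genus_class[OF assms(1)]) (simp add: homeomorphic_space_refl)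
  ultimately show ?thesis using assms(2) good_class_Int[OF OE NE] by blast
qed

lemma relabel_delete_vertex:
  assumes G: "simple_graph G" and f: "inj_on f (verts G)" and v: "v \<in> verts G"
  shows "delete_vertex (f v) (relabel f G) = relabel f (delete_vertex v G)"
proof -
  have "f v \<in> f ` e \<longleftrightarrow> v \<in> e" if "e \<in> edges G" for e
  proof -
    have "e \<subseteq> verts G" using G that by (auto simp: simple_graph_def)
    then show ?thesis using f v by (meson inj_on_image_mem_iff)
  qed
  moreover have "f ` verts G - {f v} = f ` (verts G - {v})" using f v by (auto simp: inj_on_def)
  ultimately show ?thesis by (auto simp: delete_vertex_def relabel_def)
qed

lemma relabel_delete_edge:
  assumes G: "simple_graph G" and f: "inj_on f (verts G)" and e: "e \<in> edges G"
  shows "delete_edge (f ` e) (relabel f G) = relabel f (delete_edge e G)"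
proof -
  have "f ` d = f ` e \<longleftrightarrow> d = e" if "d \<in> edges G" for d
  proof -
    have "d \<subseteq> verts G" "e \<subseteq> verts G" using G that e by (auto simp: simple_graph_def)
    then show ?thesis using f by (meson inj_on_image_eq_iff)
  qed
  then show ?thesis using e by (auto simp: delete_edge_def relabel_def)
qed

lemma relabel_contract_edge:
  assumes G: "simple_graph G" and f: "inj_on f (verts G)" and uv: "{u, v} \<in> edges G"
  shows "contract_edge (f u) (f v) (relabel f G) = relabel f (contract_edge u v G)"
proof -
  note ends = edge_ends[OF G uv]
  let ?c = "\<lambda>x. if x = v then u else x" and ?d = "\<lambda>x. if x = f v then f u else x"
  have comm: "?d ` f ` e = f ` ?c ` e" and cardeq: "card (f ` ?c ` e) = card (?c ` e)" if "e \<in> edges G" for e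
  proof -
    have e: "e \<subseteq> verts G" using G that by (auto simp: simple_graph_def)
    have "?d (f x) = f (?c x)" if "x \<in> e" for x
    proof -
      have "f x = f v \<longleftrightarrow> x = v" using f e that ends(3) by (auto simp: inj_on_def)
      then show ?thesis by simp
    qed
    then show "?d ` f ` e = f ` ?c ` e" unfolding image_image by (rule image_cong[OF HOL.refl])
    have "?c ` e \<subseteq> verts G" using e ends(2) by auto
    then show "card (f ` ?c ` e) = card (?c ` e)" using f by (meson card_image inj_on_subset)
  qed
  have "{e \<in> (`) ?d ` (`) f ` edges G. card e = 2} = (`) f ` {e \<in> (`) ?c ` edges G. card e = 2}"
  proof (intro equalityI subsetI)
    fix y assume "y \<in> {e \<in> (`) ?d ` (`) f ` edges G. card e = 2}"
    then obtain e where e: "e \<in> edges G" "y = ?d ` f ` e" "card y = 2" by blast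
    have "y = f ` ?c ` e" "card (?c ` e) = 2" using comm[OF e(1)] cardeq[OF e(1)] e(2,3) by simp_all
    moreover have "?c ` e \<in> (`) ?c ` edges G" using e(1) by (rule imageI)
    ultimately show "y \<in> (`) f ` {e \<in> (`) ?c ` edges G. card e = 2}" by blast
  next
    fix y assume "y \<in> (`) f ` {e \<in> (`) ?c ` edges G. card e = 2}"
    then obtain e where e: "e \<in> edges G" "y = f ` ?c ` e" "card (?c ` e) = 2" by blast
    have "y = ?d ` f ` e" "card y = 2" using comm[OF e(1)] cardeq[OF e(1)] e(2,3) by simp_all
    moreover have "?d ` f ` e \<in> (`) ?d ` (`) f ` edges G" using e(1) by (intro imageI)
    ultimately show "y \<in> {e \<in> (`) ?d ` (`) f ` edges G. card e = 2}" by simp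
  qed
  moreover have "f ` verts G - {f v} = f ` (verts G - {v})" using f ends(3) by (auto simp: inj_on_def)
  ultimately show ?thesis unfolding contract_edge_def relabel_def fst_conv snd_conv by simp
qed

text \<open>Each minor of a renamed graph is a renamed minor of the graph, by induction along the
  operations that produce it.\<close>

lemma iso_closed_Minor:
  assumes "iso_closed \<A>"
  shows "iso_closed (Minor \<A>)"
  unfolding iso_closed_def
proof (intro ballI allI impI)
  fix G and f :: "nat \<Rightarrow> nat" assume G: "G \<in> Minor \<A>" and f: "inj_on f (verts G)"
  have sG: "simple_graph G" using G by (simp add: Minor_def)
  have key: "\<exists>H. minor H G \<and> verts H \<subseteq> verts G \<and> K = relabel f H" if "minor K (relabel f G)" for K
    using that
  proof (induction K "relabel f G" rule: minor.induct)
    case refl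
    show ?case using minor.refl by blast
  next
    case (delete_vertex K v)
    then obtain H where H: "minor H G" "verts H \<subseteq> verts G" "K = relabel f H" by blast
    have fH: "inj_on f (verts H)" using f H(2) inj_on_subset by blast
    obtain u where u: "u \<in> verts H" "v = f u" using delete_vertex(3) H(3) by (auto simp: relabel_def)
    have "verts H \<noteq> {u}" using delete_vertex(4) u H(3) by (auto simp: relabel_def)
    then have "minor (delete_vertex u H) G" using minor.delete_vertex[OF H(1) u(1)] by blast
    moreover have "verts (delete_vertex u H) \<subseteq> verts G" using H(2) by (auto simp: delete_vertex_def)
    moreover have "delete_vertex v K = relabel f (delete_vertex u H)"
      using relabel_delete_vertex[OF minor_simple[OF H(1) sG] fH u(1)] u(2) H(3) by simp
    ultimately show ?case by blast
  next
    case (delete_edge K e)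
    then obtain H where H: "minor H G" "verts H \<subseteq> verts G" "K = relabel f H" by blast
    have fH: "inj_on f (verts H)" using f H(2) inj_on_subset by blast
    obtain d where d: "d \<in> edges H" "e = f ` d" using delete_edge(3) H(3) by (auto simp: relabel_def)
    have "minor (delete_edge d H) G" using minor.delete_edge[OF H(1) d(1)] .
    moreover have "verts (delete_edge d H) \<subseteq> verts G" using H(2) by (auto simp: delete_edge_def)
    moreover have "delete_edge e K = relabel f (delete_edge d H)"
      using relabel_delete_edge[OF minor_simple[OF H(1) sG] fH d(1)] d(2) H(3) by simp
    ultimately show ?case by blast
  next
    case (contract_edge K u v)
    then obtain H where H: "minor H G" "verts H \<subseteq> verts G" "K = relabel f H" by blast
    have sH: "simple_graph H" using minor_simple[OF H(1) sG] .
    have fH: "inj_on f (verts H)" using f H(2) inj_on_subset by blast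
    obtain e where e: "e \<in> edges H" "{u, v} = f ` e" using contract_edge(3) H(3) by (auto simp: relabel_def)
    obtain a b where ab: "e = {a, b}" "a \<noteq> b" "a \<in> verts H" "b \<in> verts H" using edgeE[OF sH e(1)] .
    have "{u, v} = {f a, f b}" using e(2) ab(1) by simp
    \<comment> \<open>The edge may be hit in either direction, but contraction keeps the first end,
      so \<open>p\<close> and \<open>q\<close> are named to match \<open>u\<close> and
      \<open>v\<close>.\<close>
    then consider "u = f a" "v = f b" | "u = f b" "v = f a" by (auto simp: doubleton_eq_iff)
    then obtain p q where pq: "e = {p, q}" "p \<noteq> q" "u = f p" "v = f q"
      by cases (use ab in \<open>auto simp: insert_commute\<close>)
    have peq: "{p, q} \<in> edges H" using e(1) pq(1) by simp
    have "minor (contract_edge p q H) G" using minor.contract_edge[OF H(1) peq pq(2)] .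
    moreover have "verts (contract_edge p q H) \<subseteq> verts G" using H(2) by (auto simp: contract_edge_def)
    moreover have "contract_edge u v K = relabel f (contract_edge p q H)"
      using relabel_contract_edge[OF sH fH peq] pq(3,4) H(3) by simp
    ultimately show ?case by blast
  qed
  have "K \<in> \<A>" if K: "minor K (relabel f G)" for K
  proof -
    obtain H where H: "minor H G" "verts H \<subseteq> verts G" "K = relabel f H" using key[OF K] by blast
    have "H \<in> \<A>" using G H(1) unfolding Minor_def by blast
    moreover have "inj_on f (verts H)" using f H(2) inj_on_subset by blast
    ultimately show ?thesis using assms H(3) by (auto simp: iso_closed_def)
  qed
  then show "relabel f G \<in> Minor \<A>" using simple_relabel[OF sG f] by (simp add: Minor_def)
qed

lemma Minor_properties:
  assumes A: "good_class \<A>"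
  shows "minor_closed (Minor \<A>)" "iso_closed (Minor \<A>)" "fan_closed (Minor \<A>)" "Minor \<A> \<noteq> {}" "Minor \<A> \<subseteq> \<A>"
proof -
  have A': "iso_closed \<A>" "fan_closed \<A>" "\<And>G. G \<in> \<A> \<Longrightarrow> simple_graph G"
    "\<And>G F. G \<in> \<A> \<Longrightarrow> F \<subseteq> edges G \<Longrightarrow> (verts G, F) \<in> \<A>" "\<And>x. ({x}, {}) \<in> \<A>" using A by (auto simp: good_class_def)
  show "minor_closed (Minor \<A>)" by (rule minor_closed_Minor)
  show iso: "iso_closed (Minor \<A>)" by (rule iso_closed_Minor[OF A'(1)])
  show "fan_closed (Minor \<A>)"
    unfolding fan_closed_def
    by (intro ballI allI impI Minor_fan_closed[OF A'(1,3) iso _ A'(4)]) (use A'(2) in \<open>auto simp: fan_closed_def\<close>)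
  show "Minor \<A> \<subseteq> \<A>" using minor.refl by (auto simp: Minor_def)
  have "H = ({0}, {})" if "minor H ({0}, {})" for H :: "nat graph"
    using that by (induction H "({0 :: nat}, {} :: nat set set)" rule: minor.induct) auto
  then have "({0}, {}) \<in> Minor \<A>" using A'(5) by (auto simp: Minor_def simple_graph_def)
  then show "Minor \<A> \<noteq> {}" by blast
qed

section \<open>Bounded differences and the maximum degree of a uniformly random graph\<close>

lemma sum_Pow_insert:
  assumes "finite E" "a \<notin> E"
  shows "sum f (Pow (insert a E)) = (\<Sum>X\<in>Pow E. f X + f (insert a X))"
proof -
  have "inj_on (insert a) (Pow E)" 
  proof (rule inj_onI)
    fix X Y assume XY: "X \<in> Pow E" "Y \<in> Pow E" "insert a X = insert a Y"
    then have "a \<notin> X" "a \<notin> Y" using assms(2) by auto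
    then show "X = Y" using XY(3) by (simp add: insert_ident)
  qed
  then have "sum f (insert a ` Pow E) = (\<Sum>X\<in>Pow E. f (insert a X))" by (simp add: sum.reindex o_def)
  moreover have "Pow E \<inter> insert a ` Pow E = {}" using assms(2) by blast
  ultimately show ?thesis using assms(1) by (simp add: Pow_insert sum.union_disjoint sum.distrib)
qed

text \<open>Hoeffding's lemma for the uniform distribution on the two points \<open>u\<close> and
  \<open>w\<close>.\<close>

lemma exp_add_exp_le: "exp u + exp w \<le> 2 * exp ((u + w) / 2 + (w - u)\<^sup>2 / 8)" for u w :: real
proof -
  have *: "exp u + exp w \<le> 2 * exp ((u + w) / 2 + (w - u)\<^sup>2 / 8)" if "u \<le> w" for u w :: real
  proof -
    have "- (w - u) * (1 / 2) + ln (1 + 1 / 2 * (exp (w - u) - 1)) \<le> (w - u)\<^sup>2 / 8"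
      by (rule Hoeffdings_lemma_aux) (use that in auto)
    then have "ln (1 + 1 / 2 * (exp (w - u) - 1)) \<le> (w - u) / 2 + (w - u)\<^sup>2 / 8" by (simp add: field_simps)
    moreover have pos: "0 < 1 + 1 / 2 * (exp (w - u) - 1 :: real)" by (simp add: add_pos_pos field_simps)
    ultimately have "1 + 1 / 2 * (exp (w - u) - 1) \<le> exp ((w - u) / 2 + (w - u)\<^sup>2 / 8)"
      by (metis exp_le_cancel_iff exp_ln)
    then have "exp u * (2 * (1 + 1 / 2 * (exp (w - u) - 1))) \<le> exp u * (2 * exp ((w - u) / 2 + (w - u)\<^sup>2 / 8))"
      by (intro mult_left_mono) auto
    also have "\<dots> = 2 * exp (u + ((w - u) / 2 + (w - u)\<^sup>2 / 8))" by (simp only: exp_add mult_ac)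
    also have "u + ((w - u) / 2 + (w - u)\<^sup>2 / 8) = (u + w) / 2 + (w - u)\<^sup>2 / 8" by (simp add: field_simps)
    also have "exp u * (2 * (1 + 1 / 2 * (exp (w - u) - 1))) = exp u + exp w"
      using exp_add[of u "w - u"] by (simp add: algebra_simps)
    finally show ?thesis .
  qed
  show ?thesis
    using *[of u w] *[of w u] by (cases "u \<le> w") (simp_all add: add.commute power2_commute)
qed

text \<open>McDiarmid's inequality by averaging over one element at a time: the conditional mean
  \<open>h\<close> has the same bounded differences, and the two-point inequality costs the summand
  \<open>(c a)\<^sup>2 / 8\<close> in the exponent.\<close>

lemma bounded_differences_mgf:
  fixes f :: "'a set \<Rightarrow> real"
  assumes "finite E" and "\<And>e X. e \<in> E \<Longrightarrow> X \<subseteq> E - {e} \<Longrightarrow> \<bar>f (insert e X) - f X\<bar> \<le> c e"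
  shows "(\<Sum>X\<in>Pow E. exp (f X)) \<le> 2 ^ card E * exp ((\<Sum>X\<in>Pow E. f X) / 2 ^ card E + (\<Sum>e\<in>E. (c e)\<^sup>2) / 8)"
  using assms
proof (induction E arbitrary: f)
  case (insert a E)
  define h where "h X = (f X + f (insert a X)) / 2" for X
  have le: "exp (f X) + exp (f (insert a X)) \<le> 2 * exp ((c a)\<^sup>2 / 8) * exp (h X)" if X: "X \<in> Pow E" for X
  proof -
    have "\<bar>f (insert a X) - f X\<bar> \<le> c a" using insert.prems[of a X] X insert.hyps by blast
    then have "(f (insert a X) - f X)\<^sup>2 \<le> (c a)\<^sup>2" using power_mono[of "\<bar>f (insert a X) - f X\<bar>" "c a" 2] by simp
    then have "2 * exp (h X + (f (insert a X) - f X)\<^sup>2 / 8) \<le> 2 * exp (h X + (c a)\<^sup>2 / 8)" by simp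
    then have "exp (f X) + exp (f (insert a X)) \<le> 2 * exp (h X + (c a)\<^sup>2 / 8)"
      using exp_add_exp_le[of "f X" "f (insert a X)"] unfolding h_def by linarith
    then show ?thesis by (simp add: exp_add mult_ac)
  qed
  have diff: "\<bar>h (insert e X) - h X\<bar> \<le> c e" if "e \<in> E" "X \<subseteq> E - {e}" for e X
  proof -
    have "\<bar>f (insert e X) - f X\<bar> \<le> c e" using insert.prems[of e X] that by blast
    moreover have "\<bar>f (insert e (insert a X)) - f (insert a X)\<bar> \<le> c e"
      using insert.prems[of e "insert a X"] that insert.hyps by blast
    moreover have "insert a (insert e X) = insert e (insert a X)" by blast
    ultimately show ?thesis by (simp add: h_def abs_le_iff field_simps)
  qed
  have mean: "(\<Sum>X\<in>Pow E. h X) / 2 ^ card E = (\<Sum>X\<in>Pow (insert a E). f X) / 2 ^ card (insert a E)"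
    using insert.hyps by (simp add: sum_Pow_insert h_def flip: sum_divide_distrib)
  have "(\<Sum>X\<in>Pow (insert a E). exp (f X)) \<le> (\<Sum>X\<in>Pow E. 2 * exp ((c a)\<^sup>2 / 8) * exp (h X))"
    unfolding sum_Pow_insert[OF insert.hyps] by (intro sum_mono le)
  also have "\<dots> = 2 * exp ((c a)\<^sup>2 / 8) * (\<Sum>X\<in>Pow E. exp (h X))" by (simp add: sum_distrib_left)
  also have "\<dots> \<le> 2 * exp ((c a)\<^sup>2 / 8) * (2 ^ card E * exp ((\<Sum>X\<in>Pow E. h X) / 2 ^ card E + (\<Sum>e\<in>E. (c e)\<^sup>2) / 8))"
    by (intro mult_left_mono insert.IH diff) auto
  also have "\<dots> = 2 ^ card (insert a E) * exp ((\<Sum>X\<in>Pow (insert a E). f X) / 2 ^ card (insert a E) + (\<Sum>e\<in>insert a E. (c e)\<^sup>2) / 8)"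
    unfolding mean using insert.hyps by (simp add: exp_add add_divide_distrib)
  finally show ?case .
qed simp

lemma bounded_differences_tail:
  fixes f :: "'a set \<Rightarrow> real"
  assumes E: "finite E" and diff: "\<And>e X. e \<in> E \<Longrightarrow> X \<subseteq> E - {e} \<Longrightarrow> \<bar>f (insert e X) - f X\<bar> \<le> c e"
    and V: "(\<Sum>e\<in>E. (c e)\<^sup>2) \<le> V" "V > 0" and s: "s \<ge> 0"
    and T: "\<And>X. X \<in> T \<Longrightarrow> X \<subseteq> E" "\<And>X. X \<in> T \<Longrightarrow> (\<Sum>X\<in>Pow E. f X) / 2 ^ card E + s \<le> f X"
  shows "real (card T) \<le> 2 ^ card E * exp (- (2 * s\<^sup>2 / V))"
proof -
  \<comment> \<open>The minimiser of \<open>t\<^sup>2 * V / 8 - t * s\<close>, the exponent that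
    Markov's inequality produces.\<close>
  define t where "t = 4 * s / V"
  define m where "m = (\<Sum>X\<in>Pow E. f X) / 2 ^ card E"
  have t: "t \<ge> 0" using s V by (simp add: t_def)
  have "\<bar>t * f (insert e X) - t * f X\<bar> \<le> t * c e" if "e \<in> E" "X \<subseteq> E - {e}" for e X
    using mult_left_mono[OF diff[OF that] t] t by (simp add: abs_mult flip: right_diff_distrib)
  from bounded_differences_mgf[OF E, of "\<lambda>X. t * f X" "\<lambda>e. t * c e", OF this]
  have "(\<Sum>X\<in>Pow E. exp (t * f X)) \<le> 2 ^ card E * exp (t * m + (\<Sum>e\<in>E. t\<^sup>2 * (c e)\<^sup>2) / 8)"
    by (simp add: m_def power_mult_distrib flip: sum_distrib_left)
  also have "\<dots> \<le> 2 ^ card E * exp (t * m + t\<^sup>2 * V / 8)"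
    using mult_left_mono[OF V(1), of "t\<^sup>2"] by (simp add: sum_distrib_left)
  finally have up: "(\<Sum>X\<in>Pow E. exp (t * f X)) \<le> 2 ^ card E * exp (t * m + t\<^sup>2 * V / 8)" .
  have "real (card T) * exp (t * (m + s)) = (\<Sum>X\<in>T. exp (t * (m + s)))" by simp
  also have "\<dots> \<le> (\<Sum>X\<in>T. exp (t * f X))" using T(2) t by (intro sum_mono) (simp add: m_def mult_left_mono)
  also have "\<dots> \<le> (\<Sum>X\<in>Pow E. exp (t * f X))" using E T(1) by (intro sum_mono2) auto
  also note up
  finally have "real (card T) \<le> 2 ^ card E * exp (t * m + t\<^sup>2 * V / 8) / exp (t * (m + s))" by (simp add: field_simps)
  also have "\<dots> = 2 ^ card E * exp (t * m + t\<^sup>2 * V / 8 - t * (m + s))" by (simp add: exp_diff)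
  also have "t * m + t\<^sup>2 * V / 8 - t * (m + s) = - (2 * s\<^sup>2 / V)"
    using V(2) by (simp add: t_def field_simps power2_eq_square)
  finally show ?thesis .
qed

text \<open>For a uniformly random subset \<open>F\<close> of \<open>E\<close> this is a sum of
  independent signs, one for each element of \<open>E \<inter> B\<close>: 1 if it is chosen and -1
  if not.\<close>

definition excess :: "'a set \<Rightarrow> 'a set \<Rightarrow> 'a set \<Rightarrow> real" where
  "excess E B F = 2 * real (card (F \<inter> B)) - real (card (E \<inter> B))"

text \<open>A new sign changes a value \<open>s\<close> to \<open>s - 1\<close> or
  \<open>s + 1\<close>; the second and fourth powers of these add up to
  \<open>2 * s\<^sup>2 + 2\<close> and \<open>2 * s ^ 4 + 12 * s\<^sup>2 + 2\<close>.\<close>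

lemma excess_moments:
  assumes "finite E"
  shows "(\<Sum>F\<in>Pow E. excess E B F) = 0 \<and>
    (\<Sum>F\<in>Pow E. (excess E B F)\<^sup>2) = real (card (E \<inter> B)) * 2 ^ card E \<and>
    (\<Sum>F\<in>Pow E. (excess E B F) ^ 4) \<le> 3 * (real (card (E \<inter> B)))\<^sup>2 * 2 ^ card E"
  using assms
proof (induction E)
  case empty
  show ?case by (simp add: excess_def)
next
  case (insert a E)
  let ?m = "real (card (E \<inter> B))" and ?N = "2 ^ card E :: real"
  show ?case
  proof (cases "a \<in> B")
    case True
    have c: "card (insert a E \<inter> B) = Suc (card (E \<inter> B))" using True insert.hyps by simp
    have x: "excess (insert a E) B F = excess E B F - 1" "excess (insert a E) B (insert a F) = excess E B F + 1"
      if "F \<in> Pow E" for F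
    proof -
      have "finite F" "a \<notin> F" using that insert.hyps finite_subset by auto
      then have "card (insert a F \<inter> B) = Suc (card (F \<inter> B))" using True by simp
      then show "excess (insert a E) B F = excess E B F - 1" "excess (insert a E) B (insert a F) = excess E B F + 1"
        by (simp_all add: excess_def c)
    qed
    have 1: "(\<Sum>F\<in>Pow (insert a E). excess (insert a E) B F) = (\<Sum>F\<in>Pow E. 2 * excess E B F)"
      unfolding sum_Pow_insert[OF insert.hyps] by (intro sum.cong) (simp_all add: x)
    have 2: "(\<Sum>F\<in>Pow (insert a E). (excess (insert a E) B F)\<^sup>2) = (\<Sum>F\<in>Pow E. 2 * (excess E B F)\<^sup>2 + 2)"
      unfolding sum_Pow_insert[OF insert.hyps]
      by (intro sum.cong) (simp_all add: x power2_eq_square algebra_simps)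
    have 4: "(\<Sum>F\<in>Pow (insert a E). (excess (insert a E) B F) ^ 4) =
        (\<Sum>F\<in>Pow E. 2 * (excess E B F) ^ 4 + 12 * (excess E B F)\<^sup>2 + 2)"
      unfolding sum_Pow_insert[OF insert.hyps]
      by (intro sum.cong) (simp_all add: x power4_eq_xxxx power2_eq_square algebra_simps)
    have "(\<Sum>F\<in>Pow (insert a E). excess (insert a E) B F) = 0"
      unfolding 1 using insert.IH by (simp flip: sum_distrib_left)
    moreover have "(\<Sum>F\<in>Pow (insert a E). (excess (insert a E) B F)\<^sup>2) = 2 * (?m * ?N) + 2 * ?N"
      unfolding 2 using insert.IH insert.hyps by (simp add: sum.distrib card_Pow flip: sum_distrib_left)
    moreover have "(\<Sum>F\<in>Pow (insert a E). (excess (insert a E) B F) ^ 4) \<le> 2 * (3 * ?m\<^sup>2 * ?N) + 12 * (?m * ?N) + 2 * ?N"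
      unfolding 4 using insert.IH insert.hyps by (simp add: sum.distrib card_Pow mult_ac flip: sum_distrib_left)
    \<comment> \<open>Up to the factor \<open>?N\<close>, the constant 2 on the left is compared
      with 6 on the right; the other terms agree.\<close>
    moreover have "2 * (3 * ?m\<^sup>2 * ?N) + 12 * (?m * ?N) + 2 * ?N \<le> 3 * (?m + 1)\<^sup>2 * (2 * ?N)"
      by (simp add: power2_eq_square algebra_simps)
    ultimately show ?thesis using insert.hyps by (simp add: c algebra_simps)
  next
    case False
    have "insert a E \<inter> B = E \<inter> B" "insert a F \<inter> B = F \<inter> B" for F using False by auto
    then have x: "excess (insert a E) B F = excess E B F" "excess E B (insert a F) = excess E B F" for F
      by (simp_all add: excess_def)
    show ?thesis
      unfolding sum_Pow_insert[OF insert.hyps] x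
      using insert.IH insert.hyps False by (simp add: mult_ac flip: sum_distrib_left)
  qed
qed

text \<open>The fourth moment bounds the first absolute moment from below, by integrating
  \<open>2 u \<ge> 3 u\<^sup>2 - u\<^sup>4\<close> at \<open>u = \<bar>excess\<bar> / \<lambda>\<close> for the optimal scale \<open>\<lambda> = sqrt (3 m)\<close>.\<close>

lemma sum_excess_pos_ge:
  assumes E: "finite E"
  shows "2 ^ card E * sqrt (real (card (E \<inter> B)) / 3) / 2 \<le> (\<Sum>F\<in>Pow E. max (excess E B F) 0)"
proof (cases "card (E \<inter> B) = 0")
  case True
  then show ?thesis by (simp add: sum_nonneg)
next
  case False
  let ?m = "real (card (E \<inter> B))" and ?S = "excess E B" and ?N = "2 ^ card E :: real"
  define l where "l = sqrt (3 * ?m)"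
  have m: "?m > 0" using False by simp
  have l: "l > 0" "l\<^sup>2 = 3 * ?m" using m by (simp_all add: l_def)
  \<comment> \<open>The difference factors with a double zero at 1, so the inequality is sharp where
    the values are close to the scale.\<close>
  have poly: "3 * u\<^sup>2 - u ^ 4 \<le> 2 * u" if "u \<ge> 0" for u :: real
  proof -
    have "0 \<le> u * ((u - 1)\<^sup>2 * (u + 2))" using that by simp
    then show ?thesis by (simp add: power2_eq_square power4_eq_xxxx algebra_simps)
  qed
  have pt: "3 * (?S F)\<^sup>2 / l\<^sup>2 - (?S F) ^ 4 / l ^ 4 \<le> 2 * \<bar>?S F\<bar> / l" for F
  proof -
    have "\<bar>x\<bar> ^ 4 = x ^ 4" for x :: real by simp
    then show ?thesis using poly[of "\<bar>?S F\<bar> / l"] l(1) by (simp add: power_divide)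
  qed
  have l4: "l ^ 4 = 9 * ?m\<^sup>2"
  proof -
    have "l ^ 4 = (l\<^sup>2)\<^sup>2" by simp
    then show ?thesis unfolding l(2) by (simp add: power_mult_distrib)
  qed
  have "3 * (?m * ?N) / l\<^sup>2 - (3 * ?m\<^sup>2 * ?N) / l ^ 4 \<le>
      3 * (\<Sum>F\<in>Pow E. (?S F)\<^sup>2) / l\<^sup>2 - (\<Sum>F\<in>Pow E. (?S F) ^ 4) / l ^ 4"
    using excess_moments[OF E, of B] l(1) by (simp add: divide_right_mono)
  also have "\<dots> = (\<Sum>F\<in>Pow E. 3 * (?S F)\<^sup>2 / l\<^sup>2 - (?S F) ^ 4 / l ^ 4)"
    by (simp add: sum_subtractf sum_distrib_left sum_divide_distrib)
  also have "\<dots> \<le> (\<Sum>F\<in>Pow E. 2 * \<bar>?S F\<bar> / l)" by (intro sum_mono pt)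
  also have "\<dots> = 2 * (\<Sum>F\<in>Pow E. \<bar>?S F\<bar>) / l" by (simp add: sum_distrib_left sum_divide_distrib)
  also have "3 * (?m * ?N) / l\<^sup>2 - (3 * ?m\<^sup>2 * ?N) / l ^ 4 = 2 * ?N / 3"
    unfolding l(2) l4 using m by (simp add: field_simps power2_eq_square)
  finally have "?N * l / 3 \<le> (\<Sum>F\<in>Pow E. \<bar>?S F\<bar>)" using l(1) by (simp add: field_simps)
  \<comment> \<open>The positive part is half of the absolute value plus half of the value, and the
    values sum to 0.\<close>
  moreover have "(\<Sum>F\<in>Pow E. max (?S F) 0) = (\<Sum>F\<in>Pow E. \<bar>?S F\<bar> / 2 + ?S F / 2)"
    by (intro sum.cong) (auto simp: max_def)
  then have "(\<Sum>F\<in>Pow E. max (?S F) 0) = (\<Sum>F\<in>Pow E. \<bar>?S F\<bar>) / 2"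
    using excess_moments[OF E, of B] by (simp add: sum.distrib flip: sum_divide_distrib)
  moreover have "l / 3 = sqrt (?m / 3)"
  proof -
    have "l / 3 = sqrt (3 * ?m) / sqrt (3\<^sup>2)" by (simp add: l_def)
    also have "\<dots> = sqrt (3 * ?m / 3\<^sup>2)" by (rule real_sqrt_divide[symmetric])
    finally show ?thesis by (simp add: power2_eq_square)
  qed
  ultimately show ?thesis by (simp add: field_simps)
qed

section \<open>Degrees in the uniformly random graph\<close>

definition pairs :: "'a set \<Rightarrow> 'a set set" where
  "pairs V = {e. e \<subseteq> V \<and> card e = 2}"

lemma finite_pairs: "finite V \<Longrightarrow> finite (pairs V)"
  by (rule finite_subset[of _ "Pow V"]) (auto simp: pairs_def)

lemma card_pairs_le: "finite V \<Longrightarrow> 2 * card (pairs V) \<le> (card V)\<^sup>2"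
proof -
  assume "finite V"
  then have "card (pairs V) = card V choose 2" unfolding pairs_def by (rule n_subsets)
  moreover have "2 * (k choose 2) \<le> k\<^sup>2" for k :: nat
    unfolding choose_two power2_eq_square
    by (rule order_trans[OF times_div_less_eq_dividend]) simp
  ultimately show ?thesis by simp
qed

lemma card_pairs_at:
  assumes "finite V" "v \<in> V"
  shows "card (pairs V \<inter> {e. v \<in> e}) = card V - 1"
proof -
  have s: "simple_graph (V, pairs V)" using assms by (auto simp: simple_graph_def pairs_def)
  have "nbrs (V, pairs V) v = V - {v}" using assms(2) by (auto simp: nbrs_def pairs_def card_2_iff doubleton_eq_iff)
  then have "degree (V, pairs V) v = card V - 1" using degree_eq_card_nbrs[OF s] assms by simp
  moreover have "pairs V \<inter> {e. v \<in> e} = {e \<in> pairs V. v \<in> e}" by blast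
  ultimately show ?thesis by (simp add: degree_def)
qed

lemma excess_pairs:
  assumes "finite V" "v \<in> V"
  shows "excess (pairs V) {e. v \<in> e} F = 2 * real (degree (V, F) v) - (real (card V) - 1)"
proof -
  have "F \<inter> {e. v \<in> e} = {e \<in> F. v \<in> e}" by blast
  moreover have "card V \<ge> 1" using assms by (auto simp: Suc_le_eq card_gt_0_iff)
  ultimately show ?thesis using card_pairs_at[OF assms] by (simp add: excess_def degree_def of_nat_diff)
qed

lemma excess_insert:
  assumes "finite X" "e \<notin> X"
  shows "excess E B (insert e X) - excess E B X = (if e \<in> B then 2 else 0)"
  using assms by (simp add: excess_def Int_insert_left)

text \<open>Only the edges at \<open>v\<close> influence its degree, each changing the excess by 2.
  The squares sum to at most 4 times the order, which makes the tail exponentially small.\<close>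

lemma card_large_degree_le:
  assumes V: "finite V" "v \<in> V" and \<epsilon>: "\<epsilon> > 0"
  shows "real (card {F \<in> Pow (pairs V). (1 / 2 + \<epsilon>) * real (card V) \<le> real (degree (V, F) v)})
    \<le> 2 ^ card (pairs V) * exp (- (2 * \<epsilon>\<^sup>2 * real (card V)))"
proof -
  let ?E = "pairs V" and ?B = "{e. v \<in> e}" and ?n = "real (card V)"
  let ?c = "\<lambda>e. if e \<in> ?B then 2 else 0 :: real"
  have fE: "finite ?E" using finite_pairs[OF V(1)] .
  have n: "card V \<ge> 1" using V by (auto simp: Suc_le_eq card_gt_0_iff)
  have "(\<Sum>e\<in>?E. (?c e)\<^sup>2) = (\<Sum>e\<in>?E. if e \<in> ?B then 4 else 0)" by (intro sum.cong) auto
  also have "\<dots> = (\<Sum>e\<in>?E \<inter> ?B. 4)" by (rule sum.inter_restrict[OF fE, symmetric])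
  also have "\<dots> \<le> 4 * ?n" using card_pairs_at[OF V] by simp
  finally have c: "(\<Sum>e\<in>?E. (?c e)\<^sup>2) \<le> 4 * ?n" .
  have "real (card {F \<in> Pow ?E. (1 / 2 + \<epsilon>) * ?n \<le> real (degree (V, F) v)})
    \<le> 2 ^ card ?E * exp (- (2 * (2 * \<epsilon> * ?n)\<^sup>2 / (4 * ?n)))"
  proof (rule bounded_differences_tail[OF fE _ c, of "excess ?E ?B"])
    fix e X assume "e \<in> ?E" "X \<subseteq> ?E - {e}"
    then have "finite X" "e \<notin> X" using fE finite_subset by auto
    then show "\<bar>excess ?E ?B (insert e X) - excess ?E ?B X\<bar> \<le> ?c e" using excess_insert[of X e ?E ?B] by simp
  next
    fix F assume "F \<in> {F \<in> Pow ?E. (1 / 2 + \<epsilon>) * ?n \<le> real (degree (V, F) v)}"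
    then have "(1 / 2 + \<epsilon>) * ?n \<le> real (degree (V, F) v)" by simp
    then show "(\<Sum>F\<in>Pow ?E. excess ?E ?B F) / 2 ^ card ?E + 2 * \<epsilon> * ?n \<le> excess ?E ?B F"
      using excess_moments[OF fE, of ?B] by (simp add: excess_pairs[OF V] algebra_simps)
  qed (use n \<epsilon> in auto)
  also have "2 * (2 * \<epsilon> * ?n)\<^sup>2 / (4 * ?n) = 2 * \<epsilon>\<^sup>2 * ?n" using n by (simp add: field_simps power2_eq_square)
  finally show ?thesis .
qed

text \<open>If all degrees are at most half the order, then the sum of the positive parts of the
  excesses is at most \<open>n\<close>, whereas its mean has order \<open>n powr (3 / 2)\<close>.\<close>

lemma card_small_degrees_le:
  assumes V: "finite V" "V \<noteq> {}" and n: "1 + sqrt (real (card V)) / 8 \<le> sqrt ((real (card V) - 1) / 3) / 2"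
  shows "real (card {F \<in> Pow (pairs V). \<forall>v\<in>V. real (degree (V, F) v) \<le> real (card V) / 2})
    \<le> 2 ^ card (pairs V) * exp (- (real (card V) / 256))"
proof -
  let ?E = "pairs V" and ?n = "real (card V)" and ?x = "\<lambda>v. excess (pairs V) {e. v \<in> e}"
  define f where "f F = (\<Sum>v\<in>V. max (?x v F) 0)" for F
  have fE: "finite ?E" using finite_pairs[OF V(1)] .
  have n1: "card V \<ge> 1" using V by (auto simp: Suc_le_eq card_gt_0_iff)
  \<comment> \<open>There are at most \<open>?n\<^sup>2 / 2\<close> pairs. Each changes the excess
    of its two ends by 2, hence \<open>f\<close> by at most 4.\<close>
  have c: "(\<Sum>e\<in>?E. 4\<^sup>2) \<le> 8 * ?n\<^sup>2"
    using card_pairs_le[OF V(1)] by (simp flip: of_nat_power add: of_nat_le_iff[symmetric, where 'a = real])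
  have diff: "\<bar>- f (insert e X) - - f X\<bar> \<le> 4" if eX: "e \<in> ?E" "X \<subseteq> ?E - {e}" for e X
  proof -
    have X: "finite X" "e \<notin> X" using eX fE finite_subset by auto
    have ve: "\<bar>max (?x v (insert e X)) 0 - max (?x v X) 0\<bar> \<le> (if v \<in> e then 2 else 0)" for v
      using excess_insert[OF X, of ?E "{e. v \<in> e}"] by (auto split: if_splits)
    have "\<bar>- f (insert e X) - - f X\<bar> = \<bar>\<Sum>v\<in>V. max (?x v (insert e X)) 0 - max (?x v X) 0\<bar>"
      by (simp add: f_def sum_subtractf abs_minus_commute)
    also have "\<dots> \<le> (\<Sum>v\<in>V. if v \<in> e then 2 else 0)" by (rule order_trans[OF sum_abs sum_mono[OF ve]])
    also have "\<dots> = (\<Sum>v\<in>V \<inter> e. 2)" by (rule sum.inter_restrict[OF V(1), symmetric])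
    also have "V \<inter> e = e" "card e = 2" using eX(1) by (auto simp: pairs_def)
    then have "(\<Sum>v\<in>V \<inter> e. 2) = (4 :: real)" by simp
    finally show ?thesis .
  qed
  \<comment> \<open>The assumption on the order leaves a gap of \<open>?n * sqrt ?n / 8\<close>
    above \<open>?n\<close>; this gap is the deviation used below.\<close>
  have mean: "2 ^ card ?E * (?n + ?n * sqrt ?n / 8) \<le> (\<Sum>F\<in>Pow ?E. f F)"
  proof -
    have "2 ^ card ?E * (1 + sqrt ?n / 8) \<le> (\<Sum>F\<in>Pow ?E. max (?x v F) 0)" if v: "v \<in> V" for v
    proof -
      have "2 ^ card ?E * (1 + sqrt ?n / 8) \<le> 2 ^ card ?E * (sqrt ((?n - 1) / 3) / 2)"
        using n by (intro mult_left_mono) auto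
      also have "\<dots> \<le> (\<Sum>F\<in>Pow ?E. max (?x v F) 0)"
        using sum_excess_pos_ge[OF fE, of "{e. v \<in> e}"] card_pairs_at[OF V(1) v] n1 by (simp add: of_nat_diff)
      finally show ?thesis .
    qed
    then have "(\<Sum>v\<in>V. 2 ^ card ?E * (1 + sqrt ?n / 8)) \<le> (\<Sum>v\<in>V. \<Sum>F\<in>Pow ?E. max (?x v F) 0)" by (rule sum_mono)
    also have "\<dots> = (\<Sum>F\<in>Pow ?E. f F)" unfolding f_def by (rule sum.swap)
    finally show ?thesis by (simp add: algebra_simps)
  qed
  have "real (card {F \<in> Pow ?E. \<forall>v\<in>V. real (degree (V, F) v) \<le> ?n / 2})
    \<le> 2 ^ card ?E * exp (- (2 * (?n * sqrt ?n / 8)\<^sup>2 / (8 * ?n\<^sup>2)))"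
  proof (rule bounded_differences_tail[OF fE _ c, of "\<lambda>F. - f F"])
    fix F assume "F \<in> {F \<in> Pow ?E. \<forall>v\<in>V. real (degree (V, F) v) \<le> ?n / 2}"
    \<comment> \<open>A degree of at most \<open>?n / 2\<close> makes the excess at most
      \<open>?n - (?n - 1) = 1\<close>.\<close>
    then have "max (?x v F) 0 \<le> 1" if "v \<in> V" for v using that excess_pairs[OF V(1) that, of F] by auto
    then have "f F \<le> (\<Sum>v\<in>V. 1)" unfolding f_def by (rule sum_mono)
    moreover have "?n + ?n * sqrt ?n / 8 \<le> (\<Sum>F\<in>Pow ?E. f F) / 2 ^ card ?E"
      using mean by (simp add: field_simps)
    ultimately show "(\<Sum>F\<in>Pow ?E. - f F) / 2 ^ card ?E + ?n * sqrt ?n / 8 \<le> - f F" by (simp add: sum_negf)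
  qed (use diff n1 in auto)
  also have "2 * (?n * sqrt ?n / 8)\<^sup>2 / (8 * ?n\<^sup>2) = ?n / 256"
    using n1 by (simp add: power_mult_distrib power_divide field_simps)
  finally show ?thesis .
qed

lemma simple_graphs_on:
  assumes "finite V" "V \<noteq> {}"
  shows "{G. simple_graph G \<and> verts G = V} = Pair V ` Pow (pairs V)"
proof -
  have "simple_graph (V, F) \<longleftrightarrow> F \<in> Pow (pairs V)" for F
    using assms by (auto simp: simple_graph_def pairs_def)
  then show ?thesis by (auto simp: image_iff)
qed

text \<open>Union bound over the two ways to fail: some vertex has too large a degree, or all
  degrees are at most half the order.\<close>

lemma prob_max_degree_ge:
  assumes V: "finite V" "V \<noteq> {}" and \<epsilon>: "\<epsilon> > 0"
    and n: "1 + sqrt (real (card V)) / 8 \<le> sqrt ((real (card V) - 1) / 3) / 2"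
  shows "measure_pmf.prob (pmf_of_set {G. simple_graph G \<and> verts G = V})
      {G. real (card V) / 2 < real (max_degree G) \<and> real (max_degree G) < (1 / 2 + \<epsilon>) * real (card V)}
    \<ge> 1 - (real (card V) * exp (- (2 * \<epsilon>\<^sup>2 * real (card V))) + exp (- (real (card V) / 256)))"
proof -
  let ?n = "real (card V)" and ?P = "Pow (pairs V)" and ?N = "2 ^ card (pairs V) :: real"
  let ?S = "{G. simple_graph G \<and> verts G = V}"
  let ?A = "{G. ?n / 2 < real (max_degree G) \<and> real (max_degree G) < (1 / 2 + \<epsilon>) * ?n}"
  let ?L = "\<lambda>v. {F \<in> ?P. (1 / 2 + \<epsilon>) * ?n \<le> real (degree (V, F) v)}"
  let ?M = "{F \<in> ?P. \<forall>v\<in>V. real (degree (V, F) v) \<le> ?n / 2}"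
  have fP: "finite ?P" using finite_pairs[OF V(1)] by simp
  have S: "?S = Pair V ` ?P" using simple_graphs_on[OF V] .
  have inj: "inj_on (Pair V) X" for X :: "'a set set set" by (simp add: inj_on_def)
  have cardS: "real (card ?S) = ?N" unfolding S using finite_pairs[OF V(1)] by (simp add: card_image[OF inj] card_Pow)
  have fS: "finite ?S" "?S \<noteq> {}" unfolding S using fP by auto
  have "?S - ?A \<subseteq> Pair V ` (?M \<union> (\<Union>v\<in>V. ?L v))"
  proof
    fix G assume G: "G \<in> ?S - ?A"
    then obtain F where F: "G = (V, F)" "F \<in> ?P" using S by auto
    have fd: "finite (degree G ` V)" "degree G ` V \<noteq> {}" using V by auto
    have md: "max_degree G = Max (degree G ` V)" using F(1) by (simp add: max_degree_def)
    have "F \<in> ?M \<union> (\<Union>v\<in>V. ?L v)"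
    proof (cases "?n / 2 < real (max_degree G)")
      case True
      then have big: "(1 / 2 + \<epsilon>) * ?n \<le> real (max_degree G)" using G by auto
      obtain v where "v \<in> V" "max_degree G = degree G v" using Max_in[OF fd] md by auto
      then show ?thesis using big F by auto
    next
      case False
      have "real (degree G v) \<le> ?n / 2" if "v \<in> V" for v
      proof -
        have "degree G v \<le> max_degree G" unfolding md using fd that by (intro Max_ge) auto
        then show ?thesis using False by linarith
      qed
      then show ?thesis using F by auto
    qed
    then show "G \<in> Pair V ` (?M \<union> (\<Union>v\<in>V. ?L v))" using F(1) by blast
  qed
  then have "card (?S - ?A) \<le> card (Pair V ` (?M \<union> (\<Union>v\<in>V. ?L v)))" using fP V(1) by (intro card_mono) auto
  also have "\<dots> = card (?M \<union> (\<Union>v\<in>V. ?L v))" by (rule card_image[OF inj])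
  also have "\<dots> \<le> card ?M + (\<Sum>v\<in>V. card (?L v))"
    using card_Un_le[of ?M "\<Union>v\<in>V. ?L v"] card_UN_le[OF V(1), of ?L] by linarith
  finally have le: "card (?S - ?A) \<le> card ?M + (\<Sum>v\<in>V. card (?L v))" .
  have L: "(\<Sum>v\<in>V. real (card (?L v))) \<le> (\<Sum>v\<in>V. ?N * exp (- (2 * \<epsilon>\<^sup>2 * ?n)))"
    by (rule sum_mono) (rule card_large_degree_le[OF V(1) _ \<epsilon>])
  have "real (card (?S - ?A)) \<le> real (card ?M) + (\<Sum>v\<in>V. real (card (?L v)))"
    using of_nat_mono[OF le, where 'a = real] by (simp only: of_nat_add of_nat_sum)
  also have "\<dots> \<le> ?N * exp (- (?n / 256)) + (\<Sum>v\<in>V. ?N * exp (- (2 * \<epsilon>\<^sup>2 * ?n)))"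
    by (rule add_mono[OF card_small_degrees_le[OF V n] L])
  also have "\<dots> = ?N * (?n * exp (- (2 * \<epsilon>\<^sup>2 * ?n)) + exp (- (?n / 256)))" by (simp add: algebra_simps)
  finally have bad: "real (card (?S - ?A)) / ?N \<le> ?n * exp (- (2 * \<epsilon>\<^sup>2 * ?n)) + exp (- (?n / 256))"
    by (simp add: field_simps)
  have "card (?S - ?A) + card (?S \<inter> ?A) = card ?S"
    using card_Diff_subset_Int[of ?S ?A] card_mono[OF fS(1), of "?S \<inter> ?A"] fS(1) by simp
  then have "real (card (?S - ?A)) + real (card (?S \<inter> ?A)) = ?N" using cardS by linarith
  then have "real (card (?S \<inter> ?A)) / ?N = 1 - real (card (?S - ?A)) / ?N" by (simp add: field_simps)
  moreover have "measure_pmf.prob (pmf_of_set ?S) ?A = real (card (?S \<inter> ?A)) / ?N"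
    using measure_pmf_of_set[OF fS(2,1), of ?A] cardS by simp
  ultimately show ?thesis using bad by linarith
qed

lemma random_graph_max_degree:
  fixes \<epsilon> :: real
  assumes \<epsilon>: "\<epsilon> > 0"
  shows "\<exists>c>0. \<forall>\<^sub>F n in sequentially.
    measure_pmf.prob (pmf_of_set {G. simple_graph G \<and> verts G = {1..n :: nat}})
      {G. real n / 2 < real (max_degree G) \<and> real (max_degree G) < (1 / 2 + \<epsilon>) * real n} \<ge> 1 - exp (- c * real n)"
proof (intro exI conjI)
  define a where "a = \<epsilon>\<^sup>2"
  \<comment> \<open>Halving the exponents \<open>2 * a\<close> and 1/256 absorbs the factor
    \<open>n\<close> and leaves each of the two terms at most half of the target.\<close>
  define c where "c = min a (1 / 512)"
  have a: "a > 0" using \<epsilon> by (simp add: a_def)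
  show "c > 0" using a by (simp add: c_def)
  \<comment> \<open>For \<open>n \<ge> 64\<close> both sides are compared with
    \<open>sqrt n / 4\<close>.\<close>
  have 1: "\<forall>\<^sub>F n in sequentially. 1 + sqrt (real n) / 8 \<le> sqrt ((real n - 1) / 3) / 2"
    using eventually_ge_at_top[of 64]
  proof eventually_elim
    case (elim n)
    then have "sqrt (8\<^sup>2) \<le> sqrt (real n)" "sqrt (real n / 2\<^sup>2) \<le> sqrt ((real n - 1) / 3)"
      by (intro real_sqrt_le_mono; simp)+
    then show ?case unfolding real_sqrt_divide real_sqrt_abs by simp
  qed
  have 2: "\<forall>\<^sub>F n in sequentially. real n * exp (- (2 * a * real n)) \<le> exp (- (a * real n)) / 2" using a by real_asymp
  have 3: "\<forall>\<^sub>F n in sequentially. exp (- (real n / 256)) \<le> exp (- (real n / 512)) / 2" by real_asymp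
  show "\<forall>\<^sub>F n in sequentially. measure_pmf.prob (pmf_of_set {G. simple_graph G \<and> verts G = {1..n :: nat}})
      {G. real n / 2 < real (max_degree G) \<and> real (max_degree G) < (1 / 2 + \<epsilon>) * real n} \<ge> 1 - exp (- c * real n)"
    using 1 2 3 eventually_gt_at_top[of 0]
  proof eventually_elim
    case (elim n)
    have "c * real n \<le> a * real n" "c * real n \<le> real n / 512"
      using mult_right_mono[of c a "real n"] mult_right_mono[of c "1 / 512" "real n"] by (simp_all add: c_def)
    then have "exp (- (a * real n)) \<le> exp (- c * real n)" "exp (- (real n / 512)) \<le> exp (- c * real n)" by simp_all
    then have "real n * exp (- (2 * a * real n)) + exp (- (real n / 256)) \<le> exp (- c * real n)"
      using elim(2,3) by linarith
    moreover have "{1..n} \<noteq> {}" using elim(4) by auto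
    ultimately show ?case
      using prob_max_degree_ge[of "{1..n}" \<epsilon>] elim(1) \<epsilon> by (simp add: a_def)
  qed
qed

section \<open>The maximum degree of random graphs from the class\<close>

lemma card_max_degree_lt:
  assumes "\<And>G. G \<in> S \<Longrightarrow> simple_graph G \<and> verts G = V"
  shows "S \<inter> {G. max_degree G < k} \<subseteq> {G \<in> S. \<forall>v\<in>verts G. card (nbrs G v) < k}"
proof clarify
  fix V' F v assume "(V', F) \<in> S" and k: "max_degree (V', F) < k" and v: "v \<in> verts (V', F)"
  then have G: "simple_graph (V', F)" using assms by blast
  have "degree (V', F) v \<le> max_degree (V', F)"
    unfolding max_degree_def using v G by (intro Max_ge) (auto simp: simple_graph_def)
  then show "card (nbrs (V', F) v) < k" using k degree_eq_card_nbrs[OF G, of v] by simp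
qed

text \<open>The exponent is half the logarithm of \<open>n\<close> to base \<open>K\<close>, rounded
  up, so the power is at most \<open>K * sqrt n\<close> and the left side has order
  \<open>sqrt n * ln n\<close>.\<close>

lemma sublogarithmic_fraction:
  fixes K :: real
  assumes K: "K \<ge> 2" and \<delta>: "\<delta> > 0"
  shows "\<forall>\<^sub>F n in sequentially. n \<ge> 3 \<and> nat \<lceil>ln (real n) / (2 * ln K)\<rceil> \<ge> 4 \<and>
    2 * real (nat \<lceil>ln (real n) / (2 * ln K)\<rceil>) * K ^ nat \<lceil>ln (real n) / (2 * ln K)\<rceil> \<le> \<delta> * real n"
proof -
  have lK: "ln K > 0" using K by simp
  have 1: "\<forall>\<^sub>F n in sequentially. ln (real n) / (2 * ln K) \<ge> 4" using lK by real_asymp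
  have 2: "\<forall>\<^sub>F n in sequentially. 2 * (ln (real n) / (2 * ln K) + 1) * (K * sqrt (real n)) \<le> \<delta> * real n"
    using lK K \<delta> by real_asymp
  show ?thesis
    using 1 2 eventually_ge_at_top[of 3]
  proof eventually_elim
    case (elim n)
    let ?x = "ln (real n) / (2 * ln K)"
    have n: "real n > 0" using elim(3) by simp
    have k: "real (nat \<lceil>?x\<rceil>) = of_int \<lceil>?x\<rceil>" "of_int \<lceil>?x\<rceil> \<le> ?x + 1" using elim(1) by linarith+
    have "K ^ nat \<lceil>?x\<rceil> = K powr real (nat \<lceil>?x\<rceil>)" using K by (simp add: powr_realpow)
    also have "\<dots> \<le> K powr (?x + 1)" using k K by (intro powr_mono) auto
    also have "\<dots> = K powr ?x * K" using K by (simp add: powr_add)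
    also have "K powr ?x = exp (ln (real n) / 2)" using K lK by (simp add: powr_def)
    also have "\<dots> = sqrt (real n)" using n by (simp add: ln_sqrt[symmetric])
    finally have "2 * real (nat \<lceil>?x\<rceil>) * K ^ nat \<lceil>?x\<rceil> \<le> 2 * (?x + 1) * (K * sqrt (real n))"
      using k elim(1) K by (intro mult_mono) (auto simp: mult.commute)
    moreover have "4 \<le> nat \<lceil>?x\<rceil>" using elim(1) by linarith
    ultimately show ?case using elim(2,3) by linarith
  qed
qed

text \<open>The threshold for \<open>low_degree_fraction\<close> is \<open>c * ln n\<close> rounded
  up, so graphs that miss the logarithmic bound have all degrees below it. The estimate holds for
  all large \<open>n\<close> and reaches the limsup through the liminf.\<close>

lemma random_graph_logarithmic_degree:
  assumes D: "minor_closed D" "iso_closed D" "fan_closed D" "D \<noteq> {}" and G: "simple_graph G" "G \<notin> D" and \<epsilon>: "\<epsilon> > 0"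
  shows "\<exists>c>0. limsup (\<lambda>n. ereal (measure_pmf.prob (pmf_of_set (on_verts D {1..n})) {G. c * ln (real n) \<le> real (max_degree G)}))
    > ereal (1 - \<epsilon>)"
proof -
  obtain K0 :: nat where K0: "K0 \<ge> 1" "\<And>n k. n \<ge> 3 \<Longrightarrow> k \<ge> 4 \<Longrightarrow>
     card {G \<in> on_verts D {1..n}. \<forall>v\<in>verts G. card (nbrs G v) < k} * n \<le> 2 * k * K0 ^ k * card (on_verts D {1..n})"
    using low_degree_fraction[OF D G] by blast
  \<comment> \<open>At least 2, so that \<open>ln K\<close> is positive.\<close>
  define K where "K = real (max K0 2)"
  define c where "c = 1 / (2 * ln K)"
  have K: "K \<ge> 2" "K \<ge> real K0" by (simp_all add: K_def)
  have c: "c > 0" using K by (simp add: c_def)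
  let ?p = "\<lambda>n. measure_pmf.prob (pmf_of_set (on_verts D {1..n})) {G. c * ln (real n) \<le> real (max_degree G)}"
  \<comment> \<open>Aiming at half of \<open>\<epsilon>\<close> makes the final inequality
    strict.\<close>
  have "\<epsilon> / 2 > 0" using \<epsilon> by simp
  from sublogarithmic_fraction[OF K(1) this]
  have "\<forall>\<^sub>F n in sequentially. 1 - \<epsilon> / 2 \<le> ?p n"
  proof eventually_elim
    case (elim n)
    let ?S = "on_verts D {1..n}" and ?k = "nat \<lceil>ln (real n) / (2 * ln K)\<rceil>"
    let ?A = "{G. c * ln (real n) \<le> real (max_degree G)}"
    have n: "3 \<le> n" and k: "4 \<le> ?k" "2 * real ?k * K ^ ?k \<le> \<epsilon> / 2 * real n" using elim by blast+
    have S: "finite ?S" "?S \<noteq> {}"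
      using finite_on_verts[of D "{1..n}"] minor_closedD(1)[OF D(1)] on_verts_nonempty[OF D, of n] n by auto
    then have N: "real (card ?S) > 0" by (simp add: card_gt_0_iff)
    have "?S - ?A \<subseteq> ?S \<inter> {G. max_degree G < ?k}"
      unfolding c_def by (auto simp: not_le) linarith
    also have "\<dots> \<subseteq> {G \<in> ?S. \<forall>v\<in>verts G. card (nbrs G v) < ?k}"
      by (rule card_max_degree_lt[where V = "{1..n}"]) (use minor_closedD(1)[OF D(1)] in \<open>auto simp: on_verts_def\<close>)
    finally have "card (?S - ?A) \<le> card {G \<in> ?S. \<forall>v\<in>verts G. card (nbrs G v) < ?k}" using S(1) by (intro card_mono) auto
    then have "card (?S - ?A) * n \<le> 2 * ?k * K0 ^ ?k * card ?S" using K0(2)[OF n k(1)] mult_le_mono1 order_trans by blast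
    then have "real (card (?S - ?A) * n) \<le> real (2 * ?k * K0 ^ ?k * card ?S)" by (rule of_nat_mono)
    then have "real (card (?S - ?A)) * real n \<le> (2 * real ?k * real K0 ^ ?k) * real (card ?S)" by simp
    also have "\<dots> \<le> (2 * real ?k * K ^ ?k) * real (card ?S)"
      using K(2) by (intro mult_right_mono mult_left_mono power_mono) auto
    also have "\<dots> \<le> \<epsilon> / 2 * real n * real (card ?S)" using k(2) by (intro mult_right_mono) auto
    finally have "real (card (?S - ?A)) * real n \<le> (\<epsilon> / 2 * real (card ?S)) * real n" by (simp add: mult_ac)
    then have bad: "real (card (?S - ?A)) \<le> \<epsilon> / 2 * real (card ?S)" using n by simp
    have "card (?S - ?A) + card (?S \<inter> ?A) = card ?S"
      using card_Diff_subset_Int[of ?S ?A] card_mono[OF S(1), of "?S \<inter> ?A"] S(1) by simp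
    then have "real (card (?S - ?A)) + real (card (?S \<inter> ?A)) = real (card ?S)" by linarith
    then have "(1 - \<epsilon> / 2) * real (card ?S) \<le> real (card (?S \<inter> ?A))" using bad by (simp add: algebra_simps)
    then show "1 - \<epsilon> / 2 \<le> ?p n" using measure_pmf_of_set[OF S(2,1), of ?A] N by (simp add: pos_le_divide_eq)
  qed
  then have "ereal (1 - \<epsilon> / 2) \<le> liminf (\<lambda>n. ereal (?p n))" by (intro Liminf_bounded) (auto elim: eventually_mono)
  also have "\<dots> \<le> limsup (\<lambda>n. ereal (?p n))" by (rule Liminf_le_Limsup) simp
  finally have "ereal (1 - \<epsilon> / 2) \<le> limsup (\<lambda>n. ereal (?p n))" .
  moreover have "ereal (1 - \<epsilon>) < ereal (1 - \<epsilon> / 2)" using \<epsilon> by simp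
  ultimately have "ereal (1 - \<epsilon>) < limsup (\<lambda>n. ereal (?p n))" by (rule less_le_trans[rotated])
  with c show ?thesis by (intro exI[of _ c] conjI)
qed

theorem theorem39:
  fixes g :: "nat \<Rightarrow> nat" and \<A> :: "nat graph set" and R :: "nat \<Rightarrow> nat graph pmf"
  assumes "mono_on {1..} g"
    and "\<A> \<in> {E_class g, OE_class g, NE_class g, OE_class g \<inter> NE_class g}"
    and "\<And>n. R n = pmf_of_set (labelled (Minor \<A>) n)"
  shows "({G. simple_graph G} \<subseteq> \<A> \<longrightarrow>
           (\<forall>\<epsilon>::real. \<epsilon> > 0 \<longrightarrow>
             (\<exists>c::real. c > 0 \<and>
               (\<forall>\<^sub>F n in sequentially.
                  measure_pmf.prob (R n)
                    {G. real n / 2 < real (max_degree G) \<and>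
                        real (max_degree G) < (1 / 2 + \<epsilon>) * real n}
                  \<ge> 1 - exp (- c * real n))))) \<and>
         (\<not> {G. simple_graph G} \<subseteq> \<A> \<longrightarrow>
           (\<forall>\<epsilon>::real. \<epsilon> > 0 \<longrightarrow>
             (\<exists>c::real. c > 0 \<and>
               limsup (\<lambda>n. ereal (measure_pmf.prob (R n)
                                    {G. c * ln (real n) \<le> real (max_degree G)}))
               > ereal (1 - \<epsilon>))))"
proof (intro conjI impI allI)
  fix \<epsilon> :: real assume all: "{G. simple_graph G} \<subseteq> \<A>" and \<epsilon>: "\<epsilon> > 0"
  \<comment> \<open>Minors of simple graphs are simple, so \<open>R n\<close> is uniform on all
    graphs with vertex set \<open>{1..n}\<close>.\<close>
  have "Minor \<A> = {G. simple_graph G}"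
  proof (intro equalityI subsetI)
    show "G \<in> {G. simple_graph G}" if "G \<in> Minor \<A>" for G
      using minor_closedD(1)[OF minor_closed_Minor that] by (rule CollectI)
    fix G :: "nat graph" assume "G \<in> {G. simple_graph G}"
    then have G: "simple_graph G" by (rule CollectD)
    show "G \<in> Minor \<A>"
      unfolding Minor_def
    proof (intro CollectI conjI allI impI)
      fix H assume "minor H G"
      then have "H \<in> {G. simple_graph G}" using minor_simple G by (intro CollectI)
      then show "H \<in> \<A>" using all by (rule rev_subsetD)
    qed (rule G)
  qed
  then have "R n = pmf_of_set {G. simple_graph G \<and> verts G = {1..n}}" for n
    unfolding assms(3) labelled_def by simp
  then show "\<exists>c>0. \<forall>\<^sub>F n in sequentially. measure_pmf.prob (R n)
      {G. real n / 2 < real (max_degree G) \<and> real (max_degree G) < (1 / 2 + \<epsilon>) * real n} \<ge> 1 - exp (- c * real n)"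
    using random_graph_max_degree[OF \<epsilon>] by simp
next
  fix \<epsilon> :: real assume "\<not> {G. simple_graph G} \<subseteq> \<A>" and \<epsilon>: "\<epsilon> > 0"
  note M = Minor_properties[OF good_class_cases[OF assms(1,2)]]
  obtain G where "simple_graph G" "G \<notin> \<A>"
    using \<open>\<not> {G. simple_graph G} \<subseteq> \<A>\<close> unfolding subset_iff mem_Collect_eq by metis
  \<comment> \<open>A graph missing from \<open>\<A>\<close> is also missing from
    \<open>Minor \<A>\<close>, which is therefore a proper minor-closed class.\<close>
  then have G: "simple_graph G" "G \<notin> Minor \<A>" using contra_subsetD[OF M(5)] by simp_all
  have "R n = pmf_of_set (on_verts (Minor \<A>) {1..n})" for n
    unfolding assms(3) labelled_def on_verts_def ..
  then show "\<exists>c>0. limsup (\<lambda>n. ereal (measure_pmf.prob (R n) {G. c * ln (real n) \<le> real (max_degree G)})) > ereal (1 - \<epsilon>)"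
    using random_graph_logarithmic_degree[OF M(1-4) G \<epsilon>] by simp
qed

end
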